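(* Let $\Lambda$ be a ring that is Morita equivalent to its centre $R:=\zeta(\Lambda)$, and let $M$ be a finitely presented left $\Lambda$-module. Then the Fitting invariant $\mathrm{Fitt}_\Lambda(M):=\mathrm{Fitt}_R(P^{\ast}\otimes_\Lambda M)$ is well-defined; that is, for every $(\Lambda,R)$-progenerator $P$ the $R$-module $P^{\ast}\otimes_\Lambda M$ is finitely presented, and the $R$-ideal $\mathrm{Fitt}_R(P^{\ast}\otimes_\Lambda M)$ does not depend on the choice of $P$.
   Context: All rings are unitary. Two rings are Morita equivalent if their categories of left modules are equivalent. A progenerator for the category of right $R$-modules is a finitely generated projective right $R$-module $P$ such that $R_R$ is a direct summand of $P^n$ for some $n\in\mathbb{N}$. A $(\Lambda,R)$-progenerator is a $(\Lambda,R)$-bimodule $P$ such that $P_R$ (that is, $P$ considered as a right $R$-module) is a progenerator for right $R$-modules and the canonical ring homomorphism $\Lambda\to\mathrm{End}(P_R)$, $\lambda\mapsto(p\mapsto\lambda p)$, is an isomorphism. Put $P^{\ast}:=\mathrm{Hom}_R(P_R,R_R)$, an $(R,\Lambda)$-bimodule via $(rq)(p)=r\,q(p)$ and $(q\lambda)(p)=q(\lambda p)$ for $r\in R$, $q\in P^{\ast}$, $p\in P$, $\lambda\in\Lambda$. When $\Lambda$ is Morita equivalent to $R$, there exists a $(\Lambda,R)$-progenerator $P$ such that $F\colon M\mapsto P^{\ast}\otimes_\Lambda M$ (from left $\Lambda$-modules to left $R$-modules) and $G\colon N\mapsto P\otimes_R N$ are mutually inverse category equivalences; the isomorphism classes of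 category equivalences from left $R$-modules to left $\Lambda$-modules are in one-one correspondence with the isomorphism classes of $(\Lambda,R)$-progenerators. For a commutative ring $R$ and a finitely presented $R$-module $N$ with finite presentation $R^a\xrightarrow{h}R^b\to N\to 0$ ($a,b$ positive integers), $\mathrm{Fitt}_R(N)$ is the (zeroth) Fitting ideal: the ideal of $R$ generated by all $b\times b$ minors of $h$ if $a\geq b$, and $0$ if $a<b$. It is independent of the choice of $h$.
   Formalization: Independence of P is shown for progenerators on which the centre R acts equally from left (through Λ) and right; without this it fails (Λ=R=ℚ×ℚ, right action twisted by the swap, M=ℚ×0). Finite presentation is shown for every progenerator. *)

theory Defs
  imports "HOL-Algebra.Algebra" "HOL-Combinatorics.Permutations"
begin

section \<open>Modules and bimodules over noncommutative rings\<close>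

text \<open>
  The modules of \<^theory>\<open>HOL-Algebra.Module\<close> are over commutative rings. As there, the
  multiplicative fields of a record that represents a module carry no meaning; all homomorphisms
  are extensional, so that they are determined by their values on the carrier.
\<close>

locale left_module = R: ring R + M: abelian_group M
  for R :: "('a, 'x) ring_scheme" (structure) and M :: "('a, 'm, 'y) module_scheme" (structure) +
  assumes smult_closed:
      "\<lbrakk>r \<in> carrier R; x \<in> carrier M\<rbrakk> \<Longrightarrow> r \<odot>\<^bsub>M\<^esub> x \<in> carrier M"
    and smult_l_distr:
      "\<lbrakk>r \<in> carrier R; s \<in> carrier R; x \<in> carrier M\<rbrakk> \<Longrightarrow>
       (r \<oplus>\<^bsub>R\<^esub> s) \<odot>\<^bsub>M\<^esub> x = r \<odot>\<^bsub>M\<^esub> x \<oplus>\<^bsub>M\<^esub> s \<odot>\<^bsub>M\<^esub> x"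
    and smult_r_distr:
      "\<lbrakk>r \<in> carrier R; x \<in> carrier M; y \<in> carrier M\<rbrakk> \<Longrightarrow>
       r \<odot>\<^bsub>M\<^esub> (x \<oplus>\<^bsub>M\<^esub> y) = r \<odot>\<^bsub>M\<^esub> x \<oplus>\<^bsub>M\<^esub> r \<odot>\<^bsub>M\<^esub> y"
    and smult_assoc:
      "\<lbrakk>r \<in> carrier R; s \<in> carrier R; x \<in> carrier M\<rbrakk> \<Longrightarrow>
       (r \<otimes>\<^bsub>R\<^esub> s) \<odot>\<^bsub>M\<^esub> x = r \<odot>\<^bsub>M\<^esub> (s \<odot>\<^bsub>M\<^esub> x)"
    and smult_one: "x \<in> carrier M \<Longrightarrow> \<one>\<^bsub>R\<^esub> \<odot>\<^bsub>M\<^esub> x = x"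

lemma left_module_iff_module: "cring R \<Longrightarrow> left_module R M \<longleftrightarrow> module R M"
  by (auto simp: left_module_def left_module_axioms_def module_def module_axioms_def cring_def)

record ('l, 'b, 'r) bimodule = "('l, 'b) module" +
  rsmult :: "'b \<Rightarrow> 'r \<Rightarrow> 'b"  (infixl \<open>\<bullet>\<index>\<close> 70)

text \<open>
  A right module is a bimodule record whose left multiplication is disregarded; thus
  the right module underlying a bimodule needs no separate notation.
\<close>

locale right_module = R: ring R + P: abelian_group P
  for R :: "('r, 'x) ring_scheme" (structure) and P :: "('l, 'p, 'r, 'y) bimodule_scheme" (structure) +
  assumes rsmult_closed:
      "\<lbrakk>p \<in> carrier P; r \<in> carrier R\<rbrakk> \<Longrightarrow> p \<bullet>\<^bsub>P\<^esub> r \<in> carrier P"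
    and rsmult_l_distr:
      "\<lbrakk>p \<in> carrier P; q \<in> carrier P; r \<in> carrier R\<rbrakk> \<Longrightarrow>
       (p \<oplus>\<^bsub>P\<^esub> q) \<bullet>\<^bsub>P\<^esub> r = p \<bullet>\<^bsub>P\<^esub> r \<oplus>\<^bsub>P\<^esub> q \<bullet>\<^bsub>P\<^esub> r"
    and rsmult_r_distr:
      "\<lbrakk>p \<in> carrier P; r \<in> carrier R; s \<in> carrier R\<rbrakk> \<Longrightarrow>
       p \<bullet>\<^bsub>P\<^esub> (r \<oplus>\<^bsub>R\<^esub> s) = p \<bullet>\<^bsub>P\<^esub> r \<oplus>\<^bsub>P\<^esub> p \<bullet>\<^bsub>P\<^esub> s"
    and rsmult_assoc:
      "\<lbrakk>p \<in> carrier P; r \<in> carrier R; s \<in> carrier R\<rbrakk> \<Longrightarrow>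
       p \<bullet>\<^bsub>P\<^esub> (r \<otimes>\<^bsub>R\<^esub> s) = (p \<bullet>\<^bsub>P\<^esub> r) \<bullet>\<^bsub>P\<^esub> s"
    and rsmult_one: "p \<in> carrier P \<Longrightarrow> p \<bullet>\<^bsub>P\<^esub> \<one>\<^bsub>R\<^esub> = p"

locale bimodule = L: left_module L P + R: right_module R P
  for L :: "('l, 'x) ring_scheme" (structure) and R :: "('r, 'y) ring_scheme" (structure)
    and P :: "('l, 'p, 'r, 'z) bimodule_scheme" (structure) +
  assumes smult_rsmult:
    "\<lbrakk>l \<in> carrier L; p \<in> carrier P; r \<in> carrier R\<rbrakk> \<Longrightarrow>
     (l \<odot>\<^bsub>P\<^esub> p) \<bullet>\<^bsub>P\<^esub> r = l \<odot>\<^bsub>P\<^esub> (p \<bullet>\<^bsub>P\<^esub> r)"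

definition left_hom ::
  "('a, 'x) ring_scheme \<Rightarrow> ('a, 'm, 'y) module_scheme \<Rightarrow> ('a, 'n, 'z) module_scheme \<Rightarrow> ('m \<Rightarrow> 'n) set"
  where "left_hom R M N =
    {f \<in> carrier M \<rightarrow>\<^sub>E carrier N.
      (\<forall>x\<in>carrier M. \<forall>y\<in>carrier M. f (x \<oplus>\<^bsub>M\<^esub> y) = f x \<oplus>\<^bsub>N\<^esub> f y) \<and>
      (\<forall>r\<in>carrier R. \<forall>x\<in>carrier M. f (r \<odot>\<^bsub>M\<^esub> x) = r \<odot>\<^bsub>N\<^esub> f x)}"

definition right_hom ::
  "('r, 'x) ring_scheme \<Rightarrow> ('k, 'p, 'r, 'y) bimodule_scheme \<Rightarrow> ('l, 'q, 'r, 'z) bimodule_scheme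
    \<Rightarrow> ('p \<Rightarrow> 'q) set"
  where "right_hom R P Q =
    {f \<in> carrier P \<rightarrow>\<^sub>E carrier Q.
      (\<forall>x\<in>carrier P. \<forall>y\<in>carrier P. f (x \<oplus>\<^bsub>P\<^esub> y) = f x \<oplus>\<^bsub>Q\<^esub> f y) \<and>
      (\<forall>x\<in>carrier P. \<forall>r\<in>carrier R. f (x \<bullet>\<^bsub>P\<^esub> r) = f x \<bullet>\<^bsub>Q\<^esub> r)}"

definition regular_bimodule :: "('a, 'x) ring_scheme \<Rightarrow> ('a, 'a, 'a) bimodule"
  where "regular_bimodule R =
    \<lparr>carrier = carrier R, monoid.mult = (\<otimes>\<^bsub>R\<^esub>), monoid.one = \<one>\<^bsub>R\<^esub>,
     ring.zero = \<zero>\<^bsub>R\<^esub>, ring.add = (\<oplus>\<^bsub>R\<^esub>),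
     smult = (\<otimes>\<^bsub>R\<^esub>), rsmult = (\<otimes>\<^bsub>R\<^esub>)\<rparr>"

definition direct_sum_power :: "'i set \<Rightarrow> ('l, 'b, 'r, 'x) bimodule_scheme \<Rightarrow> ('l, 'i \<Rightarrow> 'b, 'r) bimodule"
  where "direct_sum_power I P =
    \<lparr>carrier = {f \<in> I \<rightarrow>\<^sub>E carrier P. finite {i \<in> I. f i \<noteq> \<zero>\<^bsub>P\<^esub>}},
     monoid.mult = undefined, monoid.one = undefined,
     ring.zero = (\<lambda>i\<in>I. \<zero>\<^bsub>P\<^esub>), ring.add = (\<lambda>f g. \<lambda>i\<in>I. f i \<oplus>\<^bsub>P\<^esub> g i),
     smult = (\<lambda>l f. \<lambda>i\<in>I. l \<odot>\<^bsub>P\<^esub> f i), rsmult = (\<lambda>f r. \<lambda>i\<in>I. f i \<bullet>\<^bsub>P\<^esub> r)\<rparr>"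

abbreviation finite_power :: "('l, 'b, 'r, 'x) bimodule_scheme \<Rightarrow> nat \<Rightarrow> ('l, nat \<Rightarrow> 'b, 'r) bimodule"
  where "finite_power P n \<equiv> direct_sum_power {..<n} P"


section \<open>Progenerators\<close>

definition right_submodule :: "('r, 'x) ring_scheme \<Rightarrow> ('l, 'p, 'r, 'y) bimodule_scheme \<Rightarrow> 'p set \<Rightarrow> bool"
  where "right_submodule R P U \<longleftrightarrow>
    subgroup U (add_monoid P) \<and> (\<forall>u\<in>U. \<forall>r\<in>carrier R. u \<bullet>\<^bsub>P\<^esub> r \<in> U)"

definition right_finitely_generated ::
  "('r, 'x) ring_scheme \<Rightarrow> ('l, 'p, 'r, 'y) bimodule_scheme \<Rightarrow> bool"
  where "right_finitely_generated R P \<longleftrightarrow>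
    (\<exists>S. finite S \<and> S \<subseteq> carrier P \<and> (\<forall>U. right_submodule R P U \<and> S \<subseteq> U \<longrightarrow> U = carrier P))"

definition is_right_direct_summand ::
  "('r, 'x) ring_scheme \<Rightarrow> ('k, 'p, 'r, 'y) bimodule_scheme \<Rightarrow> ('l, 'q, 'r, 'z) bimodule_scheme \<Rightarrow> bool"
  where "is_right_direct_summand R P Q \<longleftrightarrow>
    (\<exists>U V. right_submodule R Q U \<and> right_submodule R Q V \<and>
       U \<inter> V = {\<zero>\<^bsub>Q\<^esub>} \<and> U <+>\<^bsub>Q\<^esub> V = carrier Q \<and>
       (\<exists>f \<in> right_hom R P (Q\<lparr>carrier := U\<rparr>). bij_betw f (carrier P) U))"

text \<open>
  Projective means: isomorphic to a direct summand of a free module. Requiring the basis of the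
  free module to lie in the type \<^typ>\<open>'p\<close> of elements of the module is no restriction: if $P$ is a
  direct summand of any free module, then the canonical surjection onto $P$ from the free module
  on the set of elements of $P$ splits.
\<close>

definition right_projective :: "('r, 'x) ring_scheme \<Rightarrow> ('l, 'p, 'r, 'y) bimodule_scheme \<Rightarrow> bool"
  where "right_projective R P \<longleftrightarrow>
    (\<exists>B :: 'p set. is_right_direct_summand R P (direct_sum_power B (regular_bimodule R)))"

definition right_progenerator :: "('r, 'x) ring_scheme \<Rightarrow> ('l, 'p, 'r, 'y) bimodule_scheme \<Rightarrow> bool"
  where "right_progenerator R P \<longleftrightarrow>
    right_module R P \<and> right_finitely_generated R P \<and> right_projective R P \<and>
    (\<exists>n. is_right_direct_summand R (regular_bimodule R) (finite_power P n))"

definition right_End :: "('r, 'x) ring_scheme \<Rightarrow> ('l, 'p, 'r, 'y) bimodule_scheme \<Rightarrow> ('p \<Rightarrow> 'p) ring"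
  where "right_End R P =
    \<lparr>carrier = right_hom R P P, monoid.mult = compose (carrier P), monoid.one = (\<lambda>p\<in>carrier P. p),
     ring.zero = (\<lambda>p\<in>carrier P. \<zero>\<^bsub>P\<^esub>), ring.add = (\<lambda>f g. \<lambda>p\<in>carrier P. f p \<oplus>\<^bsub>P\<^esub> g p)\<rparr>"

definition progenerator ::
  "('l, 'x) ring_scheme \<Rightarrow> ('r, 'y) ring_scheme \<Rightarrow> ('l, 'p, 'r, 'z) bimodule_scheme \<Rightarrow> bool"
  where "progenerator L R P \<longleftrightarrow>
    bimodule L R P \<and> right_progenerator R P \<and>
    (\<lambda>l. \<lambda>p\<in>carrier P. l \<odot>\<^bsub>P\<^esub> p) \<in> ring_iso L (right_End R P)"

definition dual_bimodule ::
  "('r, 'x) ring_scheme \<Rightarrow> ('l, 'p, 'r, 'y) bimodule_scheme \<Rightarrow> ('r, 'p \<Rightarrow> 'r, 'l) bimodule"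
  where "dual_bimodule R P =
    \<lparr>carrier = right_hom R P (regular_bimodule R), monoid.mult = undefined, monoid.one = undefined,
     ring.zero = (\<lambda>p\<in>carrier P. \<zero>\<^bsub>R\<^esub>), ring.add = (\<lambda>f g. \<lambda>p\<in>carrier P. f p \<oplus>\<^bsub>R\<^esub> g p),
     smult = (\<lambda>r q. \<lambda>p\<in>carrier P. r \<otimes>\<^bsub>R\<^esub> q p),
     rsmult = (\<lambda>q l. \<lambda>p\<in>carrier P. q (l \<odot>\<^bsub>P\<^esub> p))\<rparr>"


section \<open>The tensor product of a bimodule and a left module\<close>

definition tensor_relations ::
  "('l, 'x) ring_scheme \<Rightarrow> ('r, 'q, 'l, 'y) bimodule_scheme \<Rightarrow> ('l, 'm, 'z) module_scheme
    \<Rightarrow> ('q \<times> 'm \<Rightarrow>\<^sub>0 int) set"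
  where "tensor_relations L Q M =
    {frag_of (p \<oplus>\<^bsub>Q\<^esub> q, x) - frag_of (p, x) - frag_of (q, x) | p q x.
       p \<in> carrier Q \<and> q \<in> carrier Q \<and> x \<in> carrier M} \<union>
    {frag_of (q, x \<oplus>\<^bsub>M\<^esub> y) - frag_of (q, x) - frag_of (q, y) | q x y.
       q \<in> carrier Q \<and> x \<in> carrier M \<and> y \<in> carrier M} \<union>
    {frag_of (q \<bullet>\<^bsub>Q\<^esub> l, x) - frag_of (q, l \<odot>\<^bsub>M\<^esub> x) | q l x.
       q \<in> carrier Q \<and> l \<in> carrier L \<and> x \<in> carrier M}"

text \<open>
  The quotient of the free abelian group on pairs by the subgroup generated by the relations.
  A scalar acts on a coset by acting on the first component of the generators in each (equivalently,
  any) representative.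
\<close>

definition tensor_product ::
  "('l, 'x) ring_scheme \<Rightarrow> ('r, 'q, 'l, 'y) bimodule_scheme \<Rightarrow> ('l, 'm, 'z) module_scheme
    \<Rightarrow> ('r, ('q \<times> 'm \<Rightarrow>\<^sub>0 int) set) module"
  where "tensor_product L Q M =
    (let G = free_Abelian_group (carrier Q \<times> carrier M);
         K = generate G (tensor_relations L Q M)
     in \<lparr>carrier = carrier (G Mod K), monoid.mult = undefined, monoid.one = undefined,
         ring.zero = \<one>\<^bsub>G Mod K\<^esub>, ring.add = (\<otimes>\<^bsub>G Mod K\<^esub>),
         smult = (\<lambda>r C. \<Union>c\<in>C. K #>\<^bsub>G\<^esub> frag_extend (\<lambda>(q, x). frag_of (r \<odot>\<^bsub>Q\<^esub> q, x)) c)\<rparr>)"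


section \<open>Finite presentations and Fitting ideals\<close>

definition finite_presentation ::
  "('a, 'x) ring_scheme \<Rightarrow> ('a, 'm, 'y) module_scheme \<Rightarrow> nat \<Rightarrow> nat
    \<Rightarrow> ((nat \<Rightarrow> 'a) \<Rightarrow> nat \<Rightarrow> 'a) \<Rightarrow> ((nat \<Rightarrow> 'a) \<Rightarrow> 'm) \<Rightarrow> bool"
  where "finite_presentation R M a b h \<pi> \<longleftrightarrow>
    (let A = finite_power (regular_bimodule R) a; B = finite_power (regular_bimodule R) b
     in a > 0 \<and> b > 0 \<and> h \<in> left_hom R A B \<and> \<pi> \<in> left_hom R B M \<and>
        \<pi> ` carrier B = carrier M \<and> h ` carrier A = {x \<in> carrier B. \<pi> x = \<zero>\<^bsub>M\<^esub>})"

definition finitely_presented :: "('a, 'x) ring_scheme \<Rightarrow> ('a, 'm, 'y) module_scheme \<Rightarrow> bool"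
  where "finitely_presented R M \<longleftrightarrow>
    left_module R M \<and> (\<exists>a b h \<pi>. finite_presentation R M a b h \<pi>)"

definition determinant :: "('a, 'x) ring_scheme \<Rightarrow> nat \<Rightarrow> (nat \<Rightarrow> nat \<Rightarrow> 'a) \<Rightarrow> 'a"
  where "determinant R n A =
    (\<Oplus>\<^bsub>R\<^esub>\<sigma>\<in>{\<sigma>. \<sigma> permutes {..<n}}.
       (if evenperm \<sigma> then \<one>\<^bsub>R\<^esub> else \<ominus>\<^bsub>R\<^esub> \<one>\<^bsub>R\<^esub>) \<otimes>\<^bsub>R\<^esub> (\<Otimes>\<^bsub>R\<^esub>i\<in>{..<n}. A i (\<sigma> i)))"

definition matrix_entry ::
  "('a, 'x) ring_scheme \<Rightarrow> nat \<Rightarrow> ((nat \<Rightarrow> 'a) \<Rightarrow> nat \<Rightarrow> 'a) \<Rightarrow> nat \<Rightarrow> nat \<Rightarrow> 'a"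
  where "matrix_entry R a h i j = h (\<lambda>k\<in>{..<a}. if k = j then \<one>\<^bsub>R\<^esub> else \<zero>\<^bsub>R\<^esub>) i"

definition maximal_minors ::
  "('a, 'x) ring_scheme \<Rightarrow> nat \<Rightarrow> nat \<Rightarrow> ((nat \<Rightarrow> 'a) \<Rightarrow> nat \<Rightarrow> 'a) \<Rightarrow> 'a set"
  where "maximal_minors R a b h =
    {determinant R b (\<lambda>i j. matrix_entry R a h i (c j)) | c.
       strict_mono_on {..<b} c \<and> c ` {..<b} \<subseteq> {..<a}}"

definition presentation_fitting_ideal ::
  "('a, 'x) ring_scheme \<Rightarrow> nat \<Rightarrow> nat \<Rightarrow> ((nat \<Rightarrow> 'a) \<Rightarrow> nat \<Rightarrow> 'a) \<Rightarrow> 'a set"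
  where "presentation_fitting_ideal R a b h =
    (if a \<ge> b then Idl\<^bsub>R\<^esub> (maximal_minors R a b h) else {\<zero>\<^bsub>R\<^esub>})"

definition fitting_ideal :: "('a, 'x) ring_scheme \<Rightarrow> ('a, 'm, 'y) module_scheme \<Rightarrow> 'a set"
  where "fitting_ideal R M =
    (THE I. \<exists>a b h \<pi>. finite_presentation R M a b h \<pi> \<and> I = presentation_fitting_ideal R a b h)"


section \<open>Morita equivalence\<close>

definition left_modules :: "('a, 'x) ring_scheme \<Rightarrow> ('a, 'u) module set"
  where "left_modules R = {M. left_module R M}"

definition module_functor ::
  "('a, 'x) ring_scheme \<Rightarrow> ('b, 'y) ring_scheme \<Rightarrow> (('a, 'u) module \<Rightarrow> ('b, 'v) module) \<Rightarrow>
   (('a, 'u) module \<Rightarrow> ('a, 'u) module \<Rightarrow> ('u \<Rightarrow> 'u) \<Rightarrow> 'v \<Rightarrow> 'v) \<Rightarrow> bool"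
  where "module_functor R S Fo Fm \<longleftrightarrow>
    (\<forall>M\<in>left_modules R. Fo M \<in> left_modules S) \<and>
    (\<forall>M\<in>left_modules R. \<forall>N\<in>left_modules R. \<forall>f\<in>left_hom R M N.
       Fm M N f \<in> left_hom S (Fo M) (Fo N)) \<and>
    (\<forall>M\<in>left_modules R. Fm M M (\<lambda>x\<in>carrier M. x) = (\<lambda>x\<in>carrier (Fo M). x)) \<and>
    (\<forall>M\<in>left_modules R. \<forall>N\<in>left_modules R. \<forall>L\<in>left_modules R.
       \<forall>f\<in>left_hom R M N. \<forall>g\<in>left_hom R N L.
         Fm M L (compose (carrier M) g f) = compose (carrier (Fo M)) (Fm N L g) (Fm M N f))"

text \<open>
  The endofunctor of the category of left \<open>R\<close>-modules given by \<open>To\<close> and \<open>Tm\<close> is naturally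
  isomorphic to the identity functor. Bijective homomorphisms are the isomorphisms of modules.
\<close>

definition naturally_iso_identity ::
  "('a, 'x) ring_scheme \<Rightarrow> (('a, 'u) module \<Rightarrow> ('a, 'u) module) \<Rightarrow>
   (('a, 'u) module \<Rightarrow> ('a, 'u) module \<Rightarrow> ('u \<Rightarrow> 'u) \<Rightarrow> 'u \<Rightarrow> 'u) \<Rightarrow> bool"
  where "naturally_iso_identity R To Tm \<longleftrightarrow>
    (\<exists>\<eta>. (\<forall>M\<in>left_modules R.
            \<eta> M \<in> left_hom R M (To M) \<and> bij_betw (\<eta> M) (carrier M) (carrier (To M))) \<and>
         (\<forall>M\<in>left_modules R. \<forall>N\<in>left_modules R. \<forall>f\<in>left_hom R M N.
            compose (carrier M) (\<eta> N) f = compose (carrier M) (Tm M N f) (\<eta> M)))"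

text \<open>
  The categories of left modules must be restricted to modules whose elements lie in a fixed type.
  The type \<^typ>\<open>'a + 'b + nat\<close> is large enough for the resulting notion to be Morita equivalence.
  Its cardinality $\kappa$ is infinite and at least that of either ring. So every
  $(S,R)$-progenerator $P$ yields functors $P \otimes_R -$ and $P^* \otimes_S -$ between modules
  of at most $\kappa$ elements. Conversely, an equivalence between these restricted categories
  sends the regular module to a finitely generated projective generator with the same endomorphism
  ring, because direct sums of at most $\kappa$ such modules and all their quotients again have at
  most $\kappa$ elements.
\<close>

definition morita_equivalent :: "('a, 'x) ring_scheme \<Rightarrow> ('b, 'y) ring_scheme \<Rightarrow> bool"
  where "morita_equivalent R S \<longleftrightarrow>
    (\<exists>(Fo :: ('a, 'a + 'b + nat) module \<Rightarrow> ('b, 'a + 'b + nat) module) Fm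
      (Go :: ('b, 'a + 'b + nat) module \<Rightarrow> ('a, 'a + 'b + nat) module) Gm.
        module_functor R S Fo Fm \<and> module_functor S R Go Gm \<and>
        naturally_iso_identity R (\<lambda>M. Go (Fo M)) (\<lambda>M N f. Gm (Fo M) (Fo N) (Fm M N f)) \<and>
        naturally_iso_identity S (\<lambda>N. Fo (Go N)) (\<lambda>M N g. Fm (Go M) (Go N) (Gm M N g)))"


section \<open>The Fitting invariant\<close>

definition ring_centre :: "('a, 'x) ring_scheme \<Rightarrow> ('a, 'x) ring_scheme"
  where "ring_centre R =
    R\<lparr>carrier := {z \<in> carrier R. \<forall>x\<in>carrier R. z \<otimes>\<^bsub>R\<^esub> x = x \<otimes>\<^bsub>R\<^esub> z}\<rparr>"

text \<open>
  The left action of the centre through \<open>L\<close> and the right action of the centre agree, i.e. \<open>P\<close> is a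
  bimodule of algebras over the centre. In general they differ by an automorphism of the centre.
\<close>

definition centre_balanced :: "('a, 'x) ring_scheme \<Rightarrow> ('a, 'p, 'a, 'y) bimodule_scheme \<Rightarrow> bool"
  where "centre_balanced L P \<longleftrightarrow>
    (\<forall>z\<in>carrier (ring_centre L). \<forall>p\<in>carrier P. z \<odot>\<^bsub>P\<^esub> p = p \<bullet>\<^bsub>P\<^esub> z)"

definition dual_tensor ::
  "('a, 'x) ring_scheme \<Rightarrow> ('a, 'p, 'a, 'y) bimodule_scheme \<Rightarrow> ('a, 'm, 'z) module_scheme
    \<Rightarrow> ('a, (('p \<Rightarrow> 'a) \<times> 'm \<Rightarrow>\<^sub>0 int) set) module"
  where "dual_tensor L P M = tensor_product L (dual_bimodule (ring_centre L) P) M"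

definition fitting_invariant ::
  "('a, 'x) ring_scheme \<Rightarrow> ('a, 'p, 'a, 'y) bimodule_scheme \<Rightarrow> ('a, 'm, 'z) module_scheme \<Rightarrow> 'a set"
  where "fitting_invariant L P M = fitting_ideal (ring_centre L) (dual_tensor L P M)"

end

theory Submission
  imports Defs
begin

text \<open>
Let \<open>R\<close> be the centre of \<open>\<Lambda>\<close>. Two progenerators \<open>P\<close> and \<open>Q\<close> on which the centre acts equally from
both sides differ by an invertible \<open>R\<close>-module. Hence $P^* \otimes_\Lambda M$ and
$Q^* \otimes_\Lambda M$ need not be isomorphic, but they are so locally on the spectrum of \<open>R\<close>, and
Fitting ideals are local. The proof replaces localization by explicit elements.

Finite projectivity of \<open>P\<close> gives a dual basis: $p = \sum_j a_j b_j(p)$ with $a_j \in P$,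
$b_j \in P^*$ (\<open>right_progenerator_dual_basis\<close>). The generator property of \<open>Q\<close> gives $x_k \in Q$,
$y_k \in Q^*$ with $\sum_k y_k(x_k) = 1$ (\<open>right_progenerator_trace\<close>). As \<open>\<Lambda>\<close> is the
endomorphism ring of either module, the endomorphism $x' \mapsto x y(x')$ is the action of an
element $[x,y]$ of \<open>\<Lambda>\<close>. Put
$u_{jk} : Q \to P$, $x \mapsto [x,y_k] a_j$, and $v_{jk} : P \to Q$, $p \mapsto [p,b_j] x_k$.
These are bimodule maps. The composite $v_{jk} u_{jk}$ commutes with \<open>\<Lambda>\<close>, so it is
multiplication by some $z_{jk} \in R$, and
$\sum_{j,k} [x,y_k] [a_j,b_j] x_k = \sum_k x y_k(x_k) = x$ shows that the $z_{jk}$ sum to one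
(\<open>balanced_progenerators_local_maps\<close>). Dualizing and tensoring yields \<open>R\<close>-linear maps \<open>f\<close> from
$P^* \otimes_\Lambda M$ to $Q^* \otimes_\Lambda M$ and \<open>g\<close> back such that $f \circ g$ is
multiplication by $z_{jk}$.

Over the commutative ring \<open>R\<close>, the Fitting ideal is described by a finite generating family alone:
it is generated by the determinants of all square matrices whose rows are relations of the family.
This agrees with the maximal minors of any presentation (\<open>family_fitting_presents\<close>). If
$f \circ g$ is multiplication by \<open>c\<close>, a block triangular matrix shows that a power of \<open>c\<close> carries the
Fitting ideal of the source of \<open>f\<close> into that of its target (\<open>family_fitting_transfer\<close>). For identity
maps this is Fitting's lemma, that the ideal depends on the module only. For the maps above it gives
one inclusion of the two Fitting invariants, because powers of the $z_{jk}$ still generate the unit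
ideal; the other inclusion holds by symmetry.

Finally, if $m_i$ generate \<open>M\<close>, then the $b_j \otimes m_i$ generate $P^* \otimes_\Lambda M$. Finitely
many relations suffice: those that express that the $b_j$ span a direct summand of a free module, and
those induced by relations between the $m_i$. The universal property of the tensor product shows that
there are no others (\<open>finitely_presented_dual_tensor\<close>).
\<close>

section \<open>Determinants over a commutative ring\<close>

lemma (in abelian_monoid) finsum_Times:
  assumes "finite A" "finite B" "\<And>i j. i \<in> A \<Longrightarrow> j \<in> B \<Longrightarrow> f i j \<in> carrier G"
  shows "(\<Oplus>p\<in>A \<times> B. f (fst p) (snd p)) = (\<Oplus>i\<in>A. \<Oplus>j\<in>B. f i j)"
  using assms(1,3)
proof (induction A)
  case empty
  then show ?case by simp
next
  case (insert a A)
  have "insert a A \<times> B = Pair a ` B \<union> A \<times> B" by auto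
  moreover have "(\<Oplus>p\<in>Pair a ` B. f (fst p) (snd p)) = (\<Oplus>j\<in>B. f a j)"
    using insert.prems by (subst finsum_reindex) (auto simp: inj_on_def)
  moreover have "(\<Oplus>p\<in>Pair a ` B \<union> A \<times> B. f (fst p) (snd p)) =
      (\<Oplus>p\<in>Pair a ` B. f (fst p) (snd p)) \<oplus> (\<Oplus>p\<in>A \<times> B. f (fst p) (snd p))"
    using insert \<open>finite B\<close> by (intro finsum_Un_disjoint) auto
  ultimately show ?case
    using insert by (simp add: Pi_def)
qed

lemma (in abelian_monoid) finsum_swap:
  assumes "finite A" "finite B" "\<And>i j. i \<in> A \<Longrightarrow> j \<in> B \<Longrightarrow> f i j \<in> carrier G"
  shows "(\<Oplus>i\<in>A. \<Oplus>j\<in>B. f i j) = (\<Oplus>j\<in>B. \<Oplus>i\<in>A. f i j)"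
  using assms(1,3)
proof (induction A)
  case (insert a A)
  then show ?case using \<open>finite B\<close> by (simp add: finsum_addf Pi_def cong: finsum_cong)
qed simp

lemma (in cring) finprod_finsum_distrib:
  assumes "finite I" "finite K" "\<And>i k. i \<in> I \<Longrightarrow> k \<in> K \<Longrightarrow> f i k \<in> carrier R"
  shows "(\<Otimes>i\<in>I. \<Oplus>k\<in>K. f i k) = (\<Oplus>c\<in>I \<rightarrow>\<^sub>E K. \<Otimes>i\<in>I. f i (c i))"
  using assms(1,3)
proof (induction I)
  case empty
  then show ?case by simp
next
  case (insert a I)
  have fin: "finite (I \<rightarrow>\<^sub>E K)" using insert assms by (simp add: finite_PiE)
  have cl: "(\<Otimes>i\<in>I. f i (c i)) \<in> carrier R" if "c \<in> I \<rightarrow>\<^sub>E K" for c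
    using that insert.prems by (intro finprod_closed) (auto simp: PiE_def Pi_def)
  have "(\<Otimes>i\<in>insert a I. \<Oplus>k\<in>K. f i k) = (\<Oplus>k\<in>K. f a k) \<otimes> (\<Oplus>c\<in>I \<rightarrow>\<^sub>E K. \<Otimes>i\<in>I. f i (c i))"
    using insert by simp
  also have "\<dots> = (\<Oplus>k\<in>K. f a k \<otimes> (\<Oplus>c\<in>I \<rightarrow>\<^sub>E K. \<Otimes>i\<in>I. f i (c i)))"
    using insert assms cl by (intro finsum_ldistr) auto
  also have "\<dots> = (\<Oplus>k\<in>K. \<Oplus>c\<in>I \<rightarrow>\<^sub>E K. f a k \<otimes> (\<Otimes>i\<in>I. f i (c i)))"
    using insert cl fin by (intro finsum_cong') (auto intro!: finsum_rdistr)
  also have "\<dots> = (\<Oplus>p\<in>K \<times> (I \<rightarrow>\<^sub>E K). f a (fst p) \<otimes> (\<Otimes>i\<in>I. f i (snd p i)))"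
    using insert cl fin assms by (intro finsum_Times[symmetric]) auto
  also have "\<dots> = (\<Oplus>p\<in>K \<times> (I \<rightarrow>\<^sub>E K). \<Otimes>i\<in>insert a I. f i (((snd p)(a := fst p)) i))"
  proof (intro finsum_cong' refl)
    fix p assume p: "p \<in> K \<times> (I \<rightarrow>\<^sub>E K)"
    have "(\<Otimes>i\<in>I. f i (snd p i)) = (\<Otimes>i\<in>I. f i (((snd p)(a := fst p)) i))"
      using insert p by (intro finprod_cong') (auto simp: PiE_def Pi_def)
    then show "f a (fst p) \<otimes> (\<Otimes>i\<in>I. f i (snd p i)) =
        (\<Otimes>i\<in>insert a I. f i (((snd p)(a := fst p)) i))"
      using insert p by (subst finprod_insert) (auto simp: PiE_def Pi_def)
  next
    show "(\<lambda>p. \<Otimes>i\<in>insert a I. f i (((snd p)(a := fst p)) i)) \<in> K \<times> (I \<rightarrow>\<^sub>E K) \<rightarrow> carrier R"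
      using insert.prems by (auto intro!: finprod_closed simp: PiE_def Pi_def)
  qed
  also have "\<dots> = (\<Oplus>c\<in>(\<lambda>p. (snd p)(a := fst p)) ` (K \<times> (I \<rightarrow>\<^sub>E K)). \<Otimes>i\<in>insert a I. f i (c i))"
  proof (rule finsum_reindex[symmetric])
    show "inj_on (\<lambda>p. (snd p)(a := fst p)) (K \<times> (I \<rightarrow>\<^sub>E K))"
      using inj_combinator[OF insert.hyps(2), of "\<lambda>_. K"] by (simp add: case_prod_beta')
    show "(\<lambda>c. \<Otimes>i\<in>insert a I. f i (c i)) \<in> (\<lambda>p. (snd p)(a := fst p)) ` (K \<times> (I \<rightarrow>\<^sub>E K)) \<rightarrow> carrier R"
      using insert.prems by (auto intro!: finprod_closed simp: PiE_def Pi_def)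
  qed
  also have "(\<lambda>p. (snd p)(a := fst p)) ` (K \<times> (I \<rightarrow>\<^sub>E K)) = insert a I \<rightarrow>\<^sub>E K"
    by (simp add: PiE_insert_eq case_prod_beta')
  finally show ?case .
qed

context cring
begin

definition perm_sign :: "(nat \<Rightarrow> nat) \<Rightarrow> 'a"
  where "perm_sign \<rho> = (if evenperm \<rho> then \<one> else \<ominus> \<one>)"

lemma perm_sign_closed [simp]: "perm_sign \<rho> \<in> carrier R"
  by (simp add: perm_sign_def)

lemma perm_sign_comp:
  assumes "\<rho> permutes {..<n}" "\<tau> permutes {..<n}"
  shows "perm_sign (\<rho> \<circ> \<tau>) = perm_sign \<rho> \<otimes> perm_sign \<tau>"
proof -
  have "permutation \<rho>" "permutation \<tau>" using assms permutation_permutes by blast+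
  then show ?thesis
    by (simp add: perm_sign_def evenperm_comp l_minus r_minus)
qed

lemma finite_perms [simp]: "finite {\<rho>. \<rho> permutes {..<n::nat}}"
  by (simp add: finite_permutations)

lemma determinant_perm_sign:
  "determinant R n A = (\<Oplus>\<rho>\<in>{\<rho>. \<rho> permutes {..<n}}. perm_sign \<rho> \<otimes> (\<Otimes>i\<in>{..<n}. A i (\<rho> i)))"
  by (simp add: determinant_def perm_sign_def)

lemma perm_product_closed:
  assumes "\<And>i j. i < n \<Longrightarrow> j < n \<Longrightarrow> A i j \<in> carrier R" "\<rho> permutes {..<n}"
  shows "(\<Otimes>i\<in>{..<n}. A i (\<rho> i)) \<in> carrier R"
  using assms permutes_in_image[OF assms(2)] by (intro finprod_closed) auto

lemma determinant_closed:
  assumes "\<And>i j. i < n \<Longrightarrow> j < n \<Longrightarrow> A i j \<in> carrier R"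
  shows "determinant R n A \<in> carrier R"
  unfolding determinant_perm_sign using assms by (auto intro!: finsum_closed perm_product_closed)

lemma determinant_cong:
  assumes "\<And>i j. i < n \<Longrightarrow> j < n \<Longrightarrow> B i j \<in> carrier R"
    and "\<And>i j. i < n \<Longrightarrow> j < n \<Longrightarrow> A i j = B i j"
  shows "determinant R n A = determinant R n B"
  unfolding determinant_perm_sign
proof (intro finsum_cong' refl)
  show "(\<lambda>\<rho>. perm_sign \<rho> \<otimes> (\<Otimes>i\<in>{..<n}. B i (\<rho> i))) \<in> {\<rho>. \<rho> permutes {..<n}} \<rightarrow> carrier R"
    using assms by (auto intro!: perm_product_closed)
  fix \<rho> assume "\<rho> \<in> {\<rho>. \<rho> permutes {..<n}}"
  then have "\<rho> i < n" if "i < n" for i using that permutes_in_image[of \<rho> "{..<n}" i] by simp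
  then have "(\<Otimes>i\<in>{..<n}. A i (\<rho> i)) = (\<Otimes>i\<in>{..<n}. B i (\<rho> i))"
    using assms by (intro finprod_cong') auto
  then show "perm_sign \<rho> \<otimes> (\<Otimes>i\<in>{..<n}. A i (\<rho> i)) = perm_sign \<rho> \<otimes> (\<Otimes>i\<in>{..<n}. B i (\<rho> i))"
    by simp
qed

lemma finprod_permute:
  assumes "\<pi> permutes {..<n::nat}" "\<And>i. i < n \<Longrightarrow> f i \<in> carrier R"
  shows "(\<Otimes>i\<in>{..<n}. f (\<pi> i)) = (\<Otimes>i\<in>{..<n}. f i)"
  using finprod_reindex[of f \<pi> "{..<n}"] assms permutes_image[OF assms(1)] permutes_inj_on[OF assms(1)]
  by (auto simp: Pi_def)

lemma determinant_permute_rows: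
  assumes A: "\<And>i j. i < n \<Longrightarrow> j < n \<Longrightarrow> A i j \<in> carrier R" and \<pi>: "\<pi> permutes {..<n}"
  shows "determinant R n (\<lambda>i j. A (\<pi> i) j) = perm_sign \<pi> \<otimes> determinant R n A"
proof -
  let ?S = "{\<rho>. \<rho> permutes {..<n}}"
  have lt: "\<pi> i < n" if "i < n" for i using that permutes_in_image[OF \<pi>, of i] by simp
  have im: "(\<lambda>\<tau>. \<tau> \<circ> \<pi>) ` ?S = ?S"
    using image_compose_permutations_right[OF \<pi>] by (auto simp: image_def)
  have inj: "inj_on (\<lambda>\<tau>. \<tau> \<circ> \<pi>) ?S"
    using permutes_surj[OF \<pi>] by (auto simp: inj_on_def fun_eq_iff surj_def) metis
  have "determinant R n (\<lambda>i j. A (\<pi> i) j) =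
      (\<Oplus>\<rho>\<in>(\<lambda>\<tau>. \<tau> \<circ> \<pi>) ` ?S. perm_sign \<rho> \<otimes> (\<Otimes>i\<in>{..<n}. A (\<pi> i) (\<rho> i)))"
    unfolding determinant_perm_sign im ..
  also have "\<dots> = (\<Oplus>\<tau>\<in>?S. perm_sign (\<tau> \<circ> \<pi>) \<otimes> (\<Otimes>i\<in>{..<n}. A (\<pi> i) ((\<tau> \<circ> \<pi>) i)))"
  proof (rule finsum_reindex[OF _ inj])
    show "(\<lambda>\<rho>. perm_sign \<rho> \<otimes> (\<Otimes>i\<in>{..<n}. A (\<pi> i) (\<rho> i))) \<in> (\<lambda>\<tau>. \<tau> \<circ> \<pi>) ` ?S \<rightarrow> carrier R"
      unfolding im using A lt by (auto intro!: perm_product_closed[of n "\<lambda>i j. A (\<pi> i) j"])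
  qed
  also have "\<dots> = (\<Oplus>\<tau>\<in>?S. perm_sign \<pi> \<otimes> (perm_sign \<tau> \<otimes> (\<Otimes>i\<in>{..<n}. A i (\<tau> i))))"
  proof (intro finsum_cong' refl)
    fix \<tau> assume "\<tau> \<in> ?S"
    then have \<tau>: "\<tau> permutes {..<n}" by simp
    have "(\<Otimes>i\<in>{..<n}. A (\<pi> i) ((\<tau> \<circ> \<pi>) i)) = (\<Otimes>i\<in>{..<n}. A i (\<tau> i))"
      using finprod_permute[OF \<pi>, of "\<lambda>i. A i (\<tau> i)"] A permutes_in_image[OF \<tau>] by simp
    then show "perm_sign (\<tau> \<circ> \<pi>) \<otimes> (\<Otimes>i\<in>{..<n}. A (\<pi> i) ((\<tau> \<circ> \<pi>) i)) =
        perm_sign \<pi> \<otimes> (perm_sign \<tau> \<otimes> (\<Otimes>i\<in>{..<n}. A i (\<tau> i)))"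
      using perm_sign_comp[OF \<tau> \<pi>] perm_product_closed[of n A, OF A \<tau>] by (simp add: m_ac)
  qed (use perm_product_closed[of n A, OF A] in auto)
  also have "\<dots> = perm_sign \<pi> \<otimes> determinant R n A"
    unfolding determinant_perm_sign using A
    by (intro finsum_rdistr[symmetric]) (auto intro!: perm_product_closed)
  finally show ?thesis .
qed

lemma determinant_transpose:
  assumes A: "\<And>i j. i < n \<Longrightarrow> j < n \<Longrightarrow> A i j \<in> carrier R"
  shows "determinant R n (\<lambda>i j. A j i) = determinant R n A"
proof -
  let ?S = "{\<rho>. \<rho> permutes {..<n}}"
  let ?inv = "\<lambda>\<rho>::nat \<Rightarrow> nat. inv_into UNIV \<rho>"
  have im: "?inv ` ?S = ?S"
    using image_inverse_permutations[of "{..<n}"] by (auto simp: image_def)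
  have inj: "inj_on ?inv ?S"
    by (rule inj_on_inverseI[where g = ?inv]) (simp add: permutes_inv_inv)
  have "determinant R n (\<lambda>i j. A j i) = (\<Oplus>\<rho>\<in>?inv ` ?S. perm_sign \<rho> \<otimes> (\<Otimes>i\<in>{..<n}. A (\<rho> i) i))"
    unfolding determinant_perm_sign im ..
  also have "\<dots> = (\<Oplus>\<rho>\<in>?S. perm_sign (?inv \<rho>) \<otimes> (\<Otimes>i\<in>{..<n}. A (?inv \<rho> i) i))"
  proof (rule finsum_reindex[OF _ inj])
    show "(\<lambda>\<rho>. perm_sign \<rho> \<otimes> (\<Otimes>i\<in>{..<n}. A (\<rho> i) i)) \<in> ?inv ` ?S \<rightarrow> carrier R"
      unfolding im using A by (auto intro!: perm_product_closed[of n "\<lambda>i j. A j i"])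
  qed
  also have "\<dots> = (\<Oplus>\<rho>\<in>?S. perm_sign \<rho> \<otimes> (\<Otimes>i\<in>{..<n}. A i (\<rho> i)))"
  proof (intro finsum_cong' refl)
    fix \<rho> assume "\<rho> \<in> ?S"
    then have \<rho>: "\<rho> permutes {..<n}" by simp
    have lt: "?inv \<rho> i < n" if "i < n" for i
      using that permutes_in_image[OF permutes_inv[OF \<rho>], of i] by simp
    have "permutation \<rho>" using \<rho> permutation_permutes by blast
    then have "perm_sign (?inv \<rho>) = perm_sign \<rho>" by (simp add: perm_sign_def evenperm_inv)
    moreover have "(\<Otimes>i\<in>{..<n}. A (?inv \<rho> i) i) = (\<Otimes>i\<in>{..<n}. A (?inv \<rho> (\<rho> i)) (\<rho> i))"
      using A lt by (intro finprod_permute[OF \<rho>, symmetric]) auto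
    ultimately show "perm_sign (?inv \<rho>) \<otimes> (\<Otimes>i\<in>{..<n}. A (?inv \<rho> i) i) =
        perm_sign \<rho> \<otimes> (\<Otimes>i\<in>{..<n}. A i (\<rho> i))"
      using permutes_inverses[OF \<rho>] by simp
  qed (use perm_product_closed[of n A, OF A] in auto)
  finally show ?thesis by (simp add: determinant_perm_sign)
qed

lemma determinant_permute_columns:
  assumes A: "\<And>i j. i < n \<Longrightarrow> j < n \<Longrightarrow> A i j \<in> carrier R" and \<pi>: "\<pi> permutes {..<n}"
  shows "determinant R n (\<lambda>i j. A i (\<pi> j)) = perm_sign \<pi> \<otimes> determinant R n A"
proof -
  have lt: "\<pi> i < n" if "i < n" for i using that permutes_in_image[OF \<pi>, of i] by simp
  have "determinant R n (\<lambda>i j. A i (\<pi> j)) = determinant R n (\<lambda>i j. A j (\<pi> i))"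
    using A lt by (intro determinant_transpose[symmetric]) auto
  also have "\<dots> = perm_sign \<pi> \<otimes> determinant R n (\<lambda>i j. A j i)"
    using A \<pi> by (intro determinant_permute_rows[of n "\<lambda>i j. A j i"]) auto
  finally show ?thesis using determinant_transpose[of n A, OF A] by simp
qed

text \<open>
The sign change under a transposition of rows only gives $2 \det = 0$. Instead, composition with the
transposition pairs the even with the odd permutations, and the paired terms cancel.
\<close>

lemma determinant_equal_rows:
  assumes A: "\<And>i j. i < n \<Longrightarrow> j < n \<Longrightarrow> A i j \<in> carrier R"
    and ij: "i < n" "j < n" "i \<noteq> j" and eq: "\<And>k. k < n \<Longrightarrow> A i k = A j k"
  shows "determinant R n A = \<zero>"
proof -
  let ?E = "{\<rho>. \<rho> permutes {..<n} \<and> evenperm \<rho>}"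
  let ?t = "transpose i j"
  let ?T = "\<lambda>\<rho>. perm_sign \<rho> \<otimes> (\<Otimes>i\<in>{..<n}. A i (\<rho> i))"
  have t: "?t permutes {..<n}" using ij by (simp add: permutes_swap_id)
  have even: "evenperm (\<rho> \<circ> ?t) = (\<not> evenperm \<rho>)" if "\<rho> permutes {..<n}" for \<rho>
  proof -
    have "permutation \<rho>" "permutation ?t" using that t permutation_permutes by blast+
    then show ?thesis using ij by (simp add: evenperm_comp evenperm_swap)
  qed
  have finE: "finite ?E" by (rule finite_subset[OF _ finite_perms[of n]]) auto
  have split: "{\<rho>. \<rho> permutes {..<n}} = ?E \<union> (\<lambda>\<rho>. \<rho> \<circ> ?t) ` ?E"
  proof -
    have "\<rho> \<in> (\<lambda>\<rho>. \<rho> \<circ> ?t) ` ?E" if "\<rho> permutes {..<n}" "\<not> evenperm \<rho>" for \<rho>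
    proof
      show "\<rho> \<circ> ?t \<in> ?E" using that even t by (auto intro: permutes_compose)
    qed (simp add: fun_eq_iff)
    then show ?thesis using t by (auto intro: permutes_compose)
  qed
  have disj: "?E \<inter> (\<lambda>\<rho>. \<rho> \<circ> ?t) ` ?E = {}" using even by auto
  have cl: "?T \<rho> \<in> carrier R" if "\<rho> permutes {..<n}" for \<rho>
    using A that by (auto intro!: perm_product_closed)
  have inj: "inj_on (\<lambda>\<rho>. \<rho> \<circ> ?t) ?E"
    by (rule inj_onI) (metis comp_assoc comp_id transpose_comp_involutory)
  have "determinant R n A = finsum R ?T ?E \<oplus> finsum R ?T ((\<lambda>\<rho>. \<rho> \<circ> ?t) ` ?E)"
    unfolding determinant_perm_sign split using finE disj cl t
    by (intro finsum_Un_disjoint) (auto intro: permutes_compose)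
  also have "finsum R ?T ((\<lambda>\<rho>. \<rho> \<circ> ?t) ` ?E) = (\<Oplus>\<rho>\<in>?E. ?T (\<rho> \<circ> ?t))"
  proof (rule finsum_reindex[OF _ inj])
    show "?T \<in> (\<lambda>\<rho>. \<rho> \<circ> ?t) ` ?E \<rightarrow> carrier R"
      using cl t by (auto intro: permutes_compose)
  qed
  also have "\<dots> = (\<Oplus>\<rho>\<in>?E. \<ominus> ?T \<rho>)"
  proof (intro finsum_cong' refl)
    fix \<rho> assume "\<rho> \<in> ?E"
    then have \<rho>: "\<rho> permutes {..<n}" "evenperm \<rho>" by auto
    have lt: "\<rho> k < n" if "k < n" for k using that permutes_in_image[OF \<rho>(1), of k] by simp
    have "(\<Otimes>k\<in>{..<n}. A k ((\<rho> \<circ> ?t) k)) = (\<Otimes>k\<in>{..<n}. A (?t k) (\<rho> (?t k)))"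
      using lt A ij permutes_in_image[OF t] eq
      by (intro finprod_cong') (auto simp: transpose_def)
    also have "\<dots> = (\<Otimes>k\<in>{..<n}. A k (\<rho> k))"
      using finprod_permute[OF t, of "\<lambda>k. A k (\<rho> k)"] A lt by simp
    finally show "?T (\<rho> \<circ> ?t) = \<ominus> ?T \<rho>"
      using \<rho> even[OF \<rho>(1)] perm_product_closed[of n A, OF A \<rho>(1)] by (simp add: perm_sign_def l_minus)
  qed (use cl in auto)
  also have "finsum R ?T ?E \<oplus> (\<Oplus>\<rho>\<in>?E. \<ominus> ?T \<rho>) = (\<Oplus>\<rho>\<in>?E. ?T \<rho> \<oplus> \<ominus> ?T \<rho>)"
    using cl by (intro finsum_addf[symmetric]) auto
  also have "\<dots> = (\<Oplus>\<rho>\<in>?E. \<zero>)"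
    using cl by (intro finsum_cong' refl) (auto simp: r_neg)
  finally show ?thesis by simp
qed

text \<open>
Multilinearity in all rows at once. The choices of one vector per row may repeat a vector; both
multiplicativity and the reduction of arbitrary relations to those of a presentation come from
discarding these choices.
\<close>

lemma determinant_row_combinations:
  assumes "finite K"
    and s: "\<And>i k. i < n \<Longrightarrow> k \<in> K \<Longrightarrow> s i k \<in> carrier R"
    and v: "\<And>k j. k \<in> K \<Longrightarrow> j < n \<Longrightarrow> v k j \<in> carrier R"
  shows "determinant R n (\<lambda>i j. \<Oplus>k\<in>K. s i k \<otimes> v k j) =
    (\<Oplus>c\<in>{..<n} \<rightarrow>\<^sub>E K. (\<Otimes>i\<in>{..<n}. s i (c i)) \<otimes> determinant R n (\<lambda>i j. v (c i) j))"
proof -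
  let ?S = "{\<rho>. \<rho> permutes {..<n}}" and ?C = "{..<n} \<rightarrow>\<^sub>E K"
  have finC: "finite ?C" using assms by (simp add: finite_PiE)
  have cK: "c i \<in> K" if "c \<in> ?C" "i < n" for c i using that by auto
  have scl: "(\<Otimes>i\<in>{..<n}. s i (c i)) \<in> carrier R" if "c \<in> ?C" for c
    using s cK[OF that] by (intro finprod_closed) auto
  have vcl: "(\<Otimes>i\<in>{..<n}. v (c i) (\<rho> i)) \<in> carrier R" if "c \<in> ?C" "\<rho> \<in> ?S" for c \<rho>
    using v cK[OF that(1)] that(2) by (intro perm_product_closed[of n "\<lambda>i j. v (c i) j"]) auto
  have "determinant R n (\<lambda>i j. \<Oplus>k\<in>K. s i k \<otimes> v k j) =
      (\<Oplus>\<rho>\<in>?S. \<Oplus>c\<in>?C. (\<Otimes>i\<in>{..<n}. s i (c i)) \<otimes>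
         (perm_sign \<rho> \<otimes> (\<Otimes>i\<in>{..<n}. v (c i) (\<rho> i))))"
    unfolding determinant_perm_sign
  proof (intro finsum_cong' refl)
    fix \<rho> assume \<rho>S: "\<rho> \<in> ?S"
    then have \<rho>: "\<rho> i < n" if "i < n" for i using that permutes_in_image[of \<rho> "{..<n}" i] by simp
    have "(\<Otimes>i\<in>{..<n}. \<Oplus>k\<in>K. s i k \<otimes> v k (\<rho> i)) =
        (\<Oplus>c\<in>?C. \<Otimes>i\<in>{..<n}. s i (c i) \<otimes> v (c i) (\<rho> i))"
      using assms \<rho> by (intro finprod_finsum_distrib) auto
    also have "\<dots> = (\<Oplus>c\<in>?C. (\<Otimes>i\<in>{..<n}. s i (c i)) \<otimes> (\<Otimes>i\<in>{..<n}. v (c i) (\<rho> i)))"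
      using s v cK \<rho> scl vcl[OF _ \<rho>S] by (intro finsum_cong' refl) (auto intro!: finprod_multf)
    finally have "perm_sign \<rho> \<otimes> (\<Otimes>i\<in>{..<n}. \<Oplus>k\<in>K. s i k \<otimes> v k (\<rho> i)) =
        (\<Oplus>c\<in>?C. perm_sign \<rho> \<otimes> ((\<Otimes>i\<in>{..<n}. s i (c i)) \<otimes> (\<Otimes>i\<in>{..<n}. v (c i) (\<rho> i))))"
      using finC scl vcl[OF _ \<rho>S] by (simp add: finsum_rdistr Pi_def)
    also have "\<dots> = (\<Oplus>c\<in>?C. (\<Otimes>i\<in>{..<n}. s i (c i)) \<otimes>
         (perm_sign \<rho> \<otimes> (\<Otimes>i\<in>{..<n}. v (c i) (\<rho> i))))"
      using scl vcl[OF _ \<rho>S] by (intro finsum_cong' refl) (auto simp: m_ac)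
    finally show "perm_sign \<rho> \<otimes> (\<Otimes>i\<in>{..<n}. \<Oplus>k\<in>K. s i k \<otimes> v k (\<rho> i)) = \<dots>" .
  qed (use scl vcl in \<open>auto intro!: finsum_closed\<close>)
  also have "\<dots> = (\<Oplus>c\<in>?C. \<Oplus>\<rho>\<in>?S. (\<Otimes>i\<in>{..<n}. s i (c i)) \<otimes>
         (perm_sign \<rho> \<otimes> (\<Otimes>i\<in>{..<n}. v (c i) (\<rho> i))))"
    using finC scl vcl by (intro finsum_swap) auto
  also have "\<dots> = (\<Oplus>c\<in>?C. (\<Otimes>i\<in>{..<n}. s i (c i)) \<otimes> determinant R n (\<lambda>i j. v (c i) j))"
    using scl vcl v cK
    by (intro finsum_cong' refl)
       (auto simp: determinant_perm_sign[of n "\<lambda>i j. v (_ i) j"] finsum_rdistr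
             intro!: determinant_closed finsum_rdistr[symmetric] m_closed)
  finally show ?thesis .
qed

lemma determinant_mult:
  assumes D: "\<And>i j. i < n \<Longrightarrow> j < n \<Longrightarrow> D i j \<in> carrier R"
    and U: "\<And>i j. i < n \<Longrightarrow> j < n \<Longrightarrow> U i j \<in> carrier R"
  shows "determinant R n (\<lambda>i j. \<Oplus>k\<in>{..<n}. D i k \<otimes> U k j) = determinant R n D \<otimes> determinant R n U"
proof -
  let ?S = "{\<rho>. \<rho> permutes {..<n}}" and ?C = "{..<n} \<rightarrow>\<^sub>E {..<n}"
  let ?r = "\<lambda>\<rho>. restrict \<rho> {..<n}"
  let ?T = "\<lambda>c. (\<Otimes>i\<in>{..<n}. D i (c i)) \<otimes> determinant R n (\<lambda>i j. U (c i) j)"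
  have cK: "c i < n" if "c \<in> ?C" "i < n" for c i using that by auto
  have cl: "?T c \<in> carrier R" if "c \<in> ?C" for c
    using D U cK[OF that] by (intro m_closed finprod_closed determinant_closed) auto
  have less: "\<rho> i < n" if "\<rho> permutes {..<n}" "i < n" for \<rho> i
    using that permutes_in_image[of \<rho> "{..<n}" i] by simp
  have sub: "?r ` ?S \<subseteq> ?C" using less by (auto split: if_splits)
  have inj: "inj_on ?r ?S"
  proof (rule inj_onI)
    fix \<rho> \<tau> assume *: "\<rho> \<in> ?S" "\<tau> \<in> ?S" "?r \<rho> = ?r \<tau>"
    show "\<rho> = \<tau>"
    proof
      fix x show "\<rho> x = \<tau> x"
        using * permutes_not_in[of \<rho> "{..<n}" x] permutes_not_in[of \<tau> "{..<n}" x]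
        by (cases "x < n") (auto dest!: fun_cong[of _ _ x])
    qed
  qed
  have zero: "?T c = \<zero>" if c: "c \<in> ?C" "c \<notin> ?r ` ?S" for c
  proof -
    have "\<not> inj_on c {..<n}"
    proof
      assume i: "inj_on c {..<n}"
      let ?\<rho> = "\<lambda>x. if x < n then c x else x"
      have "bij_betw c {..<n} {..<n}"
        unfolding bij_betw_def using i cK[OF c(1)] endo_inj_surj[of "{..<n}" c] by auto
      then have "bij_betw ?\<rho> {..<n} {..<n}" by (rule bij_betw_cong[THEN iffD1, rotated]) auto
      then have "?\<rho> permutes {..<n}" by (intro bij_imp_permutes) auto
      moreover have "c = ?r ?\<rho>" using c by (auto simp: fun_eq_iff PiE_def extensional_def)
      ultimately show False using c by auto
    qed
    then obtain i j where "i < n" "j < n" "i \<noteq> j" "c i = c j" by (auto simp: inj_on_def)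
    then have "determinant R n (\<lambda>i j. U (c i) j) = \<zero>"
      using U cK[OF c(1)] by (intro determinant_equal_rows[of n _ i j]) auto
    then show ?thesis using D cK[OF c(1)] by (auto intro!: r_null finprod_closed)
  qed
  have "determinant R n (\<lambda>i j. \<Oplus>k\<in>{..<n}. D i k \<otimes> U k j) = finsum R ?T ?C"
    using D U by (intro determinant_row_combinations) auto
  also have "\<dots> = finsum R ?T (?r ` ?S)"
    using sub zero cl
    by (intro add.finprod_mono_neutral_cong_right) (auto simp: finite_PiE)
  also have "\<dots> = (\<Oplus>\<rho>\<in>?S. ?T (?r \<rho>))"
  proof (rule finsum_reindex[OF _ inj])
    show "?T \<in> ?r ` ?S \<rightarrow> carrier R" using sub cl by blast
  qed
  also have "\<dots> = (\<Oplus>\<rho>\<in>?S. (perm_sign \<rho> \<otimes> (\<Otimes>i\<in>{..<n}. D i (\<rho> i))) \<otimes> determinant R n U)"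
  proof (intro finsum_cong' refl)
    fix \<rho> assume "\<rho> \<in> ?S"
    then have \<rho>: "\<rho> permutes {..<n}" by simp
    have lt: "\<rho> i < n" if "i < n" for i using that permutes_in_image[OF \<rho>, of i] by simp
    have "(\<Otimes>i\<in>{..<n}. D i (?r \<rho> i)) = (\<Otimes>i\<in>{..<n}. D i (\<rho> i))"
      using D lt by (intro finprod_cong') auto
    moreover have "determinant R n (\<lambda>i j. U (?r \<rho> i) j) = determinant R n (\<lambda>i j. U (\<rho> i) j)"
      using U lt by (intro determinant_cong) auto
    ultimately show "?T (?r \<rho>) = (perm_sign \<rho> \<otimes> (\<Otimes>i\<in>{..<n}. D i (\<rho> i))) \<otimes> determinant R n U"
      using determinant_permute_rows[of n U, OF U \<rho>] perm_product_closed[of n D, OF D \<rho>] determinant_closed[of n U, OF U]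
      by (simp add: m_ac)
  qed (use perm_product_closed[of n D, OF D] determinant_closed[of n U, OF U] in auto)
  also have "\<dots> = determinant R n D \<otimes> determinant R n U"
    unfolding determinant_perm_sign[of n D]
    using perm_product_closed[of n D, OF D] determinant_closed[of n U, OF U]
    by (intro finsum_ldistr[symmetric]) auto
  finally show ?thesis .
qed
text \<open>
A permutation is determined by the row that it sends to the last column and by what remains after this
row is exchanged with the last one. Exchanging rows, rather than deleting one and shifting the later
ones up, keeps the minors in the form of determinants of reindexed rows.
\<close>

lemma determinant_expand_last_column:
  assumes A: "\<And>i j. i < Suc n \<Longrightarrow> j < Suc n \<Longrightarrow> A i j \<in> carrier R"
  shows "determinant R (Suc n) A =
    (\<Oplus>i\<in>{..<Suc n}. perm_sign (transpose i n) \<otimes> A i n \<otimes> determinant R n (\<lambda>k j. A (transpose i n k) j))"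
proof -
  let ?S = "\<lambda>n. {\<rho>. \<rho> permutes {..<n::nat}}"
  let ?f = "\<lambda>p. snd p \<circ> transpose (fst p) n"
  let ?T = "\<lambda>\<rho>. perm_sign \<rho> \<otimes> (\<Otimes>i\<in>{..<Suc n}. A i (\<rho> i))"
  have tr: "transpose i n permutes {..<Suc n}" if "i < Suc n" for i
    using that by (intro permutes_swap_id) auto
  have ext: "\<tau> permutes {..<Suc n}" "\<tau> n = n" if "\<tau> \<in> ?S n" for \<tau>
    using that permutes_subset[of \<tau> "{..<n}" "{..<Suc n}"] permutes_not_in[of \<tau> "{..<n}" n] by auto
  have bij: "bij_betw ?f ({..<Suc n} \<times> ?S n) (?S (Suc n))"
  proof (rule bij_betwI[where g = "\<lambda>\<rho>. (inv_into UNIV \<rho> n, \<rho> \<circ> transpose (inv_into UNIV \<rho> n) n)"])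
    show "?f \<in> {..<Suc n} \<times> ?S n \<rightarrow> ?S (Suc n)"
      using tr ext by (auto intro!: permutes_compose)
    show "(\<lambda>\<rho>. (inv_into UNIV \<rho> n, \<rho> \<circ> transpose (inv_into UNIV \<rho> n) n)) \<in> ?S (Suc n) \<rightarrow> {..<Suc n} \<times> ?S n"
    proof
      fix \<rho> assume "\<rho> \<in> ?S (Suc n)"
      then have \<rho>: "\<rho> permutes {..<Suc n}" by simp
      have i: "inv_into UNIV \<rho> n < Suc n" using permutes_in_image[OF permutes_inv[OF \<rho>], of n] by simp
      let ?\<tau> = "\<rho> \<circ> transpose (inv_into UNIV \<rho> n) n"
      have "?\<tau> permutes {..<Suc n}" using \<rho> tr[OF i] by (intro permutes_compose) auto
      moreover have "?\<tau> n = n" using permutes_inverses[OF \<rho>] by simp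
      then have "?\<tau> x = x" if "x \<in> {..<Suc n} - {..<n}" for x
        using that by (cases "x = n") (simp_all del: o_apply)
      ultimately have "?\<tau> permutes {..<n}"
        by (rule permutes_superset)
      then show "(inv_into UNIV \<rho> n, ?\<tau>) \<in> {..<Suc n} \<times> ?S n" using i by simp
    qed
    fix p assume p: "p \<in> {..<Suc n} \<times> ?S n"
    have f: "?f p permutes {..<Suc n}" using p tr ext by (auto intro!: permutes_compose)
    have "?f p (fst p) = n" using p ext by auto
    then have "inv_into UNIV (?f p) n = fst p" using permutes_inv_eq[OF f] by blast
    then show "(inv_into UNIV (?f p) n, ?f p \<circ> transpose (inv_into UNIV (?f p) n) n) = p"
      by (auto simp: prod_eq_iff fun_eq_iff)
  qed (auto simp: fun_eq_iff)
  have cl: "?T \<rho> \<in> carrier R" if "\<rho> \<in> ?S (Suc n)" for \<rho>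
    using perm_product_closed[of "Suc n" A, OF A] that by (auto simp del: lessThan_Suc)
  have ml: "transpose i n k < Suc n" if "i < Suc n" "k < Suc n" for i k
    using that by (auto simp: transpose_def)
  have mcl: "(\<Otimes>k\<in>{..<n}. A (transpose i n k) (\<tau> k)) \<in> carrier R"
    if "i < Suc n" "\<tau> \<in> ?S n" for i \<tau>
    using that A ml by (intro perm_product_closed[of n "\<lambda>k j. A (transpose i n k) j"]) auto
  have "determinant R (Suc n) A = finsum R ?T (?f ` ({..<Suc n} \<times> ?S n))"
    unfolding determinant_perm_sign using bij by (simp add: bij_betw_def)
  also have "\<dots> = (\<Oplus>p\<in>{..<Suc n} \<times> ?S n. ?T (?f p))"
    using bij cl by (intro finsum_reindex) (auto simp: bij_betw_def simp del: lessThan_Suc)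
  also have "\<dots> = (\<Oplus>p\<in>{..<Suc n} \<times> ?S n. perm_sign (transpose (fst p) n) \<otimes> A (fst p) n \<otimes>
      (perm_sign (snd p) \<otimes> (\<Otimes>k\<in>{..<n}. A (transpose (fst p) n k) (snd p k))))"
  proof (intro finsum_cong' refl)
    fix p assume "p \<in> {..<Suc n} \<times> ?S n"
    then obtain i \<tau> where p: "p = (i, \<tau>)" and i: "i < Suc n" and \<tau>: "\<tau> \<in> ?S n" by auto
    have \<tau>k: "\<tau> k < n" if "k < n" for k using that \<tau> permutes_in_image[of \<tau> "{..<n}" k] by simp
    have \<tau>k': "\<tau> k < Suc n" if "k < Suc n" for k
      using that ext(1)[OF \<tau>] permutes_in_image[of \<tau> "{..<Suc n}" k] by simp
    have "(\<Otimes>k\<in>{..<Suc n}. A k (?f p k)) =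
        (\<Otimes>k\<in>{..<Suc n}. A (transpose i n k) (?f p (transpose i n k)))"
      using A ml[OF i] \<tau>k' p
      by (intro finprod_permute[OF tr[OF i], of "\<lambda>k. A k (?f p k)", symmetric]) auto
    also have "\<dots> = (\<Otimes>k\<in>{..<Suc n}. A (transpose i n k) (\<tau> k))" using p by simp
    also have "\<dots> = A i n \<otimes> (\<Otimes>k\<in>{..<n}. A (transpose i n k) (\<tau> k))"
      using A ml[OF i] i \<tau>k ext[OF \<tau>] unfolding lessThan_Suc
      by (subst finprod_insert) (auto simp: less_Suc_eq)
    finally show "?T (?f p) = perm_sign (transpose (fst p) n) \<otimes> A (fst p) n \<otimes>
      (perm_sign (snd p) \<otimes> (\<Otimes>k\<in>{..<n}. A (transpose (fst p) n k) (snd p k)))"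
      using p i A mcl[OF i \<tau>] perm_sign_comp[OF ext(1)[OF \<tau>] tr[OF i]] by (simp add: m_ac)
  qed (use A mcl in \<open>auto intro!: m_closed simp del: lessThan_Suc\<close>)
  also have "\<dots> = (\<Oplus>i\<in>{..<Suc n}. \<Oplus>\<tau>\<in>?S n. perm_sign (transpose i n) \<otimes> A i n \<otimes>
      (perm_sign \<tau> \<otimes> (\<Otimes>k\<in>{..<n}. A (transpose i n k) (\<tau> k))))"
    using A mcl by (intro finsum_Times) (auto intro!: m_closed)
  also have "\<dots> = (\<Oplus>i\<in>{..<Suc n}. perm_sign (transpose i n) \<otimes> A i n \<otimes>
       determinant R n (\<lambda>k j. A (transpose i n k) j))"
    using A mcl ml
    by (intro finsum_cong' refl)
       (auto simp: determinant_perm_sign[of n "\<lambda>k j. A (transpose _ n k) j"] simp del: lessThan_Suc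
             intro!: determinant_closed finsum_rdistr[symmetric] m_closed)
  finally show ?thesis .
qed

lemma determinant_last_column_single:
  assumes A: "\<And>i j. i < Suc n \<Longrightarrow> j < Suc n \<Longrightarrow> A i j \<in> carrier R"
    and zero: "\<And>i. i < n \<Longrightarrow> A i n = \<zero>"
  shows "determinant R (Suc n) A = A n n \<otimes> determinant R n A"
proof -
  have cl: "determinant R n (\<lambda>k j. A (transpose i n k) j) \<in> carrier R" if "i < Suc n" for i
    using that A by (intro determinant_closed) (auto simp: transpose_def)
  let ?t = "\<lambda>i. perm_sign (transpose i n) \<otimes> A i n \<otimes> determinant R n (\<lambda>k j. A (transpose i n k) j)"
  have "finsum R ?t {..<n} = (\<Oplus>i\<in>{..<n}. \<zero>)"
    using zero cl by (intro finsum_cong' refl) auto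
  moreover have "finsum R ?t {..<Suc n} = ?t n \<oplus> finsum R ?t {..<n}"
    unfolding lessThan_Suc using A cl cl[of n] by (intro finsum_insert) auto
  moreover have "perm_sign (transpose n n) = \<one>" by (simp add: perm_sign_def)
  ultimately show ?thesis
    using A cl[of n] by (simp add: determinant_expand_last_column[OF A])
qed

end

section \<open>Additive maps and linear combinations\<close>

definition additive_map :: "('a, 'x) ring_scheme \<Rightarrow> ('b, 'y) ring_scheme \<Rightarrow> ('a \<Rightarrow> 'b) \<Rightarrow> bool"
  where "additive_map A B h \<longleftrightarrow> h \<in> carrier A \<rightarrow> carrier B \<and>
    (\<forall>x\<in>carrier A. \<forall>y\<in>carrier A. h (x \<oplus>\<^bsub>A\<^esub> y) = h x \<oplus>\<^bsub>B\<^esub> h y)"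

lemma additive_closed: "additive_map A B h \<Longrightarrow> x \<in> carrier A \<Longrightarrow> h x \<in> carrier B"
  by (auto simp: additive_map_def)

lemma additive_add:
  "additive_map A B h \<Longrightarrow> x \<in> carrier A \<Longrightarrow> y \<in> carrier A \<Longrightarrow> h (x \<oplus>\<^bsub>A\<^esub> y) = h x \<oplus>\<^bsub>B\<^esub> h y"
  by (auto simp: additive_map_def)

lemma additive_zero:
  assumes "abelian_group A" "abelian_group B" "additive_map A B h"
  shows "h \<zero>\<^bsub>A\<^esub> = \<zero>\<^bsub>B\<^esub>"
proof -
  interpret A: abelian_group A by fact
  interpret B: abelian_group B by fact
  have "h \<zero>\<^bsub>A\<^esub> \<oplus>\<^bsub>B\<^esub> h \<zero>\<^bsub>A\<^esub> = h \<zero>\<^bsub>A\<^esub>"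
    using additive_add[OF assms(3), of "\<zero>\<^bsub>A\<^esub>" "\<zero>\<^bsub>A\<^esub>"] by simp
  then show ?thesis using additive_closed[OF assms(3) A.zero_closed]
    by (metis B.add.r_cancel_one B.zero_closed)
qed

lemma additive_minus:
  assumes "abelian_group A" "abelian_group B" "additive_map A B h" "x \<in> carrier A"
  shows "h (\<ominus>\<^bsub>A\<^esub> x) = \<ominus>\<^bsub>B\<^esub> h x"
proof -
  interpret A: abelian_group A by fact
  interpret B: abelian_group B by fact
  have "h x \<oplus>\<^bsub>B\<^esub> h (\<ominus>\<^bsub>A\<^esub> x) = \<zero>\<^bsub>B\<^esub>"
    using additive_add[OF assms(3,4) A.a_inv_closed[OF assms(4)]] additive_zero[OF assms(1-3)] assms(4)
    by (simp add: A.r_neg)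
  then show ?thesis using additive_closed[OF assms(3)] assms(4)
    by (metis A.a_inv_closed B.add.m_comm B.minus_equality)
qed

lemma additive_finsum:
  assumes A: "abelian_group A" and B: "abelian_group B" and h: "additive_map A B h"
    and u: "\<And>i. i \<in> I \<Longrightarrow> u i \<in> carrier A"
  shows "h (\<Oplus>\<^bsub>A\<^esub>i\<in>I. u i) = (\<Oplus>\<^bsub>B\<^esub>i\<in>I. h (u i))"
proof -
  interpret A: abelian_group A by fact
  interpret B: abelian_group B by fact
  show ?thesis using u
  proof (induction I rule: infinite_finite_induct)
    case (insert i I)
    then show ?case
      using additive_closed[OF h] by (simp add: additive_add[OF h] Pi_def)
  qed (use additive_zero[OF A B h] in simp_all)
qed

lemma left_hom_additive: "f \<in> left_hom R M N \<Longrightarrow> additive_map M N f"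
  by (auto simp: left_hom_def additive_map_def)

lemma left_hom_smult:
  "f \<in> left_hom R M N \<Longrightarrow> r \<in> carrier R \<Longrightarrow> x \<in> carrier M \<Longrightarrow> f (r \<odot>\<^bsub>M\<^esub> x) = r \<odot>\<^bsub>N\<^esub> f x"
  by (auto simp: left_hom_def)

lemma right_hom_additive: "f \<in> right_hom R M N \<Longrightarrow> additive_map M N f"
  by (auto simp: right_hom_def additive_map_def)

lemma right_hom_rsmult:
  "f \<in> right_hom R M N \<Longrightarrow> x \<in> carrier M \<Longrightarrow> r \<in> carrier R \<Longrightarrow> f (x \<bullet>\<^bsub>M\<^esub> r) = f x \<bullet>\<^bsub>N\<^esub> r"
  by (auto simp: right_hom_def)

context left_module
begin

lemma additive_smult_right: "r \<in> carrier R \<Longrightarrow> additive_map M M (\<lambda>x. r \<odot>\<^bsub>M\<^esub> x)"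
  by (auto simp: additive_map_def smult_closed smult_r_distr)

lemma additive_smult_left: "x \<in> carrier M \<Longrightarrow> additive_map R M (\<lambda>r. r \<odot>\<^bsub>M\<^esub> x)"
  by (auto simp: additive_map_def smult_closed smult_l_distr)

lemma smult_zero_right: "r \<in> carrier R \<Longrightarrow> r \<odot>\<^bsub>M\<^esub> \<zero>\<^bsub>M\<^esub> = \<zero>\<^bsub>M\<^esub>"
  using additive_zero[OF M.abelian_group_axioms M.abelian_group_axioms additive_smult_right] .

lemma smult_zero_left: "x \<in> carrier M \<Longrightarrow> \<zero> \<odot>\<^bsub>M\<^esub> x = \<zero>\<^bsub>M\<^esub>"
  using additive_zero[OF R.abelian_group_axioms M.abelian_group_axioms additive_smult_left] .

lemma smult_minus_left: "r \<in> carrier R \<Longrightarrow> x \<in> carrier M \<Longrightarrow> (\<ominus> r) \<odot>\<^bsub>M\<^esub> x = \<ominus>\<^bsub>M\<^esub> (r \<odot>\<^bsub>M\<^esub> x)"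
  using additive_minus[OF R.abelian_group_axioms M.abelian_group_axioms additive_smult_left] .

lemma smult_finsum_right:
  "r \<in> carrier R \<Longrightarrow> (\<And>i. i \<in> I \<Longrightarrow> u i \<in> carrier M) \<Longrightarrow>
    r \<odot>\<^bsub>M\<^esub> (\<Oplus>\<^bsub>M\<^esub>i\<in>I. u i) = (\<Oplus>\<^bsub>M\<^esub>i\<in>I. r \<odot>\<^bsub>M\<^esub> u i)"
  using additive_finsum[OF M.abelian_group_axioms M.abelian_group_axioms additive_smult_right] .

lemma smult_finsum_left:
  "x \<in> carrier M \<Longrightarrow> (\<And>i. i \<in> I \<Longrightarrow> u i \<in> carrier R) \<Longrightarrow>
    (\<Oplus>i\<in>I. u i) \<odot>\<^bsub>M\<^esub> x = (\<Oplus>\<^bsub>M\<^esub>i\<in>I. u i \<odot>\<^bsub>M\<^esub> x)"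
  using additive_finsum[OF R.abelian_group_axioms M.abelian_group_axioms additive_smult_left] .

end

lemma left_hom_combination:
  assumes N: "left_module R N" and N': "left_module R N'" and f: "f \<in> left_hom R N N'"
    and "\<And>i. i \<in> I \<Longrightarrow> r i \<in> carrier R" "\<And>i. i \<in> I \<Longrightarrow> e i \<in> carrier N"
  shows "f (\<Oplus>\<^bsub>N\<^esub>i\<in>I. r i \<odot>\<^bsub>N\<^esub> e i) = (\<Oplus>\<^bsub>N'\<^esub>i\<in>I. r i \<odot>\<^bsub>N'\<^esub> f (e i))"
proof -
  interpret N: left_module R N by fact
  interpret N': left_module R N' by fact
  have "f (\<Oplus>\<^bsub>N\<^esub>i\<in>I. r i \<odot>\<^bsub>N\<^esub> e i) = (\<Oplus>\<^bsub>N'\<^esub>i\<in>I. f (r i \<odot>\<^bsub>N\<^esub> e i))"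
    using assms(4,5) N.smult_closed
    by (intro additive_finsum[OF N.M.abelian_group_axioms N'.M.abelian_group_axioms left_hom_additive[OF f]]) auto
  also have "\<dots> = (\<Oplus>\<^bsub>N'\<^esub>i\<in>I. r i \<odot>\<^bsub>N'\<^esub> f (e i))"
    using assms(4,5) N'.smult_closed additive_closed[OF left_hom_additive[OF f]]
    by (intro N'.M.finsum_cong' refl) (auto simp: left_hom_smult[OF f])
  finally show ?thesis .
qed

section \<open>Relations and Fitting ideals of generating families\<close>

definition relation :: "('a, 'x) ring_scheme \<Rightarrow> ('a, 'm, 'y) module_scheme \<Rightarrow> nat \<Rightarrow> (nat \<Rightarrow> 'm) \<Rightarrow> (nat \<Rightarrow> 'a) \<Rightarrow> bool"
  where "relation R N n e r \<longleftrightarrow>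
    (\<forall>j<n. r j \<in> carrier R) \<and> (\<Oplus>\<^bsub>N\<^esub>j\<in>{..<n}. r j \<odot>\<^bsub>N\<^esub> e j) = \<zero>\<^bsub>N\<^esub>"

definition spans :: "('a, 'x) ring_scheme \<Rightarrow> ('a, 'm, 'y) module_scheme \<Rightarrow> nat \<Rightarrow> (nat \<Rightarrow> 'm) \<Rightarrow> bool"
  where "spans R N n e \<longleftrightarrow> (\<forall>j<n. e j \<in> carrier N) \<and>
    (\<forall>x\<in>carrier N. \<exists>s. (\<forall>j<n. s j \<in> carrier R) \<and> x = (\<Oplus>\<^bsub>N\<^esub>j\<in>{..<n}. s j \<odot>\<^bsub>N\<^esub> e j))"

text \<open>
The zeroth Fitting ideal of a module with the given generating family. Every relation is admitted
as a row, so no generating set of relations has to be carried along when the family changes.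
\<close>

definition family_fitting :: "('a, 'x) ring_scheme \<Rightarrow> ('a, 'm, 'y) module_scheme \<Rightarrow> nat \<Rightarrow> (nat \<Rightarrow> 'm) \<Rightarrow> 'a set"
  where "family_fitting R N n e = Idl\<^bsub>R\<^esub> {determinant R n D | D. \<forall>i<n. relation R N n e (D i)}"

context cring
begin

lemma family_fitting_ideal: "ideal (family_fitting R N n e) R"
  unfolding family_fitting_def
  by (rule genideal_ideal) (auto simp: relation_def intro!: determinant_closed)

lemma family_fitting_mem:
  "\<forall>i<n. relation R N n e (D i) \<Longrightarrow> determinant R n D \<in> family_fitting R N n e"
  unfolding family_fitting_def
  by (rule subsetD[OF genideal_self]) (auto simp: relation_def intro!: determinant_closed)

lemma family_fitting_subset:
  assumes "ideal I R" "\<And>D. \<forall>i<n. relation R N n e (D i) \<Longrightarrow> determinant R n D \<in> I"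
  shows "family_fitting R N n e \<subseteq> I"
  unfolding family_fitting_def using assms by (intro genideal_minimal) auto

lemma ideal_finsum:
  assumes "ideal I R" "\<And>k. k \<in> K \<Longrightarrow> f k \<in> I"
  shows "(\<Oplus>k\<in>K. f k) \<in> I"
  using assms(2)
proof (induction K rule: infinite_finite_induct)
  case (insert k K)
  then show ?case
    using ideal.Icarr[OF assms(1)] additive_subgroup.a_closed[OF ideal.axioms(1)[OF assms(1)]]
    by (simp add: Pi_def)
qed (use additive_subgroup.zero_closed[OF ideal.axioms(1)[OF assms(1)]] in simp_all)

lemma ideal_colon:
  assumes J: "ideal J R" and d: "d \<in> carrier R"
  shows "ideal {r \<in> carrier R. r \<otimes> d \<in> J} R" (is "ideal ?K R")
proof (rule idealI[OF ring_axioms])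
  interpret J: ideal J R by (rule J)
  show "subgroup ?K (add_monoid R)"
  proof (rule add.subgroupI)
    show "?K \<noteq> {}" using d J.zero_closed by (auto intro!: exI[of _ \<zero>])
    fix a assume a: "a \<in> ?K"
    then show "\<ominus> a \<in> ?K" using d J.a_inv_closed by (auto simp: l_minus)
    fix b assume "b \<in> ?K"
    with a show "a \<oplus> b \<in> ?K" using d J.a_closed by (auto simp: l_distr)
  qed auto
  fix a x assume a: "a \<in> ?K" "x \<in> carrier R"
  then have "x \<otimes> (a \<otimes> d) \<in> J" using J.I_l_closed by blast
  then show "x \<otimes> a \<in> ?K" "a \<otimes> x \<in> ?K" using a d by (auto simp: m_ac)
qed

lemma determinant_identity: "determinant R n (\<lambda>i j. if i = j then \<one> else \<zero>) = \<one>"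
proof (induction n)
  case 0
  then show ?case by (simp add: determinant_def)
next
  case (Suc n)
  then show ?case by (subst determinant_last_column_single) auto
qed

lemma relation_cong:
  assumes "left_module R N" "\<And>j. j < n \<Longrightarrow> e' j = e j" "\<And>j. j < n \<Longrightarrow> e j \<in> carrier N"
   "relation R N n e r"
  shows "relation R N n e' r"
proof -
  interpret N: left_module R N by fact
  have "(\<Oplus>\<^bsub>N\<^esub>j\<in>{..<n}. r j \<odot>\<^bsub>N\<^esub> e' j) = (\<Oplus>\<^bsub>N\<^esub>j\<in>{..<n}. r j \<odot>\<^bsub>N\<^esub> e j)"
    using assms by (intro N.M.finsum_cong' refl) (auto simp: relation_def N.smult_closed)
  then show ?thesis using assms(4) by (simp add: relation_def)
qed

lemma family_fitting_cong:
  assumes "left_module R N" "\<And>j. j < n \<Longrightarrow> e' j = e j" "\<And>j. j < n \<Longrightarrow> e j \<in> carrier N"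
  shows "family_fitting R N n e' = family_fitting R N n e"
proof -
  have "relation R N n e' r \<longleftrightarrow> relation R N n e r" for r
    using relation_cong[OF assms(1), of n e' e r] relation_cong[OF assms(1), of n e e' r] assms by auto
  then show ?thesis by (simp add: family_fitting_def)
qed

text \<open>
Adding $s_j$ times the last column to column \<open>j\<close> turns the first \<open>n\<close> entries of every row into
a relation of the first \<open>n\<close> generators and preserves the determinant. Expansion along the last column
then writes it as a combination of determinants for these generators.
\<close>

lemma family_fitting_drop_last:
  assumes N: "left_module R N" and e: "\<And>j. j < Suc n \<Longrightarrow> e j \<in> carrier N"
    and s: "\<And>j. j < n \<Longrightarrow> s j \<in> carrier R"
    and en: "e n = (\<Oplus>\<^bsub>N\<^esub>j\<in>{..<n}. s j \<odot>\<^bsub>N\<^esub> e j)"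
  shows "family_fitting R N (Suc n) e \<subseteq> family_fitting R N n e"
proof (rule family_fitting_subset[OF family_fitting_ideal])
  interpret N: left_module R N by fact
  fix D assume rel: "\<forall>i<Suc n. relation R N (Suc n) e (D i)"
  then have D: "D i j \<in> carrier R" if "i < Suc n" "j < Suc n" for i j
    using that by (auto simp: relation_def)
  define U where "U k j = (if k = n \<and> j < n then s j else if k = j then \<one> else \<zero>)" for k j
  define Y where "Y i j = (if j < n then D i j \<oplus> D i n \<otimes> s j else D i n)" for i j
  have U: "U k j \<in> carrier R" if "k < Suc n" "j < Suc n" for k j using that s by (simp add: U_def)
  have Y: "Y i j \<in> carrier R" if "i < Suc n" "j < Suc n" for i j using that s D by (simp add: Y_def)
  have "determinant R (Suc n) U = \<one>"
  proof -
    have "determinant R (Suc n) U = U n n \<otimes> determinant R n U"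
      using U by (intro determinant_last_column_single) (auto simp: U_def)
    also have "determinant R n U = determinant R n (\<lambda>i j. if i = j then \<one> else \<zero>)"
      by (rule determinant_cong) (auto simp: U_def)
    also have "U n n = \<one>" by (simp add: U_def)
    finally show ?thesis by (simp add: determinant_identity)
  qed
  then have "determinant R (Suc n) D = determinant R (Suc n) (\<lambda>i j. \<Oplus>k\<in>{..<Suc n}. D i k \<otimes> U k j)"
    using determinant_mult[of "Suc n" D U] D U determinant_closed[of "Suc n" D, OF D] by simp
  also have "\<dots> = determinant R (Suc n) Y"
  proof (rule determinant_cong[OF Y])
    fix i j assume ij: "i < Suc n" "j < Suc n"
    have "(\<Oplus>k\<in>{..<n}. D i k \<otimes> U k j) = (\<Oplus>k\<in>{..<n}. if j = k then D i k else \<zero>)"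
      using ij D by (intro finsum_cong' refl) (auto simp: U_def)
    also have "\<dots> = (if j < n then D i j else \<zero>)"
    proof (cases "j < n")
      case True
      then show ?thesis using D ij by (simp add: finsum_singleton)
    next
      case False
      have "(\<Oplus>k\<in>{..<n}. if j = k then D i k else \<zero>) = (\<Oplus>k\<in>{..<n}. \<zero>)"
        using False by (intro finsum_cong' refl) auto
      then show ?thesis using False by simp
    qed
    finally show "(\<Oplus>k\<in>{..<Suc n}. D i k \<otimes> U k j) = Y i j"
      using ij D U s unfolding lessThan_Suc by (subst finsum_insert) (auto simp: U_def Y_def a_comm less_Suc_eq)
  qed
  also have "\<dots> = (\<Oplus>i\<in>{..<Suc n}. perm_sign (transpose i n) \<otimes> Y i n \<otimes>
      determinant R n (\<lambda>k j. Y (transpose i n k) j))"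
    using Y by (rule determinant_expand_last_column)
  also have "\<dots> \<in> family_fitting R N n e"
  proof (rule ideal_finsum[OF family_fitting_ideal])
    fix i assume i: "i \<in> {..<Suc n}"
    have rY: "relation R N n e (Y k)" if k: "k < Suc n" for k
    proof -
      have cl: "D k j \<odot>\<^bsub>N\<^esub> e j \<in> carrier N" if "j < Suc n" for j using that k D e N.smult_closed by auto
      have cl': "D k n \<otimes> s j \<odot>\<^bsub>N\<^esub> e j \<in> carrier N" if "j < n" for j
        using that k D e s by (intro N.smult_closed) auto
      have "(\<Oplus>\<^bsub>N\<^esub>j\<in>{..<n}. Y k j \<odot>\<^bsub>N\<^esub> e j) =
          (\<Oplus>\<^bsub>N\<^esub>j\<in>{..<n}. D k j \<odot>\<^bsub>N\<^esub> e j \<oplus>\<^bsub>N\<^esub> (D k n \<otimes> s j) \<odot>\<^bsub>N\<^esub> e j)"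
        using k D e s cl cl' by (intro N.M.finsum_cong' refl) (auto simp: Y_def N.smult_l_distr)
      also have "\<dots> = (\<Oplus>\<^bsub>N\<^esub>j\<in>{..<n}. D k j \<odot>\<^bsub>N\<^esub> e j) \<oplus>\<^bsub>N\<^esub> (\<Oplus>\<^bsub>N\<^esub>j\<in>{..<n}. (D k n \<otimes> s j) \<odot>\<^bsub>N\<^esub> e j)"
        using cl cl' by (intro N.M.finsum_addf) auto
      also have "(\<Oplus>\<^bsub>N\<^esub>j\<in>{..<n}. (D k n \<otimes> s j) \<odot>\<^bsub>N\<^esub> e j) = (\<Oplus>\<^bsub>N\<^esub>j\<in>{..<n}. D k n \<odot>\<^bsub>N\<^esub> (s j \<odot>\<^bsub>N\<^esub> e j))"
        using k D e s by (intro N.M.finsum_cong' refl) (auto simp: N.smult_assoc N.smult_closed)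
      also have "\<dots> = D k n \<odot>\<^bsub>N\<^esub> e n"
        unfolding en using k D e s by (intro N.smult_finsum_right[symmetric]) (auto intro: N.smult_closed)
      also have "(\<Oplus>\<^bsub>N\<^esub>j\<in>{..<n}. D k j \<odot>\<^bsub>N\<^esub> e j) \<oplus>\<^bsub>N\<^esub> D k n \<odot>\<^bsub>N\<^esub> e n =
          (\<Oplus>\<^bsub>N\<^esub>j\<in>{..<Suc n}. D k j \<odot>\<^bsub>N\<^esub> e j)"
        unfolding lessThan_Suc using cl by (subst N.M.finsum_insert) (auto intro!: N.M.a_comm N.M.finsum_closed)
      also have "\<dots> = \<zero>\<^bsub>N\<^esub>" using rel k by (auto simp: relation_def)
      finally show ?thesis using Y k by (auto simp: relation_def)
    qed
    have "determinant R n (\<lambda>k. Y (transpose i n k)) \<in> family_fitting R N n e"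
      using i rY by (intro family_fitting_mem) (auto simp: transpose_def)
    then show "perm_sign (transpose i n) \<otimes> Y i n \<otimes> determinant R n (\<lambda>k j. Y (transpose i n k) j)
        \<in> family_fitting R N n e"
      using i Y by (intro ideal.I_l_closed[OF family_fitting_ideal]) auto
  qed
  finally show "determinant R (Suc n) D \<in> family_fitting R N n e" .
qed

lemma family_fitting_drop:
  assumes N: "left_module R N" and e: "\<And>j. j < n + m \<Longrightarrow> e j \<in> carrier N"
    and s: "\<And>k j. k < m \<Longrightarrow> j < n \<Longrightarrow> s k j \<in> carrier R"
    and en: "\<And>k. k < m \<Longrightarrow> e (n + k) = (\<Oplus>\<^bsub>N\<^esub>j\<in>{..<n}. s k j \<odot>\<^bsub>N\<^esub> e j)"
  shows "family_fitting R N (n + m) e \<subseteq> family_fitting R N n e"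
  using e s en
proof (induction m)
  case (Suc m)
  interpret N: left_module R N by fact
  let ?s = "\<lambda>j. if j < n then s m j else \<zero>"
  have cl: "s m j \<odot>\<^bsub>N\<^esub> e j \<in> carrier N" if "j < n" for j
    using that Suc.prems by (intro N.smult_closed) auto
  have "(\<Oplus>\<^bsub>N\<^esub>j\<in>{..<n + m}. ?s j \<odot>\<^bsub>N\<^esub> e j) = (\<Oplus>\<^bsub>N\<^esub>j\<in>{..<n}. s m j \<odot>\<^bsub>N\<^esub> e j)"
    using Suc.prems cl
    by (intro N.M.add.finprod_mono_neutral_cong_right) (auto simp: N.smult_zero_left)
  then have "family_fitting R N (Suc (n + m)) e \<subseteq> family_fitting R N (n + m) e"
    using Suc.prems by (intro family_fitting_drop_last[OF N, of _ _ ?s]) auto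
  also have "\<dots> \<subseteq> family_fitting R N n e"
    using Suc by auto
  finally show ?case by simp
qed simp

lemma family_fitting_permute:
  assumes N: "left_module R N" and e: "\<And>j. j < n \<Longrightarrow> e j \<in> carrier N" and \<pi>: "\<pi> permutes {..<n}"
  shows "family_fitting R N n e \<subseteq> family_fitting R N n (\<lambda>j. e (\<pi> j))"
proof (rule family_fitting_subset[OF family_fitting_ideal])
  interpret N: left_module R N by fact
  fix D assume rel: "\<forall>i<n. relation R N n e (D i)"
  have lt: "\<pi> j < n" if "j < n" for j using that permutes_in_image[OF \<pi>, of j] by simp
  have D: "D i j \<in> carrier R" if "i < n" "j < n" for i j using rel that by (auto simp: relation_def)
  have "relation R N n (\<lambda>j. e (\<pi> j)) (\<lambda>j. D i (\<pi> j))" if i: "i < n" for i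
  proof -
    have "(\<Oplus>\<^bsub>N\<^esub>j\<in>\<pi> ` {..<n}. D i j \<odot>\<^bsub>N\<^esub> e j) = (\<Oplus>\<^bsub>N\<^esub>j\<in>{..<n}. D i (\<pi> j) \<odot>\<^bsub>N\<^esub> e (\<pi> j))"
      using D i e lt permutes_inj_on[OF \<pi>] by (intro N.M.finsum_reindex) (auto simp: N.smult_closed)
    then show ?thesis using rel i D lt permutes_image[OF \<pi>] by (simp add: relation_def)
  qed
  then have "determinant R n (\<lambda>i j. D i (\<pi> j)) \<in> family_fitting R N n (\<lambda>j. e (\<pi> j))"
    by (intro family_fitting_mem) auto
  then have "perm_sign \<pi> \<otimes> (perm_sign \<pi> \<otimes> determinant R n D) \<in> family_fitting R N n (\<lambda>j. e (\<pi> j))"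
    using determinant_permute_columns[of n D, OF D \<pi>] by (simp add: ideal.I_l_closed[OF family_fitting_ideal])
  moreover have "perm_sign \<pi> \<otimes> (perm_sign \<pi> \<otimes> determinant R n D) = determinant R n D"
    using determinant_closed[of n D, OF D] by (auto simp: perm_sign_def l_minus)
  ultimately show "determinant R n D \<in> family_fitting R N n (\<lambda>j. e (\<pi> j))" by simp
qed

text \<open>
The family consisting of all $f(e_k)$ and all $e'_k$ has two kinds of relations: the images of
relations of \<open>e\<close>, and $c e'_k - f(g(e'_k)) = 0$, in which $g(e'_k)$ is expanded in \<open>e\<close>. For a matrix
\<open>D\<close> of relations of \<open>e\<close>, these form a block triangular matrix of determinant $c^{b'} \det D$. Since the
$f(e_k)$ are combinations of the $e'_k$, they can be dropped from the family.
\<close>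

lemma family_fitting_transfer:
  assumes N: "left_module R N" and N': "left_module R N'"
    and e: "spans R N b e" and e': "spans R N' b' e'"
    and f: "f \<in> left_hom R N N'" and g: "g \<in> left_hom R N' N" and c: "c \<in> carrier R"
    and fg: "\<And>y. y \<in> carrier N' \<Longrightarrow> f (g y) = c \<odot>\<^bsub>N'\<^esub> y"
    and d: "d \<in> family_fitting R N b e"
  shows "c [^] b' \<otimes> d \<in> family_fitting R N' b' e'"
proof -
  interpret N: left_module R N by fact
  interpret N': left_module R N' by fact
  let ?J = "family_fitting R N' b' e'"
  let ?I = "{d \<in> carrier R. c [^] b' \<otimes> d \<in> ?J}"
  have ecl: "e j \<in> carrier N" if "j < b" for j using e that by (auto simp: spans_def)
  have ecl': "e' j \<in> carrier N'" if "j < b'" for j using e' that by (auto simp: spans_def)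
  have fcl: "f x \<in> carrier N'" if "x \<in> carrier N" for x
    using additive_closed[OF left_hom_additive[OF f] that] .
  have gcl: "g x \<in> carrier N" if "x \<in> carrier N'" for x
    using additive_closed[OF left_hom_additive[OF g] that] .
  have J: "ideal ?J R" by (rule family_fitting_ideal)
  have "?I = {d \<in> carrier R. d \<otimes> c [^] b' \<in> ?J}" using c by (auto simp: m_comm)
  then have "ideal ?I R" using ideal_colon[OF J, of "c [^] b'"] c by simp
  moreover have "determinant R b D \<in> ?I" if rel: "\<forall>i<b. relation R N b e (D i)" for D
  proof -
    have D: "D i j \<in> carrier R" if "i < b" "j < b" for i j using rel that by (auto simp: relation_def)
    have "\<forall>k. \<exists>s. k < b' \<longrightarrow> (\<forall>j<b. s j \<in> carrier R) \<and> g (e' k) = (\<Oplus>\<^bsub>N\<^esub>j\<in>{..<b}. s j \<odot>\<^bsub>N\<^esub> e j)"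
      using e gcl ecl' by (auto simp: spans_def)
    then obtain G where G: "\<And>k j. k < b' \<Longrightarrow> j < b \<Longrightarrow> G k j \<in> carrier R"
      and ge: "\<And>k. k < b' \<Longrightarrow> g (e' k) = (\<Oplus>\<^bsub>N\<^esub>j\<in>{..<b}. G k j \<odot>\<^bsub>N\<^esub> e j)"
      by metis
    have "\<forall>k. \<exists>s. k < b \<longrightarrow> (\<forall>j<b'. s j \<in> carrier R) \<and> f (e k) = (\<Oplus>\<^bsub>N'\<^esub>j\<in>{..<b'}. s j \<odot>\<^bsub>N'\<^esub> e' j)"
      using e' fcl ecl by (auto simp: spans_def)
    then obtain F where F: "\<And>k j. k < b \<Longrightarrow> j < b' \<Longrightarrow> F k j \<in> carrier R"
      and fe: "\<And>k. k < b \<Longrightarrow> f (e k) = (\<Oplus>\<^bsub>N'\<^esub>j\<in>{..<b'}. F k j \<odot>\<^bsub>N'\<^esub> e' j)"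
      by metis
    \<comment> \<open>The rows of \<open>W\<close> below \<open>D\<close> stand for $c e'_k - f(g(e'_k)) = 0$, with $g(e'_k)$ expanded by \<open>G\<close>.\<close>
    define E where "E j = (if j < b then f (e j) else e' (j - b))" for j
    define W where "W i j = (if i < b then if j < b then D i j else \<zero>
       else if j < b then \<ominus> G (i - b) j else if i = j then c else \<zero>)" for i j
    have E: "E j \<in> carrier N'" if "j < b + b'" for j using that ecl ecl' fcl by (auto simp: E_def)
    have W: "W i j \<in> carrier R" if "i < b + m" "j < b + m" "m \<le> b'" for i j m
      using that D G c by (auto simp: W_def)
    have detW: "m \<le> b' \<Longrightarrow> determinant R (b + m) W = c [^] m \<otimes> determinant R b D" for m
    proof (induction m)
      case 0
      have "determinant R b W = determinant R b D"
        using D by (intro determinant_cong) (auto simp: W_def)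
      then show ?case using D by (simp add: determinant_closed)
    next
      case (Suc m)
      have "determinant R (Suc (b + m)) W = W (b + m) (b + m) \<otimes> determinant R (b + m) W"
        using W[of _ "Suc m"] Suc.prems by (intro determinant_last_column_single) (auto simp: W_def)
      moreover have "W (b + m) (b + m) = c" by (simp add: W_def)
      ultimately show ?case using Suc c D determinant_closed[of b D, OF D] by (simp add: m_ac)
    qed
    have "relation R N' (b + b') E (W i)" if i: "i < b + b'" for i
    proof -
      have cl: "W i j \<odot>\<^bsub>N'\<^esub> E j \<in> carrier N'" if "j < b + b'" for j
        using i that E W[of i b' j] by (intro N'.smult_closed) auto
      have un: "{..<b + b'} = {..<b} \<union> {b..<b + b'}" by auto
      have split: "(\<Oplus>\<^bsub>N'\<^esub>j\<in>{..<b + b'}. W i j \<odot>\<^bsub>N'\<^esub> E j) =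
          (\<Oplus>\<^bsub>N'\<^esub>j\<in>{..<b}. W i j \<odot>\<^bsub>N'\<^esub> E j) \<oplus>\<^bsub>N'\<^esub> (\<Oplus>\<^bsub>N'\<^esub>j\<in>{b..<b + b'}. W i j \<odot>\<^bsub>N'\<^esub> E j)"
        unfolding un using cl by (intro N'.M.finsum_Un_disjoint) auto
      have "(\<Oplus>\<^bsub>N'\<^esub>j\<in>{..<b + b'}. W i j \<odot>\<^bsub>N'\<^esub> E j) = \<zero>\<^bsub>N'\<^esub>"
      proof (cases "i < b")
        case True
        have "(\<Oplus>\<^bsub>N'\<^esub>j\<in>{..<b}. W i j \<odot>\<^bsub>N'\<^esub> E j) = (\<Oplus>\<^bsub>N'\<^esub>j\<in>{..<b}. D i j \<odot>\<^bsub>N'\<^esub> f (e j))"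
          using True D fcl ecl by (intro N'.M.finsum_cong' refl) (auto simp: W_def E_def N'.smult_closed)
        also have "\<dots> = f (\<Oplus>\<^bsub>N\<^esub>j\<in>{..<b}. D i j \<odot>\<^bsub>N\<^esub> e j)"
          using True D ecl by (intro left_hom_combination[OF N N' f, symmetric]) auto
        also have "\<dots> = \<zero>\<^bsub>N'\<^esub>" using rel True
          additive_zero[OF N.M.abelian_group_axioms N'.M.abelian_group_axioms left_hom_additive[OF f]]
          by (simp add: relation_def)
        moreover have "(\<Oplus>\<^bsub>N'\<^esub>j\<in>{b..<b + b'}. W i j \<odot>\<^bsub>N'\<^esub> E j) = (\<Oplus>\<^bsub>N'\<^esub>j\<in>{b..<b + b'}. \<zero>\<^bsub>N'\<^esub>)"
          using True E by (intro N'.M.finsum_cong' refl) (auto simp: W_def N'.smult_zero_left)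
        ultimately show ?thesis by (simp add: split)
      next
        case False
        define k where "k = i - b"
        have k: "k < b'" using False i by (auto simp: k_def)
        have Gf: "G k j \<odot>\<^bsub>N'\<^esub> f (e j) \<in> carrier N'" if "j < b" for j
          using that k G ecl fcl by (intro N'.smult_closed) auto
        have "(\<Oplus>\<^bsub>N'\<^esub>j\<in>{..<b}. W i j \<odot>\<^bsub>N'\<^esub> E j) = (\<Oplus>\<^bsub>N'\<^esub>j\<in>{..<b}. (\<ominus> G k j) \<odot>\<^bsub>N'\<^esub> f (e j))"
          using False k G fcl ecl Gf by (intro N'.M.finsum_cong' refl) (auto simp: W_def E_def k_def N'.smult_minus_left)
        also have "\<dots> = f (\<Oplus>\<^bsub>N\<^esub>j\<in>{..<b}. (\<ominus> G k j) \<odot>\<^bsub>N\<^esub> e j)"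
          using k G ecl by (intro left_hom_combination[OF N N' f, symmetric]) auto
        also have "(\<Oplus>\<^bsub>N\<^esub>j\<in>{..<b}. (\<ominus> G k j) \<odot>\<^bsub>N\<^esub> e j) = (\<Oplus>\<^bsub>N\<^esub>j\<in>{..<b}. (\<ominus> \<one>) \<odot>\<^bsub>N\<^esub> (G k j \<odot>\<^bsub>N\<^esub> e j))"
          using k G ecl by (intro N.M.finsum_cong' refl)
            (auto simp: N.smult_closed l_minus simp flip: N.smult_assoc)
        also have "\<dots> = (\<ominus> \<one>) \<odot>\<^bsub>N\<^esub> g (e' k)"
          unfolding ge[OF k] using k G ecl by (intro N.smult_finsum_right[symmetric]) (auto intro: N.smult_closed)
        also have "f \<dots> = (\<ominus> \<one>) \<odot>\<^bsub>N'\<^esub> (c \<odot>\<^bsub>N'\<^esub> e' k)"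
          using k ecl' gcl fg by (simp add: left_hom_smult[OF f])
        also have "\<dots> = \<ominus>\<^bsub>N'\<^esub> (c \<odot>\<^bsub>N'\<^esub> e' k)"
          using k ecl' c by (simp add: N'.smult_minus_left N'.smult_closed N'.smult_one)
        finally have 1: "(\<Oplus>\<^bsub>N'\<^esub>j\<in>{..<b}. W i j \<odot>\<^bsub>N'\<^esub> E j) = \<ominus>\<^bsub>N'\<^esub> (c \<odot>\<^bsub>N'\<^esub> e' k)" .
        have "(\<Oplus>\<^bsub>N'\<^esub>j\<in>{b..<b + b'}. W i j \<odot>\<^bsub>N'\<^esub> E j) =
            (\<Oplus>\<^bsub>N'\<^esub>j\<in>{b..<b + b'}. if i = j then c \<odot>\<^bsub>N'\<^esub> e' (j - b) else \<zero>\<^bsub>N'\<^esub>)"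
          using False i k ecl' c N'.smult_closed
          by (intro N'.M.finsum_cong' refl) (auto simp: W_def E_def N'.smult_zero_left)
        also have "\<dots> = c \<odot>\<^bsub>N'\<^esub> e' k"
          using False i k ecl' c N'.smult_closed unfolding k_def
          by (intro N'.M.finsum_singleton) auto
        finally show ?thesis using 1 k ecl' c by (simp add: split N'.M.l_neg N'.smult_closed)
      qed
      then show ?thesis using W[of i b'] i by (auto simp: relation_def)
    qed
    then have "determinant R (b + b') W \<in> family_fitting R N' (b + b') E"
      by (intro family_fitting_mem) auto
    also have "\<dots> \<subseteq> family_fitting R N' (b + b')
        (\<lambda>j. E (if j < b' then j + b else if j < b + b' then j - b' else j))"
    proof (rule family_fitting_permute[OF N' E])
      let ?\<pi> = "\<lambda>j. if j < b' then j + b else if j < b + b' then j - b' else j"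
      have "bij_betw ?\<pi> {..<b + b'} {..<b + b'}"
        by (rule bij_betwI[where g = "\<lambda>j. if j < b then j + b' else j - b"]) auto
      then show "?\<pi> permutes {..<b + b'}" by (rule bij_imp_permutes) auto
    qed
    also have "\<dots> = family_fitting R N' (b + b') (\<lambda>j. if j < b' then e' j else f (e (j - b')))"
      using ecl' ecl fcl by (intro family_fitting_cong[OF N']) (auto simp: E_def)
    also have "\<dots> \<subseteq> family_fitting R N' b' (\<lambda>j. if j < b' then e' j else f (e (j - b')))"
      unfolding add.commute[of b b']
    proof (rule family_fitting_drop[OF N', where s = F])
      fix k assume "k < b"
      then have "f (e k) = (\<Oplus>\<^bsub>N'\<^esub>j\<in>{..<b'}. F k j \<odot>\<^bsub>N'\<^esub> (if j < b' then e' j else f (e (j - b'))))"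
        unfolding fe[OF \<open>k < b\<close>] using F ecl' by (intro N'.M.finsum_cong' refl) (auto simp: N'.smult_closed)
      then show "(if b' + k < b' then e' (b' + k) else f (e (b' + k - b'))) =
         (\<Oplus>\<^bsub>N'\<^esub>j\<in>{..<b'}. F k j \<odot>\<^bsub>N'\<^esub> (if j < b' then e' j else f (e (j - b'))))" by simp
    qed (use F ecl ecl' fcl in auto)
    also have "\<dots> = ?J"
      using ecl' by (intro family_fitting_cong[OF N']) auto
    finally have "c [^] b' \<otimes> determinant R b D \<in> ?J" by (simp add: detW)
    then show ?thesis using D determinant_closed by auto
  qed
  ultimately have "family_fitting R N b e \<subseteq> ?I" by (rule family_fitting_subset)
  then show ?thesis using d by auto
qed

text \<open>
In the induction every step spends one factor $x + y$ and raises the exponent of \<open>x\<close> or of \<open>y\<close>;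
once none is left, one of the two exponents is large enough.
\<close>

lemma ideal_power_add:
  assumes K: "ideal K R" and x: "x \<in> carrier R" "x [^] n \<in> K" and y: "y \<in> carrier R" "y [^] (m::nat) \<in> K"
  shows "(x \<oplus> y) [^] (n + m) \<in> K"
proof -
  have "n + m \<le> a + b + t \<Longrightarrow> x [^] a \<otimes> y [^] b \<otimes> (x \<oplus> y) [^] t \<in> K" for a b t :: nat
  proof (induction t arbitrary: a b)
    case 0
    then consider "n \<le> a" | "m \<le> b" by linarith
    then show ?case
    proof cases
      case 1
      then have "x [^] a \<otimes> y [^] b = x [^] n \<otimes> (x [^] (a - n) \<otimes> y [^] b)"
        using x y by (simp add: nat_pow_mult flip: m_assoc)
      then show ?thesis using ideal.I_r_closed[OF K x(2)] x y by simp
    next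
      case 2
      then have "x [^] a \<otimes> y [^] b = (x [^] a \<otimes> y [^] (b - m)) \<otimes> y [^] m"
        using x y by (simp add: nat_pow_mult m_assoc)
      then show ?thesis using ideal.I_l_closed[OF K y(2)] x y by simp
    qed
  next
    case (Suc t)
    have "x [^] a \<otimes> y [^] b \<otimes> (x \<oplus> y) [^] Suc t =
        x [^] Suc a \<otimes> y [^] b \<otimes> (x \<oplus> y) [^] t \<oplus> x [^] a \<otimes> y [^] Suc b \<otimes> (x \<oplus> y) [^] t"
      using x y by (simp add: l_distr r_distr m_ac)
    also have "\<dots> \<in> K"
      using Suc.IH[of "Suc a" b] Suc.IH[of a "Suc b"] Suc.prems
        additive_subgroup.a_closed[OF ideal.axioms(1)[OF K]] by simp
    finally show ?case .
  qed
  from this[of 0 0 "n + m"] show ?thesis using x y by simp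
qed

lemma ideal_one_of_powers:
  assumes K: "ideal K R" and "finite S" and c: "\<And>s. s \<in> S \<Longrightarrow> c s \<in> carrier R"
    and pow: "\<And>s. s \<in> S \<Longrightarrow> c s [^] (n::nat) \<in> K" and one: "(\<Oplus>s\<in>S. c s) = \<one>"
  shows "\<one> \<in> K"
proof -
  have "\<exists>m::nat. (\<Oplus>s\<in>S. c s) [^] m \<in> K"
    using \<open>finite S\<close> c pow
  proof (induction S)
    case empty
    show ?case using additive_subgroup.zero_closed[OF ideal.axioms(1)[OF K]]
      by (intro exI[of _ 1]) simp
  next
    case (insert s S)
    then obtain m :: nat where "(\<Oplus>s\<in>S. c s) [^] m \<in> K" by auto
    then have "(c s \<oplus> (\<Oplus>s\<in>S. c s)) [^] (n + m) \<in> K"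
      using insert by (intro ideal_power_add[OF K]) auto
    then show ?case using insert by (subst finsum_insert) auto
  qed
  then show ?thesis by (simp add: one)
qed

text \<open>
The passage from local to global: the elements that multiply \<open>d\<close> into the right hand side form an
ideal. It contains a power of every $c_s$, and these powers generate the unit ideal.
\<close>

lemma family_fitting_subset_of_local_maps:
  assumes N: "left_module R N" and N': "left_module R N'"
    and e: "spans R N b e" and e': "spans R N' b' e'" and S: "finite S"
    and f: "\<And>s. s \<in> S \<Longrightarrow> f s \<in> left_hom R N N'" and g: "\<And>s. s \<in> S \<Longrightarrow> g s \<in> left_hom R N' N"
    and c: "\<And>s. s \<in> S \<Longrightarrow> c s \<in> carrier R" "(\<Oplus>s\<in>S. c s) = \<one>"
    and fg: "\<And>s y. s \<in> S \<Longrightarrow> y \<in> carrier N' \<Longrightarrow> f s (g s y) = c s \<odot>\<^bsub>N'\<^esub> y"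
  shows "family_fitting R N b e \<subseteq> family_fitting R N' b' e'"
proof
  fix d assume d: "d \<in> family_fitting R N b e"
  let ?J = "family_fitting R N' b' e'"
  let ?K = "{r \<in> carrier R. r \<otimes> d \<in> ?J}"
  have J: "ideal ?J R" by (rule family_fitting_ideal)
  have dR: "d \<in> carrier R" using ideal.Icarr[OF family_fitting_ideal d] .
  have "ideal ?K R" using J dR by (rule ideal_colon)
  moreover have "c s [^] b' \<in> ?K" if "s \<in> S" for s
    using family_fitting_transfer[OF N N' e e' f[OF that] g[OF that] c(1)[OF that] fg[OF that] d] c(1)[OF that]
    by auto
  ultimately have "\<one> \<in> ?K" using S c by (intro ideal_one_of_powers[of ?K S c b']) auto
  then show "d \<in> ?J" using dR by simp
qed

text \<open>
Fitting's lemma, obtained by comparing the two families along the identity map.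
\<close>

lemma family_fitting_unique:
  assumes N: "left_module R N" and e: "spans R N b e" and e': "spans R N b' e'"
  shows "family_fitting R N b e = family_fitting R N b' e'"
proof -
  interpret N: left_module R N by fact
  let ?id = "\<lambda>x\<in>carrier N. x"
  have id: "?id \<in> left_hom R N N" by (auto simp: left_hom_def N.smult_closed)
  have *: "(\<Oplus>s\<in>{0::nat}. \<one>) = \<one>" by (subst finsum_insert) auto
  show ?thesis
    using family_fitting_subset_of_local_maps[OF N N e e', of "{0::nat}" "\<lambda>_. ?id" "\<lambda>_. ?id" "\<lambda>_. \<one>"] id *
      family_fitting_subset_of_local_maps[OF N N e' e, of "{0::nat}" "\<lambda>_. ?id" "\<lambda>_. ?id" "\<lambda>_. \<one>"]
    by (auto simp: N.smult_one)
qed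

end

lemma inj_strict_mono_factorization:
  fixes c :: "nat \<Rightarrow> nat"
  assumes "inj_on c {..<n}"
  obtains c' \<pi> where "strict_mono_on {..<n} c'" "c' ` {..<n} = c ` {..<n}" "\<pi> permutes {..<n}"
    "\<And>i. i < n \<Longrightarrow> c i = c' (\<pi> i)"
proof -
  let ?T = "c ` {..<n}"
  let ?c = "\<lambda>i. sorted_list_of_set ?T ! i"
  have len: "length (sorted_list_of_set ?T) = n" using assms by (simp add: card_image)
  have mono: "strict_mono_on {..<n} ?c"
    using len sorted_wrt_nth_less[OF strict_sorted_list_of_set[of ?T]] by (auto simp: strict_mono_on_def)
  have im: "?c ` {..<n} = ?T"
    using len set_sorted_list_of_set[of ?T] by (auto simp: set_conv_nth image_def)
  then have bij: "bij_betw ?c {..<n} ?T" using mono by (simp add: bij_betw_def strict_mono_on_imp_inj_on)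
  let ?\<pi> = "\<lambda>i. if i < n then inv_into {..<n} ?c (c i) else i"
  have "bij_betw (inv_into {..<n} ?c \<circ> c) {..<n} {..<n}"
    using assms bij_betw_inv_into[OF bij] by (intro bij_betw_trans[of c _ ?T]) (auto simp: bij_betw_def)
  then have "bij_betw ?\<pi> {..<n} {..<n}" by (rule bij_betw_cong[THEN iffD1, rotated]) auto
  then have "?\<pi> permutes {..<n}" by (rule bij_imp_permutes) auto
  moreover have "c i = ?c (?\<pi> i)" if "i < n" for i
    using that im f_inv_into_f[of "c i" ?c "{..<n}"] by auto
  ultimately show thesis using that mono im by blast
qed

definition presents :: "('a, 'x) ring_scheme \<Rightarrow> ('a, 'm, 'y) module_scheme \<Rightarrow> nat \<Rightarrow> (nat \<Rightarrow> 'm)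
    \<Rightarrow> nat \<Rightarrow> (nat \<Rightarrow> nat \<Rightarrow> 'a) \<Rightarrow> bool"
  where "presents R N b e a rel \<longleftrightarrow> spans R N b e \<and> (\<forall>l<a. relation R N b e (rel l)) \<and>
    (\<forall>s. relation R N b e s \<longrightarrow>
      (\<exists>\<mu>. (\<forall>l<a. \<mu> l \<in> carrier R) \<and> (\<forall>i<b. s i = (\<Oplus>\<^bsub>R\<^esub>l\<in>{..<a}. \<mu> l \<otimes>\<^bsub>R\<^esub> rel l i))))"

text \<open>
By multilinearity a determinant of arbitrary relations is a combination of determinants of given ones.
Those with a repeated row vanish, which leaves nothing if there are fewer relations than generators;
the others are maximal minors up to the order of the rows.
\<close>

lemma (in cring) family_fitting_presents:
  assumes p: "presents R N b e a rel"
  shows "family_fitting R N b e =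
    (if a \<ge> b then Idl {determinant R b (\<lambda>i j. rel (c j) i) | c.
       strict_mono_on {..<b} c \<and> c ` {..<b} \<subseteq> {..<a}} else {\<zero>})" (is "_ = ?I")
proof
  have rel: "relation R N b e (rel l)" if "l < a" for l using p that by (auto simp: presents_def)
  have cl: "rel l i \<in> carrier R" if "l < a" "i < b" for l i using rel[OF that(1)] that by (auto simp: relation_def)
  let ?M = "{determinant R b (\<lambda>i j. rel (c j) i) | c. strict_mono_on {..<b} c \<and> c ` {..<b} \<subseteq> {..<a}}"
  have transp: "determinant R b (\<lambda>i j. rel (c j) i) = determinant R b (\<lambda>i j. rel (c i) j)"
    if "c ` {..<b} \<subseteq> {..<a}" for c
    using that cl by (intro determinant_transpose) auto
  have M: "?M \<subseteq> carrier R"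
    using cl by (auto intro!: determinant_closed)
  have I: "ideal ?I R" using M genideal_ideal zeroideal by auto
  show "family_fitting R N b e \<subseteq> ?I"
  proof (rule family_fitting_subset[OF I])
    fix D assume D: "\<forall>i<b. relation R N b e (D i)"
    then have "\<forall>i. \<exists>\<mu>. i < b \<longrightarrow> (\<forall>l<a. \<mu> l \<in> carrier R) \<and> (\<forall>j<b. D i j = (\<Oplus>l\<in>{..<a}. \<mu> l \<otimes> rel l j))"
      using p by (auto simp: presents_def)
    then obtain \<mu> where \<mu>: "\<And>i l. i < b \<Longrightarrow> l < a \<Longrightarrow> \<mu> i l \<in> carrier R"
      and D\<mu>: "\<And>i j. i < b \<Longrightarrow> j < b \<Longrightarrow> D i j = (\<Oplus>l\<in>{..<a}. \<mu> i l \<otimes> rel l j)" by metis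
    have "determinant R b D = determinant R b (\<lambda>i j. \<Oplus>l\<in>{..<a}. \<mu> i l \<otimes> rel l j)"
      using D\<mu> \<mu> cl by (intro determinant_cong) (auto intro!: finsum_closed)
    also have "\<dots> = (\<Oplus>c\<in>{..<b} \<rightarrow>\<^sub>E {..<a}. (\<Otimes>i\<in>{..<b}. \<mu> i (c i)) \<otimes> determinant R b (\<lambda>i j. rel (c i) j))"
      using \<mu> cl by (intro determinant_row_combinations) auto
    also have "\<dots> \<in> ?I"
    proof (rule ideal_finsum[OF I])
      fix c assume c: "c \<in> {..<b} \<rightarrow>\<^sub>E {..<a}"
      then have ca: "c i < a" if "i < b" for i using that by auto
      have "determinant R b (\<lambda>i j. rel (c i) j) \<in> ?I"
      proof (cases "inj_on c {..<b}")
        case False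
        then obtain i j where "i < b" "j < b" "i \<noteq> j" "c i = c j" by (auto simp: inj_on_def)
        then have "determinant R b (\<lambda>i j. rel (c i) j) = \<zero>"
          using cl ca by (intro determinant_equal_rows[of b _ i j]) auto
        then show ?thesis using additive_subgroup.zero_closed[OF ideal.axioms(1)[OF I]] by simp
      next
        case True
        then obtain c' \<pi> where mono: "strict_mono_on {..<b} c'" and im: "c' ` {..<b} = c ` {..<b}"
          and \<pi>: "\<pi> permutes {..<b}" and c': "\<And>i. i < b \<Longrightarrow> c i = c' (\<pi> i)"
          using inj_strict_mono_factorization[of c b] by blast
        have sub: "c' ` {..<b} \<subseteq> {..<a}" using im ca by auto
        have "b \<le> a" using card_inj_on_le[OF True, of "{..<a}"] ca by auto
        moreover have "determinant R b (\<lambda>i j. rel (c' i) j) \<in> ?M"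
          using mono sub transp[OF sub, symmetric] by blast
        ultimately have m: "determinant R b (\<lambda>i j. rel (c' i) j) \<in> ?I" using genideal_self[OF M] by auto
        have lt: "\<pi> i < b" if "i < b" for i using that permutes_in_image[OF \<pi>, of i] by simp
        have "determinant R b (\<lambda>i j. rel (c i) j) = determinant R b (\<lambda>i j. rel (c' (\<pi> i)) j)"
          using c' cl sub lt by (intro determinant_cong) (auto simp: image_subset_iff)
        also have "\<dots> = perm_sign \<pi> \<otimes> determinant R b (\<lambda>i j. rel (c' i) j)"
          using cl sub \<pi> by (intro determinant_permute_rows[of b "\<lambda>i j. rel (c' i) j"]) (auto simp: image_subset_iff)
        finally show ?thesis using ideal.I_l_closed[OF I m] by simp
      qed
      then show "(\<Otimes>i\<in>{..<b}. \<mu> i (c i)) \<otimes> determinant R b (\<lambda>i j. rel (c i) j) \<in> ?I"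
        using \<mu> ca ideal.I_l_closed[OF I] by (auto intro!: finprod_closed)
    qed
    finally show "determinant R b D \<in> ?I" .
  qed
  show "?I \<subseteq> family_fitting R N b e"
  proof (cases "a \<ge> b")
    case True
    have "?M \<subseteq> family_fitting R N b e"
    proof safe
      fix c assume c: "c ` {..<b} \<subseteq> {..<a}"
      then show "determinant R b (\<lambda>i j. rel (c j) i) \<in> family_fitting R N b e"
        unfolding transp[OF c] using rel by (intro family_fitting_mem) (auto simp: image_subset_iff)
    qed
    then have "Idl ?M \<subseteq> family_fitting R N b e" by (rule genideal_minimal[OF family_fitting_ideal])
    then show ?thesis using True by simp
  next
    case False
    then show ?thesis using additive_subgroup.zero_closed[OF ideal.axioms(1)[OF family_fitting_ideal]] by auto
  qed
qed

section \<open>Finite presentations\<close>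

lemma abelian_group_direct_sum_power:
  assumes "abelian_group P"
  shows "abelian_group (direct_sum_power I P)"
proof -
  interpret P: abelian_group P by fact
  let ?C = "{f \<in> I \<rightarrow>\<^sub>E carrier P. finite {i \<in> I. f i \<noteq> \<zero>\<^bsub>P\<^esub>}}"
  have add: "(\<lambda>i\<in>I. f i \<oplus>\<^bsub>P\<^esub> g i) \<in> ?C" if "f \<in> ?C" "g \<in> ?C" for f g
  proof -
    have "finite {i \<in> I. f i \<oplus>\<^bsub>P\<^esub> g i \<noteq> \<zero>\<^bsub>P\<^esub>}"
      by (rule finite_subset[of _ "{i \<in> I. f i \<noteq> \<zero>\<^bsub>P\<^esub>} \<union> {i \<in> I. g i \<noteq> \<zero>\<^bsub>P\<^esub>}"]) (use that in auto)
    then show ?thesis using that by (auto simp: PiE_def Pi_def cong: conj_cong)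
  qed
  have inv: "(\<lambda>i\<in>I. \<ominus>\<^bsub>P\<^esub> f i) \<in> ?C" if "f \<in> ?C" for f
  proof -
    have "finite {i \<in> I. \<ominus>\<^bsub>P\<^esub> f i \<noteq> \<zero>\<^bsub>P\<^esub>}"
      by (rule finite_subset[of _ "{i \<in> I. f i \<noteq> \<zero>\<^bsub>P\<^esub>}"]) (use that in auto)
    then show ?thesis using that by (auto simp: PiE_def Pi_def cong: conj_cong)
  qed
  show ?thesis
  proof (rule abelian_groupI)
    fix x y z assume xyz: "x \<in> carrier (direct_sum_power I P)" "y \<in> carrier (direct_sum_power I P)"
      "z \<in> carrier (direct_sum_power I P)"
    show "x \<oplus>\<^bsub>direct_sum_power I P\<^esub> y \<oplus>\<^bsub>direct_sum_power I P\<^esub> z =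
        x \<oplus>\<^bsub>direct_sum_power I P\<^esub> (y \<oplus>\<^bsub>direct_sum_power I P\<^esub> z)"
      using xyz by (auto simp: direct_sum_power_def fun_eq_iff PiE_def Pi_def P.a_assoc)
  next
    fix x y assume xy: "x \<in> carrier (direct_sum_power I P)" "y \<in> carrier (direct_sum_power I P)"
    show "x \<oplus>\<^bsub>direct_sum_power I P\<^esub> y \<in> carrier (direct_sum_power I P)"
      using add[of x y] xy by (simp add: direct_sum_power_def)
    show "x \<oplus>\<^bsub>direct_sum_power I P\<^esub> y = y \<oplus>\<^bsub>direct_sum_power I P\<^esub> x"
      using xy by (auto simp: direct_sum_power_def fun_eq_iff PiE_def Pi_def P.a_comm)
  next
    fix x assume x: "x \<in> carrier (direct_sum_power I P)"
    show "\<zero>\<^bsub>direct_sum_power I P\<^esub> \<oplus>\<^bsub>direct_sum_power I P\<^esub> x = x"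
      using x by (auto simp: direct_sum_power_def fun_eq_iff PiE_def Pi_def extensional_def)
    show "\<exists>y\<in>carrier (direct_sum_power I P). y \<oplus>\<^bsub>direct_sum_power I P\<^esub> x = \<zero>\<^bsub>direct_sum_power I P\<^esub>"
      using x inv[of x] by (intro bexI[of _ "\<lambda>i\<in>I. \<ominus>\<^bsub>P\<^esub> x i"])
        (auto simp: direct_sum_power_def fun_eq_iff PiE_def Pi_def P.l_neg)
  qed (auto simp: direct_sum_power_def)
qed

definition coord_vector :: "'i set \<Rightarrow> ('b, 'x) ring_scheme \<Rightarrow> 'i \<Rightarrow> 'b \<Rightarrow> 'i \<Rightarrow> 'b"
  where "coord_vector I P i p = (\<lambda>k\<in>I. if k = i then p else \<zero>\<^bsub>P\<^esub>)"

lemma coord_vector_closed: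
  assumes "abelian_group P" "p \<in> carrier P"
  shows "coord_vector I P i p \<in> carrier (direct_sum_power I P)"
proof -
  interpret P: abelian_group P by fact
  have "finite {k \<in> I. (if k = i then p else \<zero>\<^bsub>P\<^esub>) \<noteq> \<zero>\<^bsub>P\<^esub>}"
    by (rule finite_subset[of _ "{i}"]) auto
  then show ?thesis using assms by (auto simp: direct_sum_power_def coord_vector_def cong: conj_cong)
qed

text \<open>
Only additivity is assumed, so that this decomposition serves left and right linear maps alike.
\<close>

lemma additive_direct_sum_power:
  assumes P: "abelian_group P" and N: "abelian_group N" and \<phi>: "additive_map (direct_sum_power I P) N \<phi>"
    and x: "x \<in> carrier (direct_sum_power I P)" and F: "finite F" "F \<subseteq> I" "\<And>i. i \<in> I - F \<Longrightarrow> x i = \<zero>\<^bsub>P\<^esub>"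
  shows "\<phi> x = (\<Oplus>\<^bsub>N\<^esub>i\<in>F. \<phi> (coord_vector I P i (x i)))"
  using F x
proof (induction F arbitrary: x)
  case empty
  interpret N: abelian_group N by fact
  have "x = \<zero>\<^bsub>direct_sum_power I P\<^esub>"
    using empty by (auto simp: direct_sum_power_def fun_eq_iff PiE_def extensional_def)
  then show ?case using additive_zero[OF abelian_group_direct_sum_power[OF P] N \<phi>] by simp
next
  case (insert k F)
  interpret P: abelian_group P by fact
  interpret N: abelian_group N by fact
  let ?y = "\<lambda>i\<in>I. if i = k then \<zero>\<^bsub>P\<^esub> else x i"
  have xP: "x i \<in> carrier P" if "i \<in> I" for i using insert.prems(3) that by (auto simp: direct_sum_power_def)
  have "finite {i \<in> I. (if i = k then \<zero>\<^bsub>P\<^esub> else x i) \<noteq> \<zero>\<^bsub>P\<^esub>}"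
    by (rule finite_subset[of _ "{i \<in> I. x i \<noteq> \<zero>\<^bsub>P\<^esub>}"]) (use insert.prems in \<open>auto simp: direct_sum_power_def\<close>)
  then have y: "?y \<in> carrier (direct_sum_power I P)"
    using xP by (auto simp: direct_sum_power_def cong: conj_cong)
  have eq: "x = coord_vector I P k (x k) \<oplus>\<^bsub>direct_sum_power I P\<^esub> ?y"
    using insert.prems xP by (auto simp: direct_sum_power_def coord_vector_def fun_eq_iff PiE_def extensional_def)
  have cv: "coord_vector I P i (x i) \<in> carrier (direct_sum_power I P)" if "i \<in> insert k F" for i
    using xP that insert.prems by (intro coord_vector_closed[OF P]) auto
  have "\<phi> x = \<phi> (coord_vector I P k (x k) \<oplus>\<^bsub>direct_sum_power I P\<^esub> ?y)"
    using eq by (rule arg_cong)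
  also have "\<dots> = \<phi> (coord_vector I P k (x k)) \<oplus>\<^bsub>N\<^esub> \<phi> ?y"
    by (rule additive_add[OF \<phi> cv y]) simp
  also have "\<phi> ?y = (\<Oplus>\<^bsub>N\<^esub>i\<in>F. \<phi> (coord_vector I P i (?y i)))"
    using insert.prems by (intro insert.IH[OF _ _ y]) auto
  also have "\<dots> = (\<Oplus>\<^bsub>N\<^esub>i\<in>F. \<phi> (coord_vector I P i (x i)))"
    using insert.prems insert.hyps additive_closed[OF \<phi> cv]
    by (intro N.finsum_cong' refl) (auto intro!: arg_cong[of _ _ \<phi>])
  finally show ?case
    using insert.hyps additive_closed[OF \<phi> cv] by (subst N.finsum_insert) auto
qed

lemma regular_bimodule_simps [simp]:
  "carrier (regular_bimodule R) = carrier R" "\<zero>\<^bsub>regular_bimodule R\<^esub> = \<zero>\<^bsub>R\<^esub>"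
  "x \<oplus>\<^bsub>regular_bimodule R\<^esub> y = x \<oplus>\<^bsub>R\<^esub> y"
  "x \<odot>\<^bsub>regular_bimodule R\<^esub> y = x \<otimes>\<^bsub>R\<^esub> y" "x \<bullet>\<^bsub>regular_bimodule R\<^esub> y = x \<otimes>\<^bsub>R\<^esub> y"
  by (simp_all add: regular_bimodule_def)

lemma abelian_group_regular_bimodule:
  assumes "ring R" shows "abelian_group (regular_bimodule R)"
proof -
  interpret R: ring R by fact
  show ?thesis
    by (rule abelian_groupI) (auto simp: R.a_ac intro: R.l_neg R.a_inv_closed bexI[of _ "\<ominus>\<^bsub>R\<^esub> _"])
qed

lemma finsum_regular_bimodule:
  assumes "ring R" "\<And>i. i \<in> A \<Longrightarrow> f i \<in> carrier R"
  shows "finsum (regular_bimodule R) f A = finsum R f A"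
  using additive_finsum[OF ring.is_abelian_group[OF assms(1)] abelian_group_regular_bimodule[OF assms(1)],
      of "\<lambda>x. x" A f] assms
  by (simp add: additive_map_def)

lemma left_module_regular_bimodule:
  assumes "ring R" shows "left_module R (regular_bimodule R)"
proof -
  interpret R: ring R by fact
  show ?thesis
    using abelian_group_regular_bimodule[OF assms] assms
    by (auto simp: left_module_def left_module_axioms_def R.l_distr R.r_distr R.m_assoc)
qed

lemma right_module_regular_bimodule:
  assumes "ring R" shows "right_module R (regular_bimodule R)"
proof -
  interpret R: ring R by fact
  show ?thesis
    using abelian_group_regular_bimodule[OF assms] assms
    by (auto simp: right_module_def right_module_axioms_def R.l_distr R.r_distr R.m_assoc)
qed

definition unit_vector :: "('a, 'x) ring_scheme \<Rightarrow> nat \<Rightarrow> nat \<Rightarrow> nat \<Rightarrow> 'a"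
  where "unit_vector R n j = (\<lambda>k\<in>{..<n}. if k = j then \<one>\<^bsub>R\<^esub> else \<zero>\<^bsub>R\<^esub>)"

lemma carrier_finite_power:
  "carrier (finite_power P n) = {..<n} \<rightarrow>\<^sub>E carrier P"
  by (auto simp: direct_sum_power_def)

lemma unit_vector_closed:
  "ring R \<Longrightarrow> unit_vector R n j \<in> carrier (finite_power (regular_bimodule R) n)"
  by (auto simp: carrier_finite_power unit_vector_def ring.ring_simprules)

lemma left_hom_unit_vectors:
  assumes R: "ring R" and N: "left_module R N"
    and \<phi>: "\<phi> \<in> left_hom R (finite_power (regular_bimodule R) n) N"
    and x: "x \<in> carrier (finite_power (regular_bimodule R) n)"
  shows "\<phi> x = (\<Oplus>\<^bsub>N\<^esub>j\<in>{..<n}. x j \<odot>\<^bsub>N\<^esub> \<phi> (unit_vector R n j))"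
proof -
  interpret R: ring R by fact
  interpret N: left_module R N by fact
  have xR: "x j \<in> carrier R" if "j < n" for j using x that by (auto simp: carrier_finite_power)
  have "\<phi> x = (\<Oplus>\<^bsub>N\<^esub>j\<in>{..<n}. \<phi> (coord_vector {..<n} (regular_bimodule R) j (x j)))"
    using x by (intro additive_direct_sum_power[OF abelian_group_regular_bimodule[OF R] N.M.abelian_group_axioms
        left_hom_additive[OF \<phi>]]) auto
  also have "\<dots> = (\<Oplus>\<^bsub>N\<^esub>j\<in>{..<n}. x j \<odot>\<^bsub>N\<^esub> \<phi> (unit_vector R n j))"
  proof (intro N.M.finsum_cong' refl)
    fix j assume j: "j \<in> {..<n}"
    have "coord_vector {..<n} (regular_bimodule R) j (x j) =
        x j \<odot>\<^bsub>finite_power (regular_bimodule R) n\<^esub> unit_vector R n j"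
      using xR j by (auto simp: coord_vector_def unit_vector_def direct_sum_power_def fun_eq_iff)
    then show "\<phi> (coord_vector {..<n} (regular_bimodule R) j (x j)) = x j \<odot>\<^bsub>N\<^esub> \<phi> (unit_vector R n j)"
      using left_hom_smult[OF \<phi>] xR j unit_vector_closed[OF R] by simp
  qed (use xR N.smult_closed additive_closed[OF left_hom_additive[OF \<phi>]] unit_vector_closed[OF R] in auto)
  finally show ?thesis .
qed

lemma presents_of_finite_presentation:
  assumes R: "ring R" and N: "left_module R N" and p: "finite_presentation R N a b h \<pi>"
  shows "presents R N b (\<lambda>i. \<pi> (unit_vector R b i)) a (\<lambda>l i. matrix_entry R a h i l)"
proof -
  interpret R: ring R by fact
  interpret N: left_module R N by fact
  let ?A = "finite_power (regular_bimodule R) a" and ?B = "finite_power (regular_bimodule R) b"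
  have h: "h \<in> left_hom R ?A ?B" and \<pi>: "\<pi> \<in> left_hom R ?B N" and surj: "\<pi> ` carrier ?B = carrier N"
    and ex: "h ` carrier ?A = {x \<in> carrier ?B. \<pi> x = \<zero>\<^bsub>N\<^esub>}"
    using p by (auto simp: finite_presentation_def Let_def)
  have entry: "matrix_entry R a h i l = h (unit_vector R a l) i" for i l
    by (simp add: matrix_entry_def unit_vector_def)
  have eN: "\<pi> (unit_vector R b i) \<in> carrier N" for i
    using additive_closed[OF left_hom_additive[OF \<pi>] unit_vector_closed[OF R]] .
  have hB: "h (unit_vector R a l) \<in> carrier ?B" "\<pi> (h (unit_vector R a l)) = \<zero>\<^bsub>N\<^esub>" for l
    using ex unit_vector_closed[OF R, of a l] by auto
  have "spans R N b (\<lambda>i. \<pi> (unit_vector R b i))"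
    unfolding spans_def
  proof (intro conjI ballI allI impI)
    fix y assume "y \<in> carrier N"
    then obtain x where x: "x \<in> carrier ?B" "y = \<pi> x" using surj by auto
    then show "\<exists>s. (\<forall>j<b. s j \<in> carrier R) \<and> y = (\<Oplus>\<^bsub>N\<^esub>j\<in>{..<b}. s j \<odot>\<^bsub>N\<^esub> \<pi> (unit_vector R b j))"
      using left_hom_unit_vectors[OF R N \<pi> x(1)] by (intro exI[of _ x]) (auto simp: carrier_finite_power)
  qed (rule eN)
  moreover have "relation R N b (\<lambda>i. \<pi> (unit_vector R b i)) (\<lambda>i. matrix_entry R a h i l)" for l
    using hB[of l] left_hom_unit_vectors[OF R N \<pi> hB(1), of l]
    by (auto simp: relation_def entry carrier_finite_power)
  moreover have "\<exists>\<mu>. (\<forall>l<a. \<mu> l \<in> carrier R) \<and> (\<forall>i<b. s i = (\<Oplus>\<^bsub>R\<^esub>l\<in>{..<a}. \<mu> l \<otimes>\<^bsub>R\<^esub> matrix_entry R a h i l))"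
    if s: "relation R N b (\<lambda>i. \<pi> (unit_vector R b i)) s" for s
  proof -
    let ?v = "\<lambda>i\<in>{..<b}. s i"
    have v: "?v \<in> carrier ?B" using s by (auto simp: relation_def carrier_finite_power)
    have "\<pi> ?v = (\<Oplus>\<^bsub>N\<^esub>j\<in>{..<b}. ?v j \<odot>\<^bsub>N\<^esub> \<pi> (unit_vector R b j))"
      by (rule left_hom_unit_vectors[OF R N \<pi> v])
    also have "\<dots> = (\<Oplus>\<^bsub>N\<^esub>j\<in>{..<b}. s j \<odot>\<^bsub>N\<^esub> \<pi> (unit_vector R b j))"
      using s eN by (intro N.M.finsum_cong' refl) (auto simp: relation_def N.smult_closed)
    finally have "\<pi> ?v = \<zero>\<^bsub>N\<^esub>" using s by (simp add: relation_def)
    with v ex obtain u where u: "u \<in> carrier ?A" "?v = h u" by blast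
    have "s i = (\<Oplus>\<^bsub>R\<^esub>l\<in>{..<a}. u l \<otimes>\<^bsub>R\<^esub> matrix_entry R a h i l)" if i: "i < b" for i
    proof -
      have "(\<lambda>x\<in>carrier ?A. h x i) \<in> left_hom R ?A (regular_bimodule R)"
      proof -
        have hx: "h x \<in> carrier ?B" if "x \<in> carrier ?A" for x
          using additive_closed[OF left_hom_additive[OF h] that] .
        interpret A: abelian_group ?A
          by (rule abelian_group_direct_sum_power[OF abelian_group_regular_bimodule[OF R]])
        have 1: "h (x \<oplus>\<^bsub>?A\<^esub> y) i = h x i \<oplus>\<^bsub>R\<^esub> h y i" if "x \<in> carrier ?A" "y \<in> carrier ?A" for x y
          using additive_add[OF left_hom_additive[OF h] that] i by (simp add: direct_sum_power_def)
        have 2: "r \<odot>\<^bsub>?A\<^esub> x \<in> carrier ?A" if "r \<in> carrier R" "x \<in> carrier ?A" for r x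
          using that by (auto simp: direct_sum_power_def)
        have 3: "h (r \<odot>\<^bsub>?A\<^esub> x) i = r \<otimes>\<^bsub>R\<^esub> h x i" if "r \<in> carrier R" "x \<in> carrier ?A" for r x
          using left_hom_smult[OF h that] i by (simp add: direct_sum_power_def)
        show ?thesis
          using hx i 1 2 3 A.a_closed by (auto simp: left_hom_def carrier_finite_power)
      qed
      from left_hom_unit_vectors[OF R left_module_regular_bimodule[OF R] this u(1)]
      have "h u i = (\<Oplus>\<^bsub>regular_bimodule R\<^esub>l\<in>{..<a}. u l \<otimes>\<^bsub>R\<^esub> h (unit_vector R a l) i)"
        using u(1) unit_vector_closed[OF R] by simp
      also have "\<dots> = (\<Oplus>\<^bsub>R\<^esub>l\<in>{..<a}. u l \<otimes>\<^bsub>R\<^esub> h (unit_vector R a l) i)"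
      proof (rule finsum_regular_bimodule[OF R])
        fix l assume "l \<in> {..<a}"
        then show "u l \<otimes>\<^bsub>R\<^esub> h (unit_vector R a l) i \<in> carrier R"
          using u(1) hB(1)[of l] i by (intro R.m_closed) (auto simp: carrier_finite_power)
      qed
      finally have "h u i = \<dots>" .
      moreover have "h u i = s i" using i by (simp flip: u(2))
      ultimately show ?thesis by (simp add: entry)
    qed
    then show ?thesis using u(1) by (intro exI[of _ u]) (auto simp: carrier_finite_power)
  qed
  ultimately show ?thesis by (auto simp: presents_def)
qed

lemma finitely_presented_of_presents:
  assumes R: "ring R" and N: "left_module R N" and p: "presents R N b e a rel" and "0 < a" "0 < b"
  shows "finitely_presented R N"
proof -
  interpret R: ring R by fact
  interpret N: left_module R N by fact
  let ?A = "finite_power (regular_bimodule R) a" and ?B = "finite_power (regular_bimodule R) b"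
  let ?h = "\<lambda>x\<in>carrier ?A. \<lambda>i\<in>{..<b}. \<Oplus>\<^bsub>R\<^esub>l\<in>{..<a}. x l \<otimes>\<^bsub>R\<^esub> rel l i"
  let ?\<pi> = "\<lambda>x\<in>carrier ?B. \<Oplus>\<^bsub>N\<^esub>i\<in>{..<b}. x i \<odot>\<^bsub>N\<^esub> e i"
  have e: "e i \<in> carrier N" if "i < b" for i using p that by (auto simp: presents_def spans_def)
  have rel: "relation R N b e (rel l)" if "l < a" for l using p that by (auto simp: presents_def)
  then have rl: "rel l i \<in> carrier R" if "l < a" "i < b" for l i using that by (auto simp: relation_def)
  have smultA: "r \<odot>\<^bsub>?A\<^esub> x \<in> carrier ?A" if "r \<in> carrier R" "x \<in> carrier ?A" for r x
    using that by (auto simp: direct_sum_power_def)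
  have smultB: "r \<odot>\<^bsub>?B\<^esub> x \<in> carrier ?B" if "r \<in> carrier R" "x \<in> carrier ?B" for r x
    using that by (auto simp: direct_sum_power_def)
  interpret A: abelian_group ?A
    by (rule abelian_group_direct_sum_power[OF abelian_group_regular_bimodule[OF R]])
  interpret B: abelian_group ?B
    by (rule abelian_group_direct_sum_power[OF abelian_group_regular_bimodule[OF R]])
  have xA: "x l \<in> carrier R" if "x \<in> carrier ?A" "l < a" for x l using that by (auto simp: carrier_finite_power)
  have xB: "x l \<in> carrier R" if "x \<in> carrier ?B" "l < b" for x l using that by (auto simp: carrier_finite_power)
  have "?h \<in> left_hom R ?A ?B"
    unfolding left_hom_def
  proof (intro CollectI conjI ballI)
    show "?h \<in> carrier ?A \<rightarrow>\<^sub>E carrier ?B"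
      using xA rl by (auto simp: carrier_finite_power[of b "regular_bimodule R"] intro!: R.finsum_closed)
    fix x y assume xy: "x \<in> carrier ?A" "y \<in> carrier ?A"
    have "(\<Oplus>\<^bsub>R\<^esub>l\<in>{..<a}. (x \<oplus>\<^bsub>?A\<^esub> y) l \<otimes>\<^bsub>R\<^esub> rel l i) =
        (\<Oplus>\<^bsub>R\<^esub>l\<in>{..<a}. x l \<otimes>\<^bsub>R\<^esub> rel l i) \<oplus>\<^bsub>R\<^esub> (\<Oplus>\<^bsub>R\<^esub>l\<in>{..<a}. y l \<otimes>\<^bsub>R\<^esub> rel l i)" if i: "i < b" for i
    proof -
      have "(\<Oplus>\<^bsub>R\<^esub>l\<in>{..<a}. (x \<oplus>\<^bsub>?A\<^esub> y) l \<otimes>\<^bsub>R\<^esub> rel l i) =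
          (\<Oplus>\<^bsub>R\<^esub>l\<in>{..<a}. x l \<otimes>\<^bsub>R\<^esub> rel l i \<oplus>\<^bsub>R\<^esub> y l \<otimes>\<^bsub>R\<^esub> rel l i)"
        using xA[OF xy(1)] xA[OF xy(2)] rl i
        by (intro R.finsum_cong' refl) (auto simp: direct_sum_power_def R.l_distr)
      also have "\<dots> = (\<Oplus>\<^bsub>R\<^esub>l\<in>{..<a}. x l \<otimes>\<^bsub>R\<^esub> rel l i) \<oplus>\<^bsub>R\<^esub> (\<Oplus>\<^bsub>R\<^esub>l\<in>{..<a}. y l \<otimes>\<^bsub>R\<^esub> rel l i)"
        using xA[OF xy(1)] xA[OF xy(2)] rl i by (intro R.finsum_addf) auto
      finally show ?thesis .
    qed
    then show "?h (x \<oplus>\<^bsub>?A\<^esub> y) = ?h x \<oplus>\<^bsub>?B\<^esub> ?h y"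
      using xy A.a_closed by (auto simp: direct_sum_power_def[of _ "regular_bimodule R"] fun_eq_iff)
  next
    fix r x assume rx: "r \<in> carrier R" "x \<in> carrier ?A"
    have "(\<Oplus>\<^bsub>R\<^esub>l\<in>{..<a}. (r \<odot>\<^bsub>?A\<^esub> x) l \<otimes>\<^bsub>R\<^esub> rel l i) =
        r \<otimes>\<^bsub>R\<^esub> (\<Oplus>\<^bsub>R\<^esub>l\<in>{..<a}. x l \<otimes>\<^bsub>R\<^esub> rel l i)" if i: "i < b" for i
    proof -
      have "(\<Oplus>\<^bsub>R\<^esub>l\<in>{..<a}. (r \<odot>\<^bsub>?A\<^esub> x) l \<otimes>\<^bsub>R\<^esub> rel l i) =
          (\<Oplus>\<^bsub>R\<^esub>l\<in>{..<a}. r \<otimes>\<^bsub>R\<^esub> (x l \<otimes>\<^bsub>R\<^esub> rel l i))"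
        using xA[OF rx(2)] rx rl i
        by (intro R.finsum_cong' refl) (auto simp: direct_sum_power_def R.m_assoc)
      also have "\<dots> = r \<otimes>\<^bsub>R\<^esub> (\<Oplus>\<^bsub>R\<^esub>l\<in>{..<a}. x l \<otimes>\<^bsub>R\<^esub> rel l i)"
        using xA[OF rx(2)] rx rl i by (intro R.finsum_rdistr[symmetric]) auto
      finally show ?thesis .
    qed
    then show "?h (r \<odot>\<^bsub>?A\<^esub> x) = r \<odot>\<^bsub>?B\<^esub> ?h x"
      using rx smultA by (auto simp: direct_sum_power_def[of _ "regular_bimodule R"] fun_eq_iff)
  qed
  moreover have "?\<pi> \<in> left_hom R ?B N"
    unfolding left_hom_def
  proof (intro CollectI conjI ballI)
    show "?\<pi> \<in> carrier ?B \<rightarrow>\<^sub>E carrier N"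
      using xB e by (auto intro!: N.M.finsum_closed N.smult_closed)
    fix x y assume xy: "x \<in> carrier ?B" "y \<in> carrier ?B"
    have "(\<Oplus>\<^bsub>N\<^esub>i\<in>{..<b}. (x \<oplus>\<^bsub>?B\<^esub> y) i \<odot>\<^bsub>N\<^esub> e i) =
        (\<Oplus>\<^bsub>N\<^esub>i\<in>{..<b}. x i \<odot>\<^bsub>N\<^esub> e i \<oplus>\<^bsub>N\<^esub> y i \<odot>\<^bsub>N\<^esub> e i)"
      using xB[OF xy(1)] xB[OF xy(2)] e
      by (intro N.M.finsum_cong' refl) (auto simp: direct_sum_power_def N.smult_l_distr N.smult_closed)
    also have "\<dots> = (\<Oplus>\<^bsub>N\<^esub>i\<in>{..<b}. x i \<odot>\<^bsub>N\<^esub> e i) \<oplus>\<^bsub>N\<^esub> (\<Oplus>\<^bsub>N\<^esub>i\<in>{..<b}. y i \<odot>\<^bsub>N\<^esub> e i)"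
      using xB[OF xy(1)] xB[OF xy(2)] e by (intro N.M.finsum_addf) (auto simp: N.smult_closed)
    finally show "?\<pi> (x \<oplus>\<^bsub>?B\<^esub> y) = ?\<pi> x \<oplus>\<^bsub>N\<^esub> ?\<pi> y" using xy B.a_closed by simp
  next
    fix r x assume rx: "r \<in> carrier R" "x \<in> carrier ?B"
    have "(\<Oplus>\<^bsub>N\<^esub>i\<in>{..<b}. (r \<odot>\<^bsub>?B\<^esub> x) i \<odot>\<^bsub>N\<^esub> e i) = (\<Oplus>\<^bsub>N\<^esub>i\<in>{..<b}. r \<odot>\<^bsub>N\<^esub> (x i \<odot>\<^bsub>N\<^esub> e i))"
      using xB[OF rx(2)] rx e
      by (intro N.M.finsum_cong' refl) (auto simp: direct_sum_power_def N.smult_assoc N.smult_closed)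
    also have "\<dots> = r \<odot>\<^bsub>N\<^esub> (\<Oplus>\<^bsub>N\<^esub>i\<in>{..<b}. x i \<odot>\<^bsub>N\<^esub> e i)"
      using xB[OF rx(2)] rx e by (intro N.smult_finsum_right[symmetric]) (auto intro: N.smult_closed)
    finally show "?\<pi> (r \<odot>\<^bsub>?B\<^esub> x) = r \<odot>\<^bsub>N\<^esub> ?\<pi> x" using rx smultB by simp
  qed
  moreover have "?\<pi> ` carrier ?B = carrier N"
  proof
    show "?\<pi> ` carrier ?B \<subseteq> carrier N"
      using xB e by (auto intro!: N.M.finsum_closed N.smult_closed)
    show "carrier N \<subseteq> ?\<pi> ` carrier ?B"
    proof
      fix y assume "y \<in> carrier N"
      then obtain s where s: "\<forall>j<b. s j \<in> carrier R" "y = (\<Oplus>\<^bsub>N\<^esub>j\<in>{..<b}. s j \<odot>\<^bsub>N\<^esub> e j)"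
        using p unfolding presents_def spans_def by blast
      have "y = (\<Oplus>\<^bsub>N\<^esub>j\<in>{..<b}. (\<lambda>i\<in>{..<b}. s i) j \<odot>\<^bsub>N\<^esub> e j)"
        unfolding s(2) using s(1) e by (intro N.M.finsum_cong' refl) (auto simp: N.smult_closed)
      moreover have "(\<lambda>i\<in>{..<b}. s i) \<in> carrier ?B" using s by (auto simp: carrier_finite_power)
      ultimately show "y \<in> ?\<pi> ` carrier ?B" by (intro image_eqI[of _ _ "\<lambda>i\<in>{..<b}. s i"]) simp_all
    qed
  qed
  moreover have "?h ` carrier ?A = {x \<in> carrier ?B. ?\<pi> x = \<zero>\<^bsub>N\<^esub>}"
  proof
    show "{x \<in> carrier ?B. ?\<pi> x = \<zero>\<^bsub>N\<^esub>} \<subseteq> ?h ` carrier ?A"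
    proof
      fix x assume x: "x \<in> {x \<in> carrier ?B. ?\<pi> x = \<zero>\<^bsub>N\<^esub>}"
      then have "relation R N b e x" using xB by (auto simp: relation_def)
      then obtain \<mu> where \<mu>: "\<forall>l<a. \<mu> l \<in> carrier R" "\<forall>i<b. x i = (\<Oplus>\<^bsub>R\<^esub>l\<in>{..<a}. \<mu> l \<otimes>\<^bsub>R\<^esub> rel l i)"
        using p unfolding presents_def by blast
      let ?u = "\<lambda>l\<in>{..<a}. \<mu> l"
      have u: "?u \<in> carrier ?A" using \<mu> by (auto simp: carrier_finite_power)
      have "x i = (\<Oplus>\<^bsub>R\<^esub>l\<in>{..<a}. ?u l \<otimes>\<^bsub>R\<^esub> rel l i)" if "i < b" for i
        using \<mu> that rl by (auto intro!: R.finsum_cong')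
      then have "x = ?h ?u" using u x by (auto simp: fun_eq_iff carrier_finite_power PiE_def extensional_def)
      then show "x \<in> ?h ` carrier ?A" using u by blast
    qed
    show "?h ` carrier ?A \<subseteq> {x \<in> carrier ?B. ?\<pi> x = \<zero>\<^bsub>N\<^esub>}"
    proof
      fix x assume "x \<in> ?h ` carrier ?A"
      then obtain u where u: "u \<in> carrier ?A" "x = ?h u" by blast
      have x: "x i = (\<Oplus>\<^bsub>R\<^esub>l\<in>{..<a}. u l \<otimes>\<^bsub>R\<^esub> rel l i)" if "i < b" for i using u that by simp
      have xc: "x \<in> carrier ?B"
        using u xA rl by (auto simp: carrier_finite_power[of b "regular_bimodule R"] intro!: R.finsum_closed)
      have "(\<Oplus>\<^bsub>N\<^esub>i\<in>{..<b}. x i \<odot>\<^bsub>N\<^esub> e i) = (\<Oplus>\<^bsub>N\<^esub>i\<in>{..<b}. \<Oplus>\<^bsub>N\<^esub>l\<in>{..<a}. u l \<odot>\<^bsub>N\<^esub> (rel l i \<odot>\<^bsub>N\<^esub> e i))"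
      proof (intro N.M.finsum_cong' refl)
        fix i assume i: "i \<in> {..<b}"
        have "x i \<odot>\<^bsub>N\<^esub> e i = (\<Oplus>\<^bsub>N\<^esub>l\<in>{..<a}. (u l \<otimes>\<^bsub>R\<^esub> rel l i) \<odot>\<^bsub>N\<^esub> e i)"
          unfolding x[OF i[simplified]] using i xA[OF u(1)] rl e by (intro N.smult_finsum_left) auto
        also have "\<dots> = (\<Oplus>\<^bsub>N\<^esub>l\<in>{..<a}. u l \<odot>\<^bsub>N\<^esub> (rel l i \<odot>\<^bsub>N\<^esub> e i))"
          using i xA[OF u(1)] rl e by (intro N.M.finsum_cong' refl) (auto simp: N.smult_assoc N.smult_closed)
        finally show "x i \<odot>\<^bsub>N\<^esub> e i = (\<Oplus>\<^bsub>N\<^esub>l\<in>{..<a}. u l \<odot>\<^bsub>N\<^esub> (rel l i \<odot>\<^bsub>N\<^esub> e i))" .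
      qed (use xA[OF u(1)] rl e N.smult_closed in \<open>auto intro!: N.M.finsum_closed\<close>)
      also have "\<dots> = (\<Oplus>\<^bsub>N\<^esub>l\<in>{..<a}. \<Oplus>\<^bsub>N\<^esub>i\<in>{..<b}. u l \<odot>\<^bsub>N\<^esub> (rel l i \<odot>\<^bsub>N\<^esub> e i))"
        using xA[OF u(1)] rl e N.smult_closed by (intro N.M.finsum_swap) auto
      also have "\<dots> = (\<Oplus>\<^bsub>N\<^esub>l\<in>{..<a}. \<zero>\<^bsub>N\<^esub>)"
      proof (intro N.M.finsum_cong' refl)
        fix l assume l: "l \<in> {..<a}"
        have "(\<Oplus>\<^bsub>N\<^esub>i\<in>{..<b}. u l \<odot>\<^bsub>N\<^esub> (rel l i \<odot>\<^bsub>N\<^esub> e i)) = u l \<odot>\<^bsub>N\<^esub> (\<Oplus>\<^bsub>N\<^esub>i\<in>{..<b}. rel l i \<odot>\<^bsub>N\<^esub> e i)"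
          using l xA[OF u(1)] rl e by (intro N.smult_finsum_right[symmetric]) (auto simp: N.smult_closed)
        then show "(\<Oplus>\<^bsub>N\<^esub>i\<in>{..<b}. u l \<odot>\<^bsub>N\<^esub> (rel l i \<odot>\<^bsub>N\<^esub> e i)) = \<zero>\<^bsub>N\<^esub>"
          using l rel[of l] xA[OF u(1)] by (simp add: relation_def N.smult_zero_right)
      qed auto
      finally show "x \<in> {x \<in> carrier ?B. ?\<pi> x = \<zero>\<^bsub>N\<^esub>}" using xc by simp
    qed
  qed
  ultimately have "finite_presentation R N a b ?h ?\<pi>"
    unfolding finite_presentation_def Let_def using \<open>0 < a\<close> \<open>0 < b\<close> by blast
  then show ?thesis using N by (auto simp: finitely_presented_def)
qed

text \<open>
The generators and relations of a tensor product are naturally indexed by pairs and by disjoint sums of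
sets of pairs, whereas presentations are indexed by initial segments of the natural numbers.
\<close>

lemma finitely_presented_of_indexed:
  assumes R: "ring R" and N: "left_module R N" and I: "finite I" "I \<noteq> {}" and J: "finite J" "J \<noteq> {}"
    and e: "\<And>i. i \<in> I \<Longrightarrow> e i \<in> carrier N"
    and gen: "\<And>x. x \<in> carrier N \<Longrightarrow> \<exists>s. (\<forall>i\<in>I. s i \<in> carrier R) \<and> x = (\<Oplus>\<^bsub>N\<^esub>i\<in>I. s i \<odot>\<^bsub>N\<^esub> e i)"
    and rel: "\<And>l i. l \<in> J \<Longrightarrow> i \<in> I \<Longrightarrow> rel l i \<in> carrier R"
      "\<And>l. l \<in> J \<Longrightarrow> (\<Oplus>\<^bsub>N\<^esub>i\<in>I. rel l i \<odot>\<^bsub>N\<^esub> e i) = \<zero>\<^bsub>N\<^esub>"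
    and relgen: "\<And>s. (\<And>i. i \<in> I \<Longrightarrow> s i \<in> carrier R) \<Longrightarrow> (\<Oplus>\<^bsub>N\<^esub>i\<in>I. s i \<odot>\<^bsub>N\<^esub> e i) = \<zero>\<^bsub>N\<^esub> \<Longrightarrow>
      \<exists>\<mu>. (\<forall>l\<in>J. \<mu> l \<in> carrier R) \<and> (\<forall>i\<in>I. s i = (\<Oplus>\<^bsub>R\<^esub>l\<in>J. \<mu> l \<otimes>\<^bsub>R\<^esub> rel l i))"
  shows "finitely_presented R N"
proof -
  interpret R: ring R by fact
  interpret N: left_module R N by fact
  obtain \<alpha> where \<alpha>: "bij_betw \<alpha> {..<card I} I"
    using ex_bij_betw_nat_finite[OF I(1)] by (auto simp: lessThan_atLeast0)
  obtain \<gamma> where \<gamma>: "bij_betw \<gamma> {..<card J} J"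
    using ex_bij_betw_nat_finite[OF J(1)] by (auto simp: lessThan_atLeast0)
  have sumI: "(\<Oplus>\<^bsub>N\<^esub>i\<in>I. s i \<odot>\<^bsub>N\<^esub> e i) = (\<Oplus>\<^bsub>N\<^esub>k\<in>{..<card I}. s (\<alpha> k) \<odot>\<^bsub>N\<^esub> e (\<alpha> k))"
    if "\<And>i. i \<in> I \<Longrightarrow> s i \<in> carrier R" for s
    using N.M.finsum_reindex[of "\<lambda>i. s i \<odot>\<^bsub>N\<^esub> e i" \<alpha> "{..<card I}"] that e \<alpha>
    by (auto simp: bij_betw_def N.smult_closed)
  have sumJ: "(\<Oplus>\<^bsub>R\<^esub>l\<in>J. \<mu> l \<otimes>\<^bsub>R\<^esub> rel l i) = (\<Oplus>\<^bsub>R\<^esub>k\<in>{..<card J}. \<mu> (\<gamma> k) \<otimes>\<^bsub>R\<^esub> rel (\<gamma> k) i)"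
    if "\<And>l. l \<in> J \<Longrightarrow> \<mu> l \<in> carrier R" "i \<in> I" for \<mu> i
    using R.finsum_reindex[of "\<lambda>l. \<mu> l \<otimes>\<^bsub>R\<^esub> rel l i" \<gamma> "{..<card J}"] that rel(1) \<gamma>
    by (auto simp: bij_betw_def)
  have \<alpha>I: "\<alpha> k \<in> I" if "k < card I" for k using \<alpha> that by (auto simp: bij_betw_def)
  have \<gamma>J: "\<gamma> k \<in> J" if "k < card J" for k using \<gamma> that by (auto simp: bij_betw_def)
  have "spans R N (card I) (\<lambda>k. e (\<alpha> k))"
    unfolding spans_def
  proof (intro conjI ballI allI impI)
    fix x assume "x \<in> carrier N"
    then obtain s where s: "\<forall>i\<in>I. s i \<in> carrier R" "x = (\<Oplus>\<^bsub>N\<^esub>i\<in>I. s i \<odot>\<^bsub>N\<^esub> e i)" using gen by blast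
    then show "\<exists>s. (\<forall>j<card I. s j \<in> carrier R) \<and> x = (\<Oplus>\<^bsub>N\<^esub>j\<in>{..<card I}. s j \<odot>\<^bsub>N\<^esub> e (\<alpha> j))"
      using sumI[of s] \<alpha>I by (intro exI[of _ "\<lambda>k. s (\<alpha> k)"]) auto
  qed (use e \<alpha>I in auto)
  moreover have "relation R N (card I) (\<lambda>k. e (\<alpha> k)) (\<lambda>k. rel (\<gamma> l) (\<alpha> k))" if "l < card J" for l
    using sumI[of "rel (\<gamma> l)"] rel \<gamma>J[OF that] \<alpha>I by (auto simp: relation_def)
  moreover have "\<exists>\<mu>. (\<forall>l<card J. \<mu> l \<in> carrier R) \<and>
      (\<forall>k<card I. s k = (\<Oplus>\<^bsub>R\<^esub>l\<in>{..<card J}. \<mu> l \<otimes>\<^bsub>R\<^esub> rel (\<gamma> l) (\<alpha> k)))"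
    if s: "relation R N (card I) (\<lambda>k. e (\<alpha> k)) s" for s
  proof -
    let ?\<beta> = "inv_into {..<card I} \<alpha>"
    have \<beta>: "?\<beta> i < card I" "\<alpha> (?\<beta> i) = i" if "i \<in> I" for i
      using that \<alpha> bij_betw_inv_into[OF \<alpha>] by (auto simp: bij_betw_def f_inv_into_f)
    have \<beta>\<alpha>: "?\<beta> (\<alpha> k) = k" if "k < card I" for k
      using that \<alpha> by (auto simp: bij_betw_def inv_into_f_f)
    have sR: "s (?\<beta> i) \<in> carrier R" if "i \<in> I" for i using s \<beta>[OF that] by (auto simp: relation_def)
    have "(\<Oplus>\<^bsub>N\<^esub>i\<in>I. s (?\<beta> i) \<odot>\<^bsub>N\<^esub> e i) = (\<Oplus>\<^bsub>N\<^esub>k\<in>{..<card I}. s (?\<beta> (\<alpha> k)) \<odot>\<^bsub>N\<^esub> e (\<alpha> k))"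
      using sumI[of "\<lambda>i. s (?\<beta> i)"] sR by simp
    also have "\<dots> = (\<Oplus>\<^bsub>N\<^esub>k\<in>{..<card I}. s k \<odot>\<^bsub>N\<^esub> e (\<alpha> k))"
      using s \<beta>\<alpha> e \<alpha>I by (intro N.M.finsum_cong' refl) (auto simp: relation_def N.smult_closed)
    also have "\<dots> = \<zero>\<^bsub>N\<^esub>" using s by (simp add: relation_def)
    finally obtain \<mu> where \<mu>: "\<forall>l\<in>J. \<mu> l \<in> carrier R"
      "\<forall>i\<in>I. s (?\<beta> i) = (\<Oplus>\<^bsub>R\<^esub>l\<in>J. \<mu> l \<otimes>\<^bsub>R\<^esub> rel l i)"
      using relgen[of "\<lambda>i. s (?\<beta> i)"] sR by blast
    have "s k = (\<Oplus>\<^bsub>R\<^esub>l\<in>{..<card J}. \<mu> (\<gamma> l) \<otimes>\<^bsub>R\<^esub> rel (\<gamma> l) (\<alpha> k))" if "k < card I" for k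
      using \<mu> sumJ[of \<mu> "\<alpha> k"] \<alpha>I[OF that] \<beta>\<alpha>[OF that] by metis
    then show ?thesis using \<mu> \<gamma>J by (intro exI[of _ "\<lambda>k. \<mu> (\<gamma> k)"]) auto
  qed
  ultimately have "presents R N (card I) (\<lambda>k. e (\<alpha> k)) (card J) (\<lambda>l k. rel (\<gamma> l) (\<alpha> k))"
    by (auto simp: presents_def)
  then show ?thesis
    using I J by (intro finitely_presented_of_presents[OF R N]) (auto simp: card_gt_0_iff)
qed

lemma (in cring) fitting_ideal_eq_family_fitting:
  assumes N: "left_module R N" and fp: "finitely_presented R N" and e: "spans R N b e"
  shows "fitting_ideal R N = family_fitting R N b e"
proof -
  have eq: "presentation_fitting_ideal R a' b' h = family_fitting R N b e"
    if p: "finite_presentation R N a' b' h \<pi>" for a' b' h \<pi>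
  proof -
    note q = presents_of_finite_presentation[OF ring_axioms N p]
    have "presentation_fitting_ideal R a' b' h = family_fitting R N b' (\<lambda>i. \<pi> (unit_vector R b' i))"
      unfolding family_fitting_presents[OF q] presentation_fitting_ideal_def maximal_minors_def ..
    also have "\<dots> = family_fitting R N b e"
      using q by (intro family_fitting_unique[OF N _ e]) (simp add: presents_def)
    finally show ?thesis .
  qed
  obtain a' b' h \<pi> where p: "finite_presentation R N a' b' h \<pi>"
    using fp by (auto simp: finitely_presented_def)
  show ?thesis
    unfolding fitting_ideal_def
  proof (rule the_equality)
    show "\<exists>a b' h \<pi>. finite_presentation R N a b' h \<pi> \<and> family_fitting R N b e = presentation_fitting_ideal R a b' h"
      using p eq by metis
  qed (use eq in auto)
qed

section \<open>Dual bases and trace elements of progenerators\<close>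

context right_module
begin

lemma additive_rsmult_left: "r \<in> carrier R \<Longrightarrow> additive_map P P (\<lambda>p. p \<bullet>\<^bsub>P\<^esub> r)"
  by (auto simp: additive_map_def rsmult_closed rsmult_l_distr)

lemma rsmult_zero_left: "r \<in> carrier R \<Longrightarrow> \<zero>\<^bsub>P\<^esub> \<bullet>\<^bsub>P\<^esub> r = \<zero>\<^bsub>P\<^esub>"
  using additive_zero[OF P.abelian_group_axioms P.abelian_group_axioms additive_rsmult_left] .

lemma additive_rsmult_right: "p \<in> carrier P \<Longrightarrow> additive_map R P (\<lambda>r. p \<bullet>\<^bsub>P\<^esub> r)"
  by (auto simp: additive_map_def rsmult_closed rsmult_r_distr)

lemma rsmult_finsum_right:
  "p \<in> carrier P \<Longrightarrow> (\<And>i. i \<in> I \<Longrightarrow> u i \<in> carrier R) \<Longrightarrow>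
    p \<bullet>\<^bsub>P\<^esub> (\<Oplus>i\<in>I. u i) = (\<Oplus>\<^bsub>P\<^esub>i\<in>I. p \<bullet>\<^bsub>P\<^esub> u i)"
  using additive_finsum[OF R.abelian_group_axioms P.abelian_group_axioms additive_rsmult_right] .

end

lemma right_module_direct_sum_power:
  assumes "right_module R P"
  shows "right_module R (direct_sum_power I P)"
proof -
  interpret P: right_module R P by fact
  interpret D: abelian_group "direct_sum_power I P"
    by (rule abelian_group_direct_sum_power) (rule P.P.abelian_group_axioms)
  have cl: "(\<lambda>i\<in>I. f i \<bullet>\<^bsub>P\<^esub> r) \<in> carrier (direct_sum_power I P)"
    if f: "f \<in> carrier (direct_sum_power I P)" and r: "r \<in> carrier R" for f r
  proof -
    have "finite {i \<in> I. f i \<bullet>\<^bsub>P\<^esub> r \<noteq> \<zero>\<^bsub>P\<^esub>}"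
      by (rule finite_subset[of _ "{i \<in> I. f i \<noteq> \<zero>\<^bsub>P\<^esub>}"])
         (use f r P.rsmult_zero_left in \<open>auto simp: direct_sum_power_def\<close>)
    then show ?thesis using f r
      by (auto simp: direct_sum_power_def PiE_def Pi_def P.rsmult_closed cong: conj_cong)
  qed
  show ?thesis
  proof (intro right_module.intro right_module_axioms.intro)
    show "ring R" by (rule P.R.ring_axioms)
    show "abelian_group (direct_sum_power I P)" by (rule D.abelian_group_axioms)
    fix p r assume "p \<in> carrier (direct_sum_power I P)" "r \<in> carrier R"
    from cl[OF this] show "p \<bullet>\<^bsub>direct_sum_power I P\<^esub> r \<in> carrier (direct_sum_power I P)"
      by (simp add: direct_sum_power_def)
  qed (auto simp: direct_sum_power_def fun_eq_iff PiE_def Pi_def extensional_def P.rsmult_l_distr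
      P.rsmult_r_distr P.rsmult_assoc P.rsmult_one)
qed

lemma right_direct_summand_retraction:
  assumes P: "right_module R P" and Q: "right_module R Q" and PQ: "is_right_direct_summand R P Q"
  obtains i r where "i \<in> right_hom R P Q" "r \<in> right_hom R Q P" "\<And>p. p \<in> carrier P \<Longrightarrow> r (i p) = p"
proof -
  interpret P: right_module R P by fact
  interpret Q: right_module R Q by fact
  obtain U V f where U: "right_submodule R Q U" and V: "right_submodule R Q V"
    and UV: "U \<inter> V = {\<zero>\<^bsub>Q\<^esub>}" and sum: "U <+>\<^bsub>Q\<^esub> V = carrier Q"
    and f: "f \<in> right_hom R P (Q\<lparr>carrier := U\<rparr>)" and bij: "bij_betw f (carrier P) U"
    using PQ by (auto simp: is_right_direct_summand_def)
  have sU: "subgroup U (add_monoid Q)" and sV: "subgroup V (add_monoid Q)"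
    using U V by (auto simp: right_submodule_def)
  have UQ: "U \<subseteq> carrier Q" "V \<subseteq> carrier Q"
    using subgroup.subset[OF sU] subgroup.subset[OF sV] by auto
  have Uadd: "x \<oplus>\<^bsub>Q\<^esub> y \<in> U" if "x \<in> U" "y \<in> U" for x y using subgroup.m_closed[OF sU that] by simp
  have Vadd: "x \<oplus>\<^bsub>Q\<^esub> y \<in> V" if "x \<in> V" "y \<in> V" for x y using subgroup.m_closed[OF sV that] by simp
  have Uneg: "\<ominus>\<^bsub>Q\<^esub> x \<in> U" if "x \<in> U" for x using subgroup.m_inv_closed[OF sU that] by (simp add: a_inv_def)
  have Vneg: "\<ominus>\<^bsub>Q\<^esub> x \<in> V" if "x \<in> V" for x using subgroup.m_inv_closed[OF sV that] by (simp add: a_inv_def)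
  have Usm: "x \<bullet>\<^bsub>Q\<^esub> r \<in> U" if "x \<in> U" "r \<in> carrier R" for x r using U that by (auto simp: right_submodule_def)
  have Vsm: "x \<bullet>\<^bsub>Q\<^esub> r \<in> V" if "x \<in> V" "r \<in> carrier R" for x r using V that by (auto simp: right_submodule_def)
  have unique: "u = u'" if "u \<in> U" "u' \<in> U" "v \<in> V" "v' \<in> V" "u \<oplus>\<^bsub>Q\<^esub> v = u' \<oplus>\<^bsub>Q\<^esub> v'" for u u' v v'
  proof -
    have c: "u \<in> carrier Q" "u' \<in> carrier Q" "v \<in> carrier Q" "v' \<in> carrier Q" using that UQ by auto
    have "u \<oplus>\<^bsub>Q\<^esub> \<ominus>\<^bsub>Q\<^esub> u' = (u \<oplus>\<^bsub>Q\<^esub> v) \<oplus>\<^bsub>Q\<^esub> (\<ominus>\<^bsub>Q\<^esub> v \<oplus>\<^bsub>Q\<^esub> \<ominus>\<^bsub>Q\<^esub> u')"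
      using c by (simp add: Q.P.a_assoc Q.P.r_neg1 Q.P.r_neg2)
    also have "\<dots> = (u' \<oplus>\<^bsub>Q\<^esub> v') \<oplus>\<^bsub>Q\<^esub> (\<ominus>\<^bsub>Q\<^esub> v \<oplus>\<^bsub>Q\<^esub> \<ominus>\<^bsub>Q\<^esub> u')" using that by simp
    also have "\<dots> = (v' \<oplus>\<^bsub>Q\<^esub> u') \<oplus>\<^bsub>Q\<^esub> (\<ominus>\<^bsub>Q\<^esub> u' \<oplus>\<^bsub>Q\<^esub> \<ominus>\<^bsub>Q\<^esub> v)"
      using c by (simp add: Q.P.a_comm)
    also have "\<dots> = v' \<oplus>\<^bsub>Q\<^esub> \<ominus>\<^bsub>Q\<^esub> v"
      using c by (simp add: Q.P.a_assoc Q.P.r_neg2)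
    finally have "u \<oplus>\<^bsub>Q\<^esub> \<ominus>\<^bsub>Q\<^esub> u' \<in> U \<inter> V" using that Uadd Uneg Vadd Vneg by (metis IntI)
    then have "u \<oplus>\<^bsub>Q\<^esub> \<ominus>\<^bsub>Q\<^esub> u' = \<zero>\<^bsub>Q\<^esub>" using UV by simp
    then show ?thesis using c
      by (metis Q.P.a_inv_closed Q.P.add.m_comm Q.P.minus_equality Q.P.minus_minus)
  qed
  have "\<forall>x\<in>carrier Q. \<exists>u\<in>U. \<exists>v\<in>V. x = u \<oplus>\<^bsub>Q\<^esub> v" using sum unfolding set_add_def' by blast
  then obtain u v where u: "\<And>x. x \<in> carrier Q \<Longrightarrow> u x \<in> U" and v: "\<And>x. x \<in> carrier Q \<Longrightarrow> v x \<in> V"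
    and uv: "\<And>x. x \<in> carrier Q \<Longrightarrow> x = u x \<oplus>\<^bsub>Q\<^esub> v x" by metis
  have u_add: "u (x \<oplus>\<^bsub>Q\<^esub> y) = u x \<oplus>\<^bsub>Q\<^esub> u y" if xy: "x \<in> carrier Q" "y \<in> carrier Q" for x y
  proof (rule unique)
    have c: "u x \<in> carrier Q" "u y \<in> carrier Q" "v x \<in> carrier Q" "v y \<in> carrier Q" using xy u v UQ by auto
    have "u (x \<oplus>\<^bsub>Q\<^esub> y) \<oplus>\<^bsub>Q\<^esub> v (x \<oplus>\<^bsub>Q\<^esub> y) = (u x \<oplus>\<^bsub>Q\<^esub> v x) \<oplus>\<^bsub>Q\<^esub> (u y \<oplus>\<^bsub>Q\<^esub> v y)"
      using uv[of "x \<oplus>\<^bsub>Q\<^esub> y"] uv[of x] uv[of y] xy by simp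
    also have "\<dots> = (u x \<oplus>\<^bsub>Q\<^esub> u y) \<oplus>\<^bsub>Q\<^esub> (v x \<oplus>\<^bsub>Q\<^esub> v y)" using c by (simp add: Q.P.a_ac)
    finally show "u (x \<oplus>\<^bsub>Q\<^esub> y) \<oplus>\<^bsub>Q\<^esub> v (x \<oplus>\<^bsub>Q\<^esub> y) = \<dots>" .
  qed (use xy u v Uadd Vadd in auto)
  have u_sm: "u (x \<bullet>\<^bsub>Q\<^esub> r) = u x \<bullet>\<^bsub>Q\<^esub> r" if xr: "x \<in> carrier Q" "r \<in> carrier R" for x r
  proof (rule unique)
    have c: "u x \<in> carrier Q" "v x \<in> carrier Q" using xr u v UQ by auto
    show "u (x \<bullet>\<^bsub>Q\<^esub> r) \<oplus>\<^bsub>Q\<^esub> v (x \<bullet>\<^bsub>Q\<^esub> r) = u x \<bullet>\<^bsub>Q\<^esub> r \<oplus>\<^bsub>Q\<^esub> v x \<bullet>\<^bsub>Q\<^esub> r"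
      using uv[of "x \<bullet>\<^bsub>Q\<^esub> r"] uv[of x] xr c Q.rsmult_closed by (metis Q.rsmult_l_distr)
  qed (use xr u v Usm Vsm Q.rsmult_closed in auto)
  have u_id: "u x = x" if "x \<in> U" for x
  proof (rule unique)
    have x: "x \<in> carrier Q" using that UQ by auto
    show "u x \<oplus>\<^bsub>Q\<^esub> v x = x \<oplus>\<^bsub>Q\<^esub> \<zero>\<^bsub>Q\<^esub>" using uv[OF x] x by simp
    show "\<zero>\<^bsub>Q\<^esub> \<in> V" using UV by auto
  qed (use that u v UQ in auto)
  have fU: "f p \<in> U" if "p \<in> carrier P" for p using bij that by (auto simp: bij_betw_def)
  have f_add: "f (p \<oplus>\<^bsub>P\<^esub> q) = f p \<oplus>\<^bsub>Q\<^esub> f q" if "p \<in> carrier P" "q \<in> carrier P" for p q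
    using f that by (auto simp: right_hom_def)
  have f_sm: "f (p \<bullet>\<^bsub>P\<^esub> r) = f p \<bullet>\<^bsub>Q\<^esub> r" if "p \<in> carrier P" "r \<in> carrier R" for p r
    using f that by (auto simp: right_hom_def)
  let ?g = "inv_into (carrier P) f"
  have gf: "?g (f p) = p" if "p \<in> carrier P" for p using bij that by (auto simp: bij_betw_def)
  have fg: "?g y \<in> carrier P" "f (?g y) = y" if "y \<in> U" for y
    using bij that by (auto simp: bij_betw_def inv_into_into f_inv_into_f)
  have g_add: "?g (x \<oplus>\<^bsub>Q\<^esub> y) = ?g x \<oplus>\<^bsub>P\<^esub> ?g y" if "x \<in> U" "y \<in> U" for x y
    using gf[of "?g x \<oplus>\<^bsub>P\<^esub> ?g y"] f_add[of "?g x" "?g y"] fg[OF that(1)] fg[OF that(2)] by simp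
  have g_sm: "?g (x \<bullet>\<^bsub>Q\<^esub> r) = ?g x \<bullet>\<^bsub>P\<^esub> r" if "x \<in> U" "r \<in> carrier R" for x r
    using gf[of "?g x \<bullet>\<^bsub>P\<^esub> r"] f_sm[of "?g x" r] fg[OF that(1)] that P.rsmult_closed by simp
  have "f \<in> right_hom R P Q" using f UQ by (auto simp: right_hom_def PiE_def Pi_def)
  moreover have "(\<lambda>x\<in>carrier Q. ?g (u x)) \<in> right_hom R Q P"
    using u_add u_sm u fg(1) g_add g_sm Q.rsmult_closed by (auto simp: right_hom_def)
  moreover have "(\<lambda>x\<in>carrier Q. ?g (u x)) (f p) = p" if "p \<in> carrier P" for p
    using fU[OF that] u_id gf[OF that] UQ by auto
  ultimately show thesis by (rule that)
qed

text \<open>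
The functionals are the coordinates of an embedding of \<open>P\<close> as a direct summand of a free module, and the
elements are the images of the basis under a retraction. Only finitely many coordinates are nonzero
on a finite generating set, and the others vanish on all of \<open>P\<close>. The zero element of \<open>P\<close> joins
the index set to make it nonempty: a presentation needs at least one generator.
\<close>

lemma right_progenerator_dual_basis:
  fixes P :: "('l, 'p, 'r, 'z) bimodule_scheme"
  assumes "right_progenerator R P"
  obtains F :: "'p set" and a b where "finite F" "F \<noteq> {}" "\<And>j. j \<in> F \<Longrightarrow> a j \<in> carrier P"
    "\<And>j. j \<in> F \<Longrightarrow> b j \<in> right_hom R P (regular_bimodule R)"
    "\<And>p. p \<in> carrier P \<Longrightarrow> p = (\<Oplus>\<^bsub>P\<^esub>j\<in>F. a j \<bullet>\<^bsub>P\<^esub> b j p)"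
proof -
  have P: "right_module R P" and fg: "right_finitely_generated R P" and pr: "right_projective R P"
    using assms by (auto simp: right_progenerator_def)
  interpret P: right_module R P by fact
  have R: "ring R" by (rule P.R.ring_axioms)
  obtain B :: "'p set" where "is_right_direct_summand R P (direct_sum_power B (regular_bimodule R))"
    using pr by (auto simp: right_projective_def)
  then obtain i r where i: "i \<in> right_hom R P (direct_sum_power B (regular_bimodule R))"
    and r: "r \<in> right_hom R (direct_sum_power B (regular_bimodule R)) P"
    and ri: "\<And>p. p \<in> carrier P \<Longrightarrow> r (i p) = p"
    using right_direct_summand_retraction[OF P right_module_direct_sum_power[OF right_module_regular_bimodule[OF R]]]
    by blast
  obtain S where S: "finite S" "S \<subseteq> carrier P"
    and gen: "\<And>U. right_submodule R P U \<Longrightarrow> S \<subseteq> U \<Longrightarrow> U = carrier P"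
    using fg by (auto simp: right_finitely_generated_def)
  have ic: "i p \<in> carrier (direct_sum_power B (regular_bimodule R))" if "p \<in> carrier P" for p
    using additive_closed[OF right_hom_additive[OF i] that] .
  have icR: "i p j \<in> carrier R" if "p \<in> carrier P" "j \<in> B" for p j
    using ic[OF that(1)] that(2) by (auto simp: direct_sum_power_def)
  have i_add: "i (p \<oplus>\<^bsub>P\<^esub> q) j = i p j \<oplus>\<^bsub>R\<^esub> i q j" if "p \<in> carrier P" "q \<in> carrier P" "j \<in> B" for p q j
    using additive_add[OF right_hom_additive[OF i] that(1,2)] that by (simp add: direct_sum_power_def)
  have i_sm: "i (p \<bullet>\<^bsub>P\<^esub> s) j = i p j \<otimes>\<^bsub>R\<^esub> s" if "p \<in> carrier P" "s \<in> carrier R" "j \<in> B" for p s j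
    using right_hom_rsmult[OF i that(1,2)] that by (simp add: direct_sum_power_def)
  define F where "F = (\<Union>s\<in>S. {j \<in> B. i s j \<noteq> \<zero>\<^bsub>R\<^esub>})"
  have F: "finite F" "F \<subseteq> B"
    unfolding F_def using S ic by (auto simp: direct_sum_power_def)
  let ?U = "{p \<in> carrier P. \<forall>j\<in>B - F. i p j = \<zero>\<^bsub>R\<^esub>}"
  have i_additive: "additive_map P R (\<lambda>p. i p j)" if "j \<in> B" for j
    using icR i_add that by (auto simp: additive_map_def)
  have "right_submodule R P ?U"
    unfolding right_submodule_def
  proof (intro conjI ballI)
    show "subgroup ?U (add_monoid P)"
    proof (rule P.P.add.subgroupI)
      have "\<zero>\<^bsub>P\<^esub> \<in> ?U"
        using additive_zero[OF P.P.abelian_group_axioms P.R.abelian_group_axioms i_additive] by auto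
      then show "?U \<noteq> {}" by blast
      fix x assume "x \<in> ?U"
      then show "\<ominus>\<^bsub>P\<^esub> x \<in> ?U"
        using additive_minus[OF P.P.abelian_group_axioms P.R.abelian_group_axioms i_additive, of _ x] by auto
    qed (use i_add in auto)
  qed (use i_sm P.rsmult_closed in auto)
  moreover have "S \<subseteq> ?U" using S by (auto simp: F_def)
  ultimately have U: "?U = carrier P" by (rule gen)
  let ?e = "\<lambda>j. coord_vector B (regular_bimodule R) j"
  let ?a = "\<lambda>j. if j \<in> F then r (?e j \<one>\<^bsub>R\<^esub>) else \<zero>\<^bsub>P\<^esub>"
  let ?b = "\<lambda>j. \<lambda>p\<in>carrier P. if j \<in> F then i p j else \<zero>\<^bsub>R\<^esub>"
  have ec: "?e j x \<in> carrier (direct_sum_power B (regular_bimodule R))" if "x \<in> carrier R" for x j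
    using that by (intro coord_vector_closed[OF abelian_group_regular_bimodule[OF R]]) simp
  have a: "?a j \<in> carrier P" for j
    using additive_closed[OF right_hom_additive[OF r] ec] by simp
  have b: "?b j \<in> right_hom R P (regular_bimodule R)" for j
    using icR i_add i_sm F P.rsmult_closed by (auto simp: right_hom_def)
  have bc: "?b j p \<in> carrier R" if "p \<in> carrier P" for p j using that icR F by auto
  have sum: "p = (\<Oplus>\<^bsub>P\<^esub>j\<in>insert \<zero>\<^bsub>P\<^esub> F. ?a j \<bullet>\<^bsub>P\<^esub> ?b j p)" if p: "p \<in> carrier P" for p
  proof -
    have "p = r (i p)" using ri p by simp
    also have "\<dots> = (\<Oplus>\<^bsub>P\<^esub>j\<in>F. r (?e j (i p j)))"
      using F p ic U
      by (intro additive_direct_sum_power[OF abelian_group_regular_bimodule[OF R] P.P.abelian_group_axioms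
          right_hom_additive[OF r]]) auto
    also have "\<dots> = (\<Oplus>\<^bsub>P\<^esub>j\<in>F. ?a j \<bullet>\<^bsub>P\<^esub> ?b j p)"
    proof (intro P.P.finsum_cong' refl)
      fix j assume j: "j \<in> F"
      have "?e j (i p j) = ?e j \<one>\<^bsub>R\<^esub> \<bullet>\<^bsub>direct_sum_power B (regular_bimodule R)\<^esub> i p j"
        using icR[OF p] j F by (auto simp: coord_vector_def direct_sum_power_def fun_eq_iff)
      then show "r (?e j (i p j)) = ?a j \<bullet>\<^bsub>P\<^esub> ?b j p"
        using right_hom_rsmult[OF r ec] icR[OF p] j F p by auto
    qed (use additive_closed[OF right_hom_additive[OF r] ec] icR F p in \<open>auto intro!: P.rsmult_closed\<close>)
    also have "\<dots> = (\<Oplus>\<^bsub>P\<^esub>j\<in>insert \<zero>\<^bsub>P\<^esub> F. ?a j \<bullet>\<^bsub>P\<^esub> ?b j p)"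
      using additive_closed[OF right_hom_additive[OF r] ec] icR F p P.rsmult_zero_left
      by (intro P.P.add.finprod_mono_neutral_cong_left) (auto intro!: P.rsmult_closed)
    finally show ?thesis .
  qed
  show thesis
    by (rule that[of "insert \<zero>\<^bsub>P\<^esub> F" ?a ?b]) (use F a b sum in auto)
qed

text \<open>
If \<open>R\<close> is a direct summand of a power of \<open>P\<close>, take the components of the image of one, and the components
of a retraction.
\<close>

lemma right_progenerator_trace:
  assumes "right_progenerator R P"
  obtains n :: nat and x y where "\<And>k. k < n \<Longrightarrow> x k \<in> carrier P"
    "\<And>k. k < n \<Longrightarrow> y k \<in> right_hom R P (regular_bimodule R)"
    "(\<Oplus>\<^bsub>R\<^esub>k\<in>{..<n}. y k (x k)) = \<one>\<^bsub>R\<^esub>"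
proof -
  have P: "right_module R P" using assms by (auto simp: right_progenerator_def)
  interpret P: right_module R P by fact
  have R: "ring R" by (rule P.R.ring_axioms)
  obtain n where "is_right_direct_summand R (regular_bimodule R) (finite_power P n)"
    using assms by (auto simp: right_progenerator_def)
  then obtain i r where i: "i \<in> right_hom R (regular_bimodule R) (finite_power P n)"
    and r: "r \<in> right_hom R (finite_power P n) (regular_bimodule R)"
    and ri: "\<And>p. p \<in> carrier R \<Longrightarrow> r (i p) = p"
    using right_direct_summand_retraction[OF right_module_regular_bimodule[OF R] right_module_direct_sum_power[OF P]]
    by (metis regular_bimodule_simps(1))
  let ?x = "i \<one>\<^bsub>R\<^esub>" and ?e = "\<lambda>k. coord_vector {..<n} P k"
  let ?y = "\<lambda>k. \<lambda>p\<in>carrier P. r (?e k p)"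
  have ix: "?x \<in> carrier (finite_power P n)"
    using additive_closed[OF right_hom_additive[OF i]] by simp
  have ec: "?e k p \<in> carrier (finite_power P n)" if "p \<in> carrier P" for k p
    using coord_vector_closed[OF P.P.abelian_group_axioms that] .
  have rc: "r z \<in> carrier R" if "z \<in> carrier (finite_power P n)" for z
    using additive_closed[OF right_hom_additive[OF r] that] by simp
  have x: "?x k \<in> carrier P" if "k < n" for k using ix that by (auto simp: carrier_finite_power)
  have y: "?y k \<in> right_hom R P (regular_bimodule R)" for k
  proof -
    have "r (?e k (p \<oplus>\<^bsub>P\<^esub> q)) = r (?e k p) \<oplus>\<^bsub>R\<^esub> r (?e k q)" if "p \<in> carrier P" "q \<in> carrier P" for p q
    proof -
      have "?e k (p \<oplus>\<^bsub>P\<^esub> q) = ?e k p \<oplus>\<^bsub>finite_power P n\<^esub> ?e k q"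
        by (auto simp: coord_vector_def direct_sum_power_def fun_eq_iff)
      then show ?thesis using additive_add[OF right_hom_additive[OF r] ec[OF that(1)] ec[OF that(2)]] by simp
    qed
    moreover have "r (?e k (p \<bullet>\<^bsub>P\<^esub> s)) = r (?e k p) \<otimes>\<^bsub>R\<^esub> s" if "p \<in> carrier P" "s \<in> carrier R" for p s
    proof -
      have "?e k (p \<bullet>\<^bsub>P\<^esub> s) = ?e k p \<bullet>\<^bsub>finite_power P n\<^esub> s"
        using that P.rsmult_zero_left by (auto simp: coord_vector_def direct_sum_power_def fun_eq_iff)
      then show ?thesis using right_hom_rsmult[OF r ec[OF that(1)] that(2)] by simp
    qed
    ultimately show ?thesis using rc ec P.rsmult_closed by (auto simp: right_hom_def)
  qed
  have "\<one>\<^bsub>R\<^esub> = r ?x" using ri[of "\<one>\<^bsub>R\<^esub>"] by simp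
  also have "\<dots> = (\<Oplus>\<^bsub>regular_bimodule R\<^esub>k\<in>{..<n}. r (?e k (?x k)))"
    using ix by (intro additive_direct_sum_power[OF P.P.abelian_group_axioms
        abelian_group_regular_bimodule[OF R] right_hom_additive[OF r]]) auto
  also have "\<dots> = (\<Oplus>\<^bsub>R\<^esub>k\<in>{..<n}. r (?e k (?x k)))"
    using rc ec x by (intro finsum_regular_bimodule[OF R]) auto
  also have "\<dots> = (\<Oplus>\<^bsub>R\<^esub>k\<in>{..<n}. ?y k (?x k))"
    using rc ec x by (intro P.R.finsum_cong' refl) auto
  finally show thesis using x y that[of n ?x ?y] by simp
qed

lemma progenerator_endomorphism:
  assumes "progenerator L R P" "\<phi> \<in> right_hom R P P"
  obtains l where "l \<in> carrier L" "\<And>p. p \<in> carrier P \<Longrightarrow> l \<odot>\<^bsub>P\<^esub> p = \<phi> p"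
proof -
  have "bij_betw (\<lambda>l. \<lambda>p\<in>carrier P. l \<odot>\<^bsub>P\<^esub> p) (carrier L) (carrier (right_End R P))"
    using assms by (auto simp: progenerator_def ring_iso_def)
  moreover have "\<phi> \<in> carrier (right_End R P)" using assms by (simp add: right_End_def)
  ultimately have "\<phi> \<in> (\<lambda>l. \<lambda>p\<in>carrier P. l \<odot>\<^bsub>P\<^esub> p) ` carrier L"
    by (simp add: bij_betw_def)
  then obtain l where "l \<in> carrier L" "(\<lambda>p\<in>carrier P. l \<odot>\<^bsub>P\<^esub> p) = \<phi>" by blast
  then show thesis using that by (metis restrict_apply')
qed

lemma progenerator_faithful:
  assumes "progenerator L R P" "l \<in> carrier L" "l' \<in> carrier L"
    and "\<And>p. p \<in> carrier P \<Longrightarrow> l \<odot>\<^bsub>P\<^esub> p = l' \<odot>\<^bsub>P\<^esub> p"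
  shows "l = l'"
proof -
  have "inj_on (\<lambda>l. \<lambda>p\<in>carrier P. l \<odot>\<^bsub>P\<^esub> p) (carrier L)"
    using assms by (auto simp: progenerator_def ring_iso_def bij_betw_def)
  moreover have "(\<lambda>p\<in>carrier P. l \<odot>\<^bsub>P\<^esub> p) = (\<lambda>p\<in>carrier P. l' \<odot>\<^bsub>P\<^esub> p)"
    using assms(4) by auto
  ultimately show ?thesis using assms(2,3) by (auto dest: inj_onD)
qed

section \<open>The tensor product and its universal property\<close>

lemma (in abelian_group) minus_eq_iff:
  assumes "x \<in> carrier G" "y \<in> carrier G" "z \<in> carrier G"
  shows "x \<ominus> y = z \<longleftrightarrow> x = z \<oplus> y"
proof -
  have "x = (x \<ominus> y) \<oplus> y" "z = (z \<oplus> y) \<ominus> y"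
    using assms by (simp_all add: a_minus_def a_assoc l_neg r_neg)
  then show ?thesis by metis
qed

locale tensor = Q: bimodule R L Q + M: left_module L M
  for R :: "('r, 'x) ring_scheme" and L :: "('l, 'y) ring_scheme"
    and Q :: "('r, 'q, 'l, 'z) bimodule_scheme" and M :: "('l, 'm, 'w) module_scheme"
begin

abbreviation G where "G \<equiv> free_Abelian_group (carrier Q \<times> carrier M)"
abbreviation K where "K \<equiv> generate G (tensor_relations L Q M)"
abbreviation T where "T \<equiv> tensor_product L Q M"
abbreviation cls where "cls c \<equiv> K #>\<^bsub>G\<^esub> c"

definition pure :: "'q \<Rightarrow> 'm \<Rightarrow> ('q \<times> 'm \<Rightarrow>\<^sub>0 int) set"
  where "pure q m = cls (frag_of (q, m))"

lemma relations_in_G: "tensor_relations L Q M \<subseteq> carrier G"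
proof -
  have "x - y \<in> carrier G" if "x \<in> carrier G" "y \<in> carrier G" for x y
    using that keys_diff[of x y] by auto
  moreover have "frag_of (q, m) \<in> carrier G" if "q \<in> carrier Q" "m \<in> carrier M" for q m
    using that by simp
  ultimately show ?thesis
    using Q.R.rsmult_closed M.smult_closed
    unfolding tensor_relations_def by (auto simp del: carrier_free_Abelian_group_iff)
qed

lemma K_subgroup: "subgroup K G"
  by (rule group.generate_is_subgroup[OF group_free_Abelian_group relations_in_G])

lemma K_normal: "K \<lhd> G"
  using comm_group.normal_iff_subgroup[OF abelian_free_Abelian_group] K_subgroup by blast

lemma T_simps:
  "carrier T = carrier (G Mod K)" "\<zero>\<^bsub>T\<^esub> = \<one>\<^bsub>G Mod K\<^esub>" "x \<oplus>\<^bsub>T\<^esub> y = x \<otimes>\<^bsub>G Mod K\<^esub> y"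
  by (simp_all add: tensor_product_def Let_def)

lemma T_abelian_group: "abelian_group T"
proof -
  interpret T: comm_group "G Mod K"
    by (rule comm_group.abelian_FactGroup[OF abelian_free_Abelian_group K_subgroup])
  show ?thesis
    by (rule abelian_groupI)
       (auto simp: T_simps T.m_ac simp del: one_FactGroup mult_FactGroup intro: T.l_inv_ex)
qed

sublocale T: abelian_group T by (rule T_abelian_group)

lemma carrier_T: "carrier T = cls ` carrier G"
  by (simp add: T_simps carrier_FactGroup)

lemma cls_closed: "c \<in> carrier G \<Longrightarrow> cls c \<in> carrier T"
  by (simp add: carrier_T)

lemma cls_add:
  assumes "c \<in> carrier G" "d \<in> carrier G"
  shows "cls (c + d) = cls c \<oplus>\<^bsub>T\<^esub> cls d"
  using normal.rcos_sum[OF K_normal assms] by (simp add: T_simps)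

lemma cls_zero: "cls 0 = \<zero>\<^bsub>T\<^esub>"
  using group.coset_join2[OF group_free_Abelian_group _ K_subgroup subgroup.one_closed[OF K_subgroup]]
  by (simp add: T_simps)

lemma cls_diff:
  assumes "c \<in> carrier G" "d \<in> carrier G"
  shows "cls (c - d) = cls c \<ominus>\<^bsub>T\<^esub> cls d"
proof -
  have cd: "c - d \<in> carrier G" using assms keys_diff[of c d] by auto
  have "cls c = cls (c - d) \<oplus>\<^bsub>T\<^esub> cls d" using cls_add[OF cd assms(2)] by simp
  then show ?thesis using cls_closed[OF cd] cls_closed[OF assms(2)]
    by (simp add: a_minus_def T.a_assoc T.r_neg)
qed

lemma cls_eq_iff:
  assumes "c \<in> carrier G" "d \<in> carrier G"
  shows "cls c = cls d \<longleftrightarrow> c - d \<in> K"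
proof
  have cd: "c - d \<in> carrier G" using assms keys_diff[of c d] by auto
  have z: "cls c = cls d \<longleftrightarrow> cls (c - d) = \<zero>\<^bsub>T\<^esub>"
    unfolding cls_diff[OF assms] using cls_closed assms by (simp add: T.minus_eq_iff)
  have zK: "\<zero>\<^bsub>T\<^esub> = K" by (simp add: T_simps)
  show "cls c = cls d \<Longrightarrow> c - d \<in> K"
    using z zK cd group.coset_join1[OF group_free_Abelian_group _ cd K_subgroup] by simp
  show "c - d \<in> K \<Longrightarrow> cls c = cls d"
    using z zK cd group.coset_join2[OF group_free_Abelian_group cd K_subgroup] by simp
qed

lemma cls_relation:
  assumes "c \<in> tensor_relations L Q M" shows "cls c = \<zero>\<^bsub>T\<^esub>"
proof -
  have "c \<in> K" using assms by (rule generate.incl)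
  moreover have "c \<in> carrier G" using relations_in_G assms by blast
  ultimately show ?thesis
    using group.coset_join2[OF group_free_Abelian_group _ K_subgroup] by (simp add: T_simps)
qed

lemma pure_closed: "q \<in> carrier Q \<Longrightarrow> m \<in> carrier M \<Longrightarrow> pure q m \<in> carrier T"
  unfolding pure_def by (rule cls_closed) simp

lemma pure_relation_zero:
  assumes "x \<in> carrier T" "y \<in> carrier T" "z \<in> carrier T" "x \<ominus>\<^bsub>T\<^esub> y \<ominus>\<^bsub>T\<^esub> z = \<zero>\<^bsub>T\<^esub>"
  shows "x = y \<oplus>\<^bsub>T\<^esub> z"
  using assms by (simp add: T.minus_eq_iff T.a_comm)

lemma pure_add_left:
  assumes "p \<in> carrier Q" "q \<in> carrier Q" "m \<in> carrier M"
  shows "pure (p \<oplus>\<^bsub>Q\<^esub> q) m = pure p m \<oplus>\<^bsub>T\<^esub> pure q m"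
proof -
  have c: "frag_of (p \<oplus>\<^bsub>Q\<^esub> q, m) \<in> carrier G" "frag_of (p, m) \<in> carrier G" "frag_of (q, m) \<in> carrier G"
    using assms by auto
  have d: "frag_of (p \<oplus>\<^bsub>Q\<^esub> q, m) - frag_of (p, m) \<in> carrier G"
    using c keys_diff[of "frag_of (p \<oplus>\<^bsub>Q\<^esub> q, m)" "frag_of (p, m)"] by auto
  have "frag_of (p \<oplus>\<^bsub>Q\<^esub> q, m) - frag_of (p, m) - frag_of (q, m) \<in> tensor_relations L Q M"
    using assms unfolding tensor_relations_def by blast
  from cls_relation[OF this] show ?thesis
    unfolding pure_def cls_diff[OF d c(3)] cls_diff[OF c(1,2)]
    using cls_closed c by (intro pure_relation_zero) auto
qed

lemma pure_add_right:
  assumes "q \<in> carrier Q" "m \<in> carrier M" "n \<in> carrier M"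
  shows "pure q (m \<oplus>\<^bsub>M\<^esub> n) = pure q m \<oplus>\<^bsub>T\<^esub> pure q n"
proof -
  have c: "frag_of (q, m \<oplus>\<^bsub>M\<^esub> n) \<in> carrier G" "frag_of (q, m) \<in> carrier G" "frag_of (q, n) \<in> carrier G"
    using assms by auto
  have d: "frag_of (q, m \<oplus>\<^bsub>M\<^esub> n) - frag_of (q, m) \<in> carrier G"
    using c keys_diff[of "frag_of (q, m \<oplus>\<^bsub>M\<^esub> n)" "frag_of (q, m)"] by auto
  have "frag_of (q, m \<oplus>\<^bsub>M\<^esub> n) - frag_of (q, m) - frag_of (q, n) \<in> tensor_relations L Q M"
    using assms unfolding tensor_relations_def by blast
  from cls_relation[OF this] show ?thesis
    unfolding pure_def cls_diff[OF d c(3)] cls_diff[OF c(1,2)]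
    using cls_closed c by (intro pure_relation_zero) auto
qed

lemma pure_balanced:
  assumes "q \<in> carrier Q" "l \<in> carrier L" "m \<in> carrier M"
  shows "pure (q \<bullet>\<^bsub>Q\<^esub> l) m = pure q (l \<odot>\<^bsub>M\<^esub> m)"
proof -
  have c: "frag_of (q \<bullet>\<^bsub>Q\<^esub> l, m) \<in> carrier G" "frag_of (q, l \<odot>\<^bsub>M\<^esub> m) \<in> carrier G"
    using assms Q.R.rsmult_closed M.smult_closed by auto
  have "frag_of (q \<bullet>\<^bsub>Q\<^esub> l, m) - frag_of (q, l \<odot>\<^bsub>M\<^esub> m) \<in> tensor_relations L Q M"
    using assms unfolding tensor_relations_def by blast
  then show ?thesis
    unfolding pure_def cls_eq_iff[OF c] by (rule generate.incl)
qed

lemma T_induct [consumes 1, case_names zero diff pure]: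
  assumes "t \<in> carrier T" "P \<zero>\<^bsub>T\<^esub>"
    and diff: "\<And>x y. x \<in> carrier T \<Longrightarrow> y \<in> carrier T \<Longrightarrow> P x \<Longrightarrow> P y \<Longrightarrow> P (x \<ominus>\<^bsub>T\<^esub> y)"
    and pure: "\<And>q m. q \<in> carrier Q \<Longrightarrow> m \<in> carrier M \<Longrightarrow> P (pure q m)"
  shows "P t"
proof -
  obtain c where c: "c \<in> carrier G" "t = cls c" using assms(1) by (auto simp: carrier_T)
  have "P (cls c)"
  proof (rule free_Abelian_group_induct[where P = "\<lambda>c. P (cls c)"])
    show "Poly_Mapping.keys c \<subseteq> carrier Q \<times> carrier M" using c by simp
    show "P (cls 0)" using assms(2) cls_zero by simp
    show "P (cls (x - y))" if "Poly_Mapping.keys x \<subseteq> carrier Q \<times> carrier M"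
      "Poly_Mapping.keys y \<subseteq> carrier Q \<times> carrier M" "P (cls x)" "P (cls y)" for x y
      using that cls_diff[of x y] cls_closed diff by simp
    show "P (cls (frag_of a))" if "a \<in> carrier Q \<times> carrier M" for a
      using that pure[of "fst a" "snd a"] by (auto simp: pure_def)
  qed
  with c show ?thesis by simp
qed

lemma additive_diff:
  assumes "abelian_group N" "additive_map T N h" "x \<in> carrier T" "y \<in> carrier T"
  shows "h (x \<ominus>\<^bsub>T\<^esub> y) = h x \<ominus>\<^bsub>N\<^esub> h y"
  using assms additive_add[OF assms(2), of x "\<ominus>\<^bsub>T\<^esub> y"] additive_minus[OF T_abelian_group assms(1,2,4)]
  by (simp add: a_minus_def)

lemma additive_eqI:
  assumes N: "abelian_group N" and h: "additive_map T N h" "additive_map T N h'"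
    and eq: "\<And>q m. q \<in> carrier Q \<Longrightarrow> m \<in> carrier M \<Longrightarrow> h (pure q m) = h' (pure q m)"
    and t: "t \<in> carrier T"
  shows "h t = h' t"
  using t
  by (induction t rule: T_induct)
     (auto simp: eq additive_diff[OF N] h additive_zero[OF T_abelian_group N])

lemma universal_property:
  assumes N: "abelian_group N"
    and \<beta>: "\<And>q m. q \<in> carrier Q \<Longrightarrow> m \<in> carrier M \<Longrightarrow> \<beta> q m \<in> carrier N"
    and left: "\<And>p q m. p \<in> carrier Q \<Longrightarrow> q \<in> carrier Q \<Longrightarrow> m \<in> carrier M \<Longrightarrow>
      \<beta> (p \<oplus>\<^bsub>Q\<^esub> q) m = \<beta> p m \<oplus>\<^bsub>N\<^esub> \<beta> q m"
    and right: "\<And>q m n. q \<in> carrier Q \<Longrightarrow> m \<in> carrier M \<Longrightarrow> n \<in> carrier M \<Longrightarrow>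
      \<beta> q (m \<oplus>\<^bsub>M\<^esub> n) = \<beta> q m \<oplus>\<^bsub>N\<^esub> \<beta> q n"
    and bal: "\<And>q l m. q \<in> carrier Q \<Longrightarrow> l \<in> carrier L \<Longrightarrow> m \<in> carrier M \<Longrightarrow>
      \<beta> (q \<bullet>\<^bsub>Q\<^esub> l) m = \<beta> q (l \<odot>\<^bsub>M\<^esub> m)"
  obtains h where "additive_map T N h" "\<And>q m. q \<in> carrier Q \<Longrightarrow> m \<in> carrier M \<Longrightarrow> h (pure q m) = \<beta> q m"
proof -
  interpret N: abelian_group N by fact
  have img: "(\<lambda>(q, m). \<beta> q m) ` (carrier Q \<times> carrier M) \<subseteq> carrier (add_monoid N)" using \<beta> by auto
  obtain g where g: "g \<in> hom G (add_monoid N)"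
    and g_of: "\<And>z. z \<in> carrier Q \<times> carrier M \<Longrightarrow> g (frag_of z) = (\<lambda>(q, m). \<beta> q m) z"
    using comm_group.free_Abelian_group_universal[OF N.a_comm_group img] by blast
  have gc: "g c \<in> carrier N" if "c \<in> carrier G" for c using g that by (auto simp: hom_def)
  have g_add: "g (c + d) = g c \<oplus>\<^bsub>N\<^esub> g d" if "c \<in> carrier G" "d \<in> carrier G" for c d
    using hom_mult[OF g that] by simp
  have g_diff: "g (c - d) = g c \<ominus>\<^bsub>N\<^esub> g d" if "c \<in> carrier G" "d \<in> carrier G" for c d
  proof -
    have cd: "c - d \<in> carrier G" using that keys_diff[of c d] by auto
    have "g c = g (c - d) \<oplus>\<^bsub>N\<^esub> g d" using g_add[OF cd that(2)] by simp
    then show ?thesis using gc[OF cd] gc[OF that(2)] by (simp add: a_minus_def N.a_assoc N.r_neg)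
  qed
  have g_pair: "g (frag_of (q, m)) = \<beta> q m" if "q \<in> carrier Q" "m \<in> carrier M" for q m
    using g_of[of "(q, m)"] that by simp
  have fr: "frag_of (q, m) \<in> carrier G" if "q \<in> carrier Q" "m \<in> carrier M" for q m using that by simp
  have frd: "frag_of (q, m) - frag_of (q', m') \<in> carrier G"
    if "q \<in> carrier Q" "m \<in> carrier M" "q' \<in> carrier Q" "m' \<in> carrier M" for q m q' m'
    using that keys_diff[of "frag_of (q, m)" "frag_of (q', m')"] by auto
  have g_rel: "g c = \<zero>\<^bsub>N\<^esub>" if "c \<in> tensor_relations L Q M" for c
    using that unfolding tensor_relations_def
  proof (elim UnE CollectE exE conjE)
    fix p q x assume "p \<in> carrier Q" "q \<in> carrier Q" "x \<in> carrier M"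
      "c = frag_of (p \<oplus>\<^bsub>Q\<^esub> q, x) - frag_of (p, x) - frag_of (q, x)"
    then show ?thesis using \<beta>[of p x] \<beta>[of q x]
      by (simp add: g_diff g_pair left frd fr N.minus_eq_iff N.a_comm
          del: carrier_free_Abelian_group_iff)
  next
    fix q x y assume "q \<in> carrier Q" "x \<in> carrier M" "y \<in> carrier M"
      "c = frag_of (q, x \<oplus>\<^bsub>M\<^esub> y) - frag_of (q, x) - frag_of (q, y)"
    then show ?thesis using \<beta>[of q x] \<beta>[of q y]
      by (simp add: g_diff g_pair right frd fr N.minus_eq_iff N.a_comm
          del: carrier_free_Abelian_group_iff)
  next
    fix q l x assume "q \<in> carrier Q" "l \<in> carrier L" "x \<in> carrier M"
      "c = frag_of (q \<bullet>\<^bsub>Q\<^esub> l, x) - frag_of (q, l \<odot>\<^bsub>M\<^esub> x)"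
    then show ?thesis using \<beta>[of q "l \<odot>\<^bsub>M\<^esub> x"] M.smult_closed[of l x] Q.R.rsmult_closed[of q l]
      by (simp add: g_diff g_pair bal fr a_minus_def N.r_neg del: carrier_free_Abelian_group_iff)
  qed
  have g_K: "g c = \<zero>\<^bsub>N\<^esub>" if "c \<in> K" for c
  proof -
    have G: "group G" by simp
    have N': "group (add_monoid N)" by (rule N.a_group)
    have "group_hom G (add_monoid N) g" using g G N' by (simp add: group_hom_def group_hom_axioms_def)
    then have "subgroup (kernel G (add_monoid N) g) G" by (rule group_hom.subgroup_kernel)
    moreover have "tensor_relations L Q M \<subseteq> kernel G (add_monoid N) g"
      using relations_in_G g_rel by (auto simp: kernel_def simp del: carrier_free_Abelian_group_iff)
    ultimately have "K \<subseteq> kernel G (add_monoid N) g"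
      by (intro group.generate_subgroup_incl[OF G])
    with that show ?thesis by (auto simp: kernel_def)
  qed
  obtain h where h: "h \<in> hom (G Mod K) (add_monoid N)" and hg: "\<And>c. c \<in> carrier G \<Longrightarrow> h (cls c) = g c"
  proof (rule FactGroup_universal[OF g K_normal])
    fix c d assume cd: "c \<in> carrier G" "d \<in> carrier G" "cls c = cls d"
    then have "g c \<ominus>\<^bsub>N\<^esub> g d = \<zero>\<^bsub>N\<^esub>" using g_K[of "c - d"] cls_eq_iff g_diff by simp
    then show "g c = g d" using gc[OF cd(1)] gc[OF cd(2)] by (simp add: N.minus_eq_iff)
  qed blast
  have "additive_map T N h" using h by (auto simp: additive_map_def hom_def T_simps)
  moreover have "h (pure q m) = \<beta> q m" if "q \<in> carrier Q" "m \<in> carrier M" for q m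
    using hg[OF fr[OF that]] g_pair[OF that] by (simp add: pure_def)
  ultimately show thesis by (rule that)
qed

text \<open>
The action on representatives maps relations to relations, so the union in the definition of the action
on a coset is a union of equal cosets.
\<close>

lemma smult_cls:
  assumes r: "r \<in> carrier R" and c: "c \<in> carrier G"
  shows "frag_extend (\<lambda>(q, x). frag_of (r \<odot>\<^bsub>Q\<^esub> q, x)) c \<in> carrier G"
    and "r \<odot>\<^bsub>T\<^esub> cls c = cls (frag_extend (\<lambda>(q, x). frag_of (r \<odot>\<^bsub>Q\<^esub> q, x)) c)"
proof -
  let ?A = "frag_extend (\<lambda>(q, x). frag_of (r \<odot>\<^bsub>Q\<^esub> q, x))"
  have A: "?A c \<in> carrier G" if "c \<in> carrier G" for c
  proof -
    have "Poly_Mapping.keys (?A c) \<subseteq> (\<Union>z\<in>Poly_Mapping.keys c. Poly_Mapping.keys (case z of (q, x) \<Rightarrow> frag_of (r \<odot>\<^bsub>Q\<^esub> q, x)))"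
      by (rule keys_frag_extend)
    also have "\<dots> \<subseteq> carrier Q \<times> carrier M" using that Q.L.smult_closed[OF r] by auto
    finally show ?thesis by simp
  qed
  show "?A c \<in> carrier G" using A[OF c] .
  note rels = tensor_relations_def[of L Q M]
  let ?R1 = "{frag_of (p \<oplus>\<^bsub>Q\<^esub> q, x) - frag_of (p, x) - frag_of (q, x) | p q x.
    p \<in> carrier Q \<and> q \<in> carrier Q \<and> x \<in> carrier M}"
  let ?R2 = "{frag_of (q, x \<oplus>\<^bsub>M\<^esub> y) - frag_of (q, x) - frag_of (q, y) | q x y.
    q \<in> carrier Q \<and> x \<in> carrier M \<and> y \<in> carrier M}"
  let ?R3 = "{frag_of (q \<bullet>\<^bsub>Q\<^esub> l, x) - frag_of (q, l \<odot>\<^bsub>M\<^esub> x) | q l x.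
    q \<in> carrier Q \<and> l \<in> carrier L \<and> x \<in> carrier M}"
  have A_rel: "?A k \<in> tensor_relations L Q M" if "k \<in> tensor_relations L Q M" for k
    using that unfolding rels
  proof (elim UnE CollectE exE conjE)
    fix p q x assume pqx: "p \<in> carrier Q" "q \<in> carrier Q" "x \<in> carrier M"
      and k: "k = frag_of (p \<oplus>\<^bsub>Q\<^esub> q, x) - frag_of (p, x) - frag_of (q, x)"
    have "?A k = frag_of (r \<odot>\<^bsub>Q\<^esub> p \<oplus>\<^bsub>Q\<^esub> r \<odot>\<^bsub>Q\<^esub> q, x) - frag_of (r \<odot>\<^bsub>Q\<^esub> p, x) - frag_of (r \<odot>\<^bsub>Q\<^esub> q, x)"
      using pqx r by (simp add: k frag_extend_diff Q.L.smult_r_distr)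
    then show "?A k \<in> ?R1 \<union> ?R2 \<union> ?R3" using pqx Q.L.smult_closed[OF r] by blast
  next
    fix q x y assume pqx: "q \<in> carrier Q" "x \<in> carrier M" "y \<in> carrier M"
      and k: "k = frag_of (q, x \<oplus>\<^bsub>M\<^esub> y) - frag_of (q, x) - frag_of (q, y)"
    have "?A k = frag_of (r \<odot>\<^bsub>Q\<^esub> q, x \<oplus>\<^bsub>M\<^esub> y) - frag_of (r \<odot>\<^bsub>Q\<^esub> q, x) - frag_of (r \<odot>\<^bsub>Q\<^esub> q, y)"
      by (simp add: k frag_extend_diff)
    then show "?A k \<in> ?R1 \<union> ?R2 \<union> ?R3" using pqx Q.L.smult_closed[OF r] by blast
  next
    fix q l x assume pqx: "q \<in> carrier Q" "l \<in> carrier L" "x \<in> carrier M"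
      and k: "k = frag_of (q \<bullet>\<^bsub>Q\<^esub> l, x) - frag_of (q, l \<odot>\<^bsub>M\<^esub> x)"
    have "?A k = frag_of ((r \<odot>\<^bsub>Q\<^esub> q) \<bullet>\<^bsub>Q\<^esub> l, x) - frag_of (r \<odot>\<^bsub>Q\<^esub> q, l \<odot>\<^bsub>M\<^esub> x)"
      using pqx r by (simp add: k frag_extend_diff Q.smult_rsmult)
    then show "?A k \<in> ?R1 \<union> ?R2 \<union> ?R3" using pqx Q.L.smult_closed[OF r] by blast
  qed
  have A_K: "?A k \<in> K" if "k \<in> K" for k
    using that
  proof (induction k rule: generate.induct)
    case one
    then show ?case using generate.one[of G] by simp
  next
    case (incl k)
    then show ?case using A_rel by (intro generate.incl) auto
  next
    case (inv k)
    then have "inv\<^bsub>G\<^esub> (?A k) \<in> K" using A_rel by (intro generate.inv) auto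
    moreover have "k \<in> carrier G" using inv relations_in_G by blast
    ultimately show ?case using A[of k] by (simp add: frag_extend_minus)
  next
    case (eng h1 h2)
    then show ?case using generate.eng[of "?A h1" G _ "?A h2"] by (simp add: frag_extend_add)
  qed
  have const: "cls (?A d) = cls (?A c)" if "d \<in> cls c" for d
  proof -
    obtain k where k: "k \<in> K" "d = k + c" using \<open>d \<in> cls c\<close> by (auto simp: r_coset_def)
    have "k \<in> carrier G" using k subgroup.subset[OF K_subgroup] by blast
    then have d: "d \<in> carrier G" using k c keys_add[of k c] by auto
    have "?A d - ?A c = ?A k" by (simp add: k frag_extend_add)
    then show ?thesis using cls_eq_iff[OF A[OF d] A[OF c]] A_K[OF k(1)] by simp
  qed
  have ne: "c \<in> cls c" using group.rcos_self[OF group_free_Abelian_group c K_subgroup] .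
  have "r \<odot>\<^bsub>T\<^esub> cls c = (\<Union>d\<in>cls c. cls (?A d))"
    by (simp add: tensor_product_def Let_def)
  also have "\<dots> = cls (?A c)"
    using const ne by blast
  finally show "r \<odot>\<^bsub>T\<^esub> cls c = cls (?A c)" .
qed

lemma smult_pure:
  assumes "r \<in> carrier R" "q \<in> carrier Q" "m \<in> carrier M"
  shows "r \<odot>\<^bsub>T\<^esub> pure q m = pure (r \<odot>\<^bsub>Q\<^esub> q) m"
  using smult_cls(2)[OF assms(1), of "frag_of (q, m)"] assms(2,3) by (simp add: pure_def)

lemma additive_smult: "r \<in> carrier R \<Longrightarrow> additive_map T T (\<lambda>t. r \<odot>\<^bsub>T\<^esub> t)"
  unfolding additive_map_def
proof (intro conjI ballI Pi_I)
  assume r: "r \<in> carrier R"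
  fix x assume "x \<in> carrier T"
  then obtain c where c: "c \<in> carrier G" "x = cls c" by (auto simp: carrier_T)
  show "r \<odot>\<^bsub>T\<^esub> x \<in> carrier T" using smult_cls[OF r c(1)] c cls_closed by simp
  fix y assume "y \<in> carrier T"
  then obtain d where d: "d \<in> carrier G" "y = cls d" by (auto simp: carrier_T)
  have cd: "c + d \<in> carrier G" using c d keys_add[of c d] by auto
  show "r \<odot>\<^bsub>T\<^esub> (x \<oplus>\<^bsub>T\<^esub> y) = r \<odot>\<^bsub>T\<^esub> x \<oplus>\<^bsub>T\<^esub> r \<odot>\<^bsub>T\<^esub> y"
    unfolding c d cls_add[OF c(1) d(1), symmetric]
    using smult_cls[OF r cd] smult_cls[OF r c(1)] smult_cls[OF r d(1)] cls_add
    by (simp add: frag_extend_add del: carrier_free_Abelian_group_iff)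
qed

lemma T_left_module: "left_module R T"
proof (intro left_module.intro left_module_axioms.intro)
  show "ring R" by (rule Q.L.R.ring_axioms)
  show "abelian_group T" by (rule T_abelian_group)
  fix r x assume r: "r \<in> carrier R" and x: "x \<in> carrier T"
  show "r \<odot>\<^bsub>T\<^esub> x \<in> carrier T" using additive_closed[OF additive_smult[OF r] x] .
  show "r \<odot>\<^bsub>T\<^esub> (x \<oplus>\<^bsub>T\<^esub> y) = r \<odot>\<^bsub>T\<^esub> x \<oplus>\<^bsub>T\<^esub> r \<odot>\<^bsub>T\<^esub> y" if "y \<in> carrier T" for y
    using additive_add[OF additive_smult[OF r] x that] .
  fix s assume s: "s \<in> carrier R"
  have "additive_map T T (\<lambda>t. r \<odot>\<^bsub>T\<^esub> t \<oplus>\<^bsub>T\<^esub> s \<odot>\<^bsub>T\<^esub> t)"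
    unfolding additive_map_def
    using additive_closed[OF additive_smult[OF r]] additive_closed[OF additive_smult[OF s]]
      additive_add[OF additive_smult[OF r]] additive_add[OF additive_smult[OF s]]
    by (auto simp: T.a_ac)
  from additive_eqI[OF T_abelian_group additive_smult this _ x, of "r \<oplus>\<^bsub>R\<^esub> s"] r s
  show "(r \<oplus>\<^bsub>R\<^esub> s) \<odot>\<^bsub>T\<^esub> x = r \<odot>\<^bsub>T\<^esub> x \<oplus>\<^bsub>T\<^esub> s \<odot>\<^bsub>T\<^esub> x"
    by (simp add: smult_pure Q.L.smult_l_distr pure_add_left Q.L.smult_closed)
  have "additive_map T T (\<lambda>t. r \<odot>\<^bsub>T\<^esub> (s \<odot>\<^bsub>T\<^esub> t))"
    unfolding additive_map_def
    using additive_closed[OF additive_smult[OF r]] additive_closed[OF additive_smult[OF s]]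
      additive_add[OF additive_smult[OF r]] additive_add[OF additive_smult[OF s]]
    by auto
  from additive_eqI[OF T_abelian_group additive_smult this _ x, of "r \<otimes>\<^bsub>R\<^esub> s"] r s
  show "(r \<otimes>\<^bsub>R\<^esub> s) \<odot>\<^bsub>T\<^esub> x = r \<odot>\<^bsub>T\<^esub> (s \<odot>\<^bsub>T\<^esub> x)"
    by (simp add: smult_pure Q.L.smult_assoc Q.L.smult_closed)
next
  fix x assume x: "x \<in> carrier T"
  have "additive_map T T (\<lambda>t. t)" by (auto simp: additive_map_def)
  from additive_eqI[OF T_abelian_group additive_smult this _ x, of "\<one>\<^bsub>R\<^esub>"]
  show "\<one>\<^bsub>R\<^esub> \<odot>\<^bsub>T\<^esub> x = x"
    by (simp add: smult_pure Q.L.smult_one)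
qed

end

section \<open>The dual of a progenerator and finite presentation of the tensor product\<close>

lemma cring_ring_centre:
  assumes "ring L" shows "cring (ring_centre L)"
proof -
  interpret L: ring L by fact
  let ?Z = "carrier (ring_centre L)"
  have ZI: "z \<in> ?Z" if "z \<in> carrier L" "\<And>x. x \<in> carrier L \<Longrightarrow> z \<otimes>\<^bsub>L\<^esub> x = x \<otimes>\<^bsub>L\<^esub> z" for z
    using that by (simp add: ring_centre_def)
  have ZL: "z \<in> carrier L" if "z \<in> ?Z" for z using that by (simp add: ring_centre_def)
  have comm: "z \<otimes>\<^bsub>L\<^esub> x = x \<otimes>\<^bsub>L\<^esub> z" if "z \<in> ?Z" "x \<in> carrier L" for z x
    using that by (simp add: ring_centre_def)
  have ops: "a \<oplus>\<^bsub>ring_centre L\<^esub> b = a \<oplus>\<^bsub>L\<^esub> b" "a \<otimes>\<^bsub>ring_centre L\<^esub> b = a \<otimes>\<^bsub>L\<^esub> b"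
    "\<zero>\<^bsub>ring_centre L\<^esub> = \<zero>\<^bsub>L\<^esub>" "\<one>\<^bsub>ring_centre L\<^esub> = \<one>\<^bsub>L\<^esub>" for a b
    by (simp_all add: ring_centre_def)
  have mult: "a \<otimes>\<^bsub>L\<^esub> b \<in> ?Z" if ab: "a \<in> ?Z" "b \<in> ?Z" for a b
  proof (rule ZI)
    fix x assume x: "x \<in> carrier L"
    have "a \<otimes>\<^bsub>L\<^esub> b \<otimes>\<^bsub>L\<^esub> x = a \<otimes>\<^bsub>L\<^esub> (x \<otimes>\<^bsub>L\<^esub> b)"
      unfolding comm[OF ab(2) x, symmetric] using x ab[THEN ZL] by (rule L.m_assoc[rotated 2])
    also have "\<dots> = a \<otimes>\<^bsub>L\<^esub> x \<otimes>\<^bsub>L\<^esub> b" using x ab[THEN ZL] by (simp add: L.m_assoc)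
    also have "\<dots> = x \<otimes>\<^bsub>L\<^esub> (a \<otimes>\<^bsub>L\<^esub> b)"
      unfolding comm[OF ab(1) x] using x ab[THEN ZL] by (simp add: L.m_assoc)
    finally show "a \<otimes>\<^bsub>L\<^esub> b \<otimes>\<^bsub>L\<^esub> x = x \<otimes>\<^bsub>L\<^esub> (a \<otimes>\<^bsub>L\<^esub> b)" .
  qed (use ab[THEN ZL] in simp)
  have add: "a \<oplus>\<^bsub>L\<^esub> b \<in> ?Z" if "a \<in> ?Z" "b \<in> ?Z" for a b
    using that[THEN ZL] comm[OF that(1)] comm[OF that(2)] by (intro ZI) (auto simp: L.l_distr L.r_distr)
  have neg: "\<ominus>\<^bsub>L\<^esub> a \<in> ?Z" if "a \<in> ?Z" for a
    using ZL[OF that] comm[OF that] by (intro ZI) (auto simp: L.l_minus L.r_minus)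
  have zero: "\<zero>\<^bsub>L\<^esub> \<in> ?Z" and one: "\<one>\<^bsub>L\<^esub> \<in> ?Z" by (auto intro: ZI)
  show ?thesis
  proof (rule cringI)
    show "abelian_group (ring_centre L)"
    proof (rule abelian_groupI)
      fix x assume x: "x \<in> ?Z"
      show "\<exists>y\<in>?Z. y \<oplus>\<^bsub>ring_centre L\<^esub> x = \<zero>\<^bsub>ring_centre L\<^esub>"
        using neg[OF x] L.l_neg[OF ZL[OF x]] by (auto simp: ops)
    qed (use ZL add zero in \<open>simp_all add: ops L.a_ac\<close>)
    show "comm_monoid (ring_centre L)"
    proof (rule comm_monoidI)
      show "x \<otimes>\<^bsub>ring_centre L\<^esub> y = y \<otimes>\<^bsub>ring_centre L\<^esub> x" if "x \<in> ?Z" "y \<in> ?Z" for x y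
        unfolding ops by (rule comm[OF that(1) ZL[OF that(2)]])
    qed (use ZL mult one in \<open>simp_all add: ops L.m_assoc\<close>)
  qed (use ZL in \<open>simp add: ops L.l_distr\<close>)
qed

lemma dual_bimodule_simps:
  "carrier (dual_bimodule R P) = right_hom R P (regular_bimodule R)"
  "\<zero>\<^bsub>dual_bimodule R P\<^esub> = (\<lambda>p\<in>carrier P. \<zero>\<^bsub>R\<^esub>)"
  "f \<oplus>\<^bsub>dual_bimodule R P\<^esub> g = (\<lambda>p\<in>carrier P. f p \<oplus>\<^bsub>R\<^esub> g p)"
  "r \<odot>\<^bsub>dual_bimodule R P\<^esub> f = (\<lambda>p\<in>carrier P. r \<otimes>\<^bsub>R\<^esub> f p)"
  "f \<bullet>\<^bsub>dual_bimodule R P\<^esub> l = (\<lambda>p\<in>carrier P. f (l \<odot>\<^bsub>P\<^esub> p))"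
  by (simp_all add: dual_bimodule_def)

lemma right_hom_regular_iff:
  "q \<in> right_hom R P (regular_bimodule R) \<longleftrightarrow> q \<in> carrier P \<rightarrow>\<^sub>E carrier R \<and>
    (\<forall>x\<in>carrier P. \<forall>y\<in>carrier P. q (x \<oplus>\<^bsub>P\<^esub> y) = q x \<oplus>\<^bsub>R\<^esub> q y) \<and>
    (\<forall>x\<in>carrier P. \<forall>r\<in>carrier R. q (x \<bullet>\<^bsub>P\<^esub> r) = q x \<otimes>\<^bsub>R\<^esub> r)"
  by (auto simp: right_hom_def)

lemma bimodule_dual_bimodule:
  fixes P :: "('l, 'p, 'r, 'z) bimodule_scheme"
  assumes "bimodule L R P" shows "bimodule R L (dual_bimodule R P)"
proof -
  interpret P: bimodule L R P by fact
  let ?D = "dual_bimodule R P"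
  have qc: "q x \<in> carrier R" if "q \<in> carrier ?D" "x \<in> carrier P" for q x
    using that by (auto simp: dual_bimodule_simps right_hom_regular_iff)
  have qadd: "q (x \<oplus>\<^bsub>P\<^esub> y) = q x \<oplus>\<^bsub>R\<^esub> q y" if "q \<in> carrier ?D" "x \<in> carrier P" "y \<in> carrier P" for q x y
    using that by (auto simp: dual_bimodule_simps right_hom_regular_iff)
  have qsm: "q (x \<bullet>\<^bsub>P\<^esub> r) = q x \<otimes>\<^bsub>R\<^esub> r" if "q \<in> carrier ?D" "x \<in> carrier P" "r \<in> carrier R" for q x r
    using that by (auto simp: dual_bimodule_simps right_hom_regular_iff)
  have qext: "q \<in> extensional (carrier P)" if "q \<in> carrier ?D" for q
    using that by (auto simp: dual_bimodule_simps right_hom_regular_iff PiE_def)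
  have intro: "(\<lambda>x\<in>carrier P. h x) \<in> carrier ?D" if "\<And>x. x \<in> carrier P \<Longrightarrow> h x \<in> carrier R"
    "\<And>x y. x \<in> carrier P \<Longrightarrow> y \<in> carrier P \<Longrightarrow> h (x \<oplus>\<^bsub>P\<^esub> y) = h x \<oplus>\<^bsub>R\<^esub> h y"
    "\<And>x r. x \<in> carrier P \<Longrightarrow> r \<in> carrier R \<Longrightarrow> h (x \<bullet>\<^bsub>P\<^esub> r) = h x \<otimes>\<^bsub>R\<^esub> r" for h
    using that P.R.rsmult_closed by (auto simp: dual_bimodule_simps right_hom_regular_iff)
  have eqI: "f = g" if "f \<in> extensional (carrier P)" "g \<in> extensional (carrier P)"
    "\<And>x. x \<in> carrier P \<Longrightarrow> f x = g x" for f g :: "'p \<Rightarrow> 'r"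
    using that by (rule extensionalityI)
  have sc: "r \<odot>\<^bsub>?D\<^esub> q \<in> carrier ?D" if "r \<in> carrier R" "q \<in> carrier ?D" for r q
    unfolding dual_bimodule_simps(4) using that
    by (intro intro) (auto simp: qc qadd qsm P.R.R.r_distr P.R.R.m_assoc)
  have rc: "q \<bullet>\<^bsub>?D\<^esub> l \<in> carrier ?D" if "l \<in> carrier L" "q \<in> carrier ?D" for l q
    unfolding dual_bimodule_simps(5) using that
    by (intro intro) (auto simp: qc qadd qsm P.L.smult_closed P.L.smult_r_distr P.smult_rsmult[symmetric])
  have ac: "q \<oplus>\<^bsub>?D\<^esub> q' \<in> carrier ?D" if "q \<in> carrier ?D" "q' \<in> carrier ?D" for q q'
    unfolding dual_bimodule_simps(3) using that
    by (intro intro) (auto simp: qc qadd qsm P.R.R.a_ac P.R.R.l_distr)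
  have zc: "\<zero>\<^bsub>?D\<^esub> \<in> carrier ?D"
    unfolding dual_bimodule_simps(2) by (intro intro) auto
  have nc: "(\<lambda>p\<in>carrier P. \<ominus>\<^bsub>R\<^esub> q p) \<in> carrier ?D" if "q \<in> carrier ?D" for q
    using that by (intro intro) (auto simp: qc qadd qsm P.R.R.minus_add P.R.R.l_minus)
  have D: "abelian_group ?D"
  proof (rule abelian_groupI)
    fix x assume x: "x \<in> carrier ?D"
    show "\<exists>y\<in>carrier ?D. y \<oplus>\<^bsub>?D\<^esub> x = \<zero>\<^bsub>?D\<^esub>"
      using nc[OF x] qc[OF x]
      by (intro bexI[of _ "\<lambda>p\<in>carrier P. \<ominus>\<^bsub>R\<^esub> x p"]) (auto simp: dual_bimodule_simps(2,3) P.R.R.l_neg)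
    show "\<zero>\<^bsub>?D\<^esub> \<oplus>\<^bsub>?D\<^esub> x = x"
      using qc[OF x] qext[OF x] by (intro eqI) (auto simp: dual_bimodule_simps(2,3))
  qed (use ac zc qc in \<open>auto simp: dual_bimodule_simps(3) P.R.R.a_ac intro!: restrict_ext\<close>)
  have left: "left_module R ?D"
  proof (intro left_module.intro left_module_axioms.intro)
    show "ring R" by (rule P.R.R.ring_axioms)
    show "abelian_group ?D" by (rule D)
    show "\<one>\<^bsub>R\<^esub> \<odot>\<^bsub>?D\<^esub> x = x" if "x \<in> carrier ?D" for x
      using qc[OF that] qext[OF that] by (intro eqI) (auto simp: dual_bimodule_simps(4))
  qed (use sc qc in \<open>auto simp: dual_bimodule_simps(3,4) P.R.R.l_distr P.R.R.r_distr P.R.R.m_assoc intro!: restrict_ext\<close>)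
  have right: "right_module L ?D"
  proof (intro right_module.intro right_module_axioms.intro)
    show "ring L" by (rule P.L.R.ring_axioms)
    show "abelian_group ?D" by (rule D)
    show "x \<bullet>\<^bsub>?D\<^esub> \<one>\<^bsub>L\<^esub> = x" if "x \<in> carrier ?D" for x
      using qc[OF that] qext[OF that] P.L.smult_one by (intro eqI) (auto simp: dual_bimodule_simps(5))
  qed (use rc qc qadd P.L.smult_closed in \<open>auto simp: dual_bimodule_simps(3,5) P.L.smult_l_distr P.L.smult_assoc intro!: restrict_ext\<close>)
  show ?thesis
    using left right P.L.smult_closed
    by (auto simp: bimodule_def bimodule_axioms_def dual_bimodule_simps(4,5) intro!: restrict_ext)
qed

lemma (in abelian_monoid) finsum_Plus:
  assumes "finite A" "finite B" "\<And>a. a \<in> A \<Longrightarrow> f (Inl a) \<in> carrier G" "\<And>b. b \<in> B \<Longrightarrow> f (Inr b) \<in> carrier G"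
  shows "(\<Oplus>z\<in>A <+> B. f z) = (\<Oplus>a\<in>A. f (Inl a)) \<oplus> (\<Oplus>b\<in>B. f (Inr b))"
proof -
  have "(\<Oplus>z\<in>A <+> B. f z) = (\<Oplus>z\<in>Inl ` A. f z) \<oplus> (\<Oplus>z\<in>Inr ` B. f z)"
    unfolding Plus_def using assms by (intro finsum_Un_disjoint) auto
  also have "(\<Oplus>z\<in>Inl ` A. f z) = (\<Oplus>a\<in>A. f (Inl a))"
    using assms by (intro finsum_reindex) auto
  also have "(\<Oplus>z\<in>Inr ` B. f z) = (\<Oplus>b\<in>B. f (Inr b))"
    using assms by (intro finsum_reindex) auto
  finally show ?thesis .
qed

lemma abelian_group_quotient:
  fixes A :: "('a, 'x) ring_scheme"
  assumes A: "abelian_group A" and U: "subgroup U (add_monoid A)"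
  obtains N :: "'a set ring" and \<kappa> where "abelian_group N" "additive_map A N \<kappa>"
    "\<And>x. x \<in> carrier A \<Longrightarrow> \<kappa> x = \<zero>\<^bsub>N\<^esub> \<longleftrightarrow> x \<in> U"
proof -
  interpret A: abelian_group A by fact
  let ?Q = "add_monoid A Mod U"
  let ?N = "\<lparr>carrier = carrier ?Q, monoid.mult = undefined, monoid.one = undefined,
    ring.zero = \<one>\<^bsub>?Q\<^esub>, ring.add = (\<otimes>\<^bsub>?Q\<^esub>)\<rparr> :: 'a set ring"
  let ?\<kappa> = "\<lambda>x. U #>\<^bsub>add_monoid A\<^esub> x"
  interpret Q: comm_group ?Q
    by (rule comm_group.abelian_FactGroup[OF A.a_comm_group U])
  have "abelian_group ?N"
    by (rule abelian_groupI)
       (auto simp: Q.m_ac simp del: one_FactGroup mult_FactGroup intro: Q.l_inv_ex)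
  moreover have "U \<lhd> add_monoid A"
    using comm_group.normal_iff_subgroup[OF A.a_comm_group] U by blast
  then have "additive_map A ?N ?\<kappa>"
    using normal.r_coset_hom_Mod[of U "add_monoid A"] by (auto simp: additive_map_def hom_def)
  moreover have "?\<kappa> x = \<zero>\<^bsub>?N\<^esub> \<longleftrightarrow> x \<in> U" if "x \<in> carrier A" for x
    using that group.coset_join1[OF A.a_group _ _ U, of x] group.coset_join2[OF A.a_group _ U, of x] by auto
  ultimately show thesis by (rule that)
qed

text \<open>
If the $e_i$ generate \<open>M\<close>, then $q \otimes \sum_i \nu_i e_i$ has the coordinates
$q(\nu_i a_j)$ with respect to the $b_j \otimes e_i$. They depend on the choice of the $\nu_i$, but only up to the relations of the second
kind below, so they define a map from the tensor product to the quotient of the free module by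
all relations. Up to relations of the first kind it takes $b_j \otimes e_i$ to the
corresponding basis vector; hence a combination of the generators that vanishes in the tensor product
is a combination of relations.
\<close>

lemma finitely_presented_dual_tensor:
  fixes P :: "('l, 'p, 'r, 'z) bimodule_scheme"
  assumes P: "bimodule L R P" and prog: "right_progenerator R P"
    and M: "left_module L M" and fp: "finitely_presented L M"
  shows "finitely_presented R (tensor_product L (dual_bimodule R P) M)"
proof -
  let ?D = "dual_bimodule R P"
  interpret P: bimodule L R P by fact
  interpret M: left_module L M by fact
  interpret D: bimodule R L ?D by (rule bimodule_dual_bimodule[OF P])
  interpret tensor R L ?D M by unfold_locales
  interpret TM: left_module R T by (rule T_left_module)
  have R: "ring R" by (rule P.R.R.ring_axioms)
  obtain F :: "'p set" and a b where F: "finite F" "F \<noteq> {}" and a: "\<And>j. j \<in> F \<Longrightarrow> a j \<in> carrier P"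
    and b': "\<And>j. j \<in> F \<Longrightarrow> b j \<in> right_hom R P (regular_bimodule R)"
    and ab: "\<And>p. p \<in> carrier P \<Longrightarrow> p = (\<Oplus>\<^bsub>P\<^esub>j\<in>F. a j \<bullet>\<^bsub>P\<^esub> b j p)"
    by (rule right_progenerator_dual_basis[OF prog]) (rule that)
  have b: "b j \<in> carrier ?D" if "j \<in> F" for j using b'[OF that] by (simp add: dual_bimodule_simps)
  obtain c n h \<pi> where pres: "finite_presentation L M c n h \<pi>" using fp by (auto simp: finitely_presented_def)
  then have cn: "0 < c" "0 < n" by (auto simp: finite_presentation_def Let_def)
  obtain e rel where "presents L M n e c rel"
    using presents_of_finite_presentation[OF P.L.R.ring_axioms M pres] by blast
  then have e: "\<And>i. i < n \<Longrightarrow> e i \<in> carrier M"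
    and span: "\<And>m. m \<in> carrier M \<Longrightarrow> \<exists>s. (\<forall>j<n. s j \<in> carrier L) \<and> m = (\<Oplus>\<^bsub>M\<^esub>j\<in>{..<n}. s j \<odot>\<^bsub>M\<^esub> e j)"
    and rel: "\<And>l. l < c \<Longrightarrow> relation L M n e (rel l)"
    and relgen: "\<And>s. relation L M n e s \<Longrightarrow> \<exists>\<mu>. (\<forall>l<c. \<mu> l \<in> carrier L) \<and>
      (\<forall>i<n. s i = (\<Oplus>\<^bsub>L\<^esub>l\<in>{..<c}. \<mu> l \<otimes>\<^bsub>L\<^esub> rel l i))"
    unfolding presents_def spans_def by blast+
  have relc: "rel l i \<in> carrier L" if "l < c" "i < n" for l i using rel[OF that(1)] that by (auto simp: relation_def)
  have q_hom: "q \<in> right_hom R P (regular_bimodule R)" if "q \<in> carrier ?D" for q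
    using that by (simp add: dual_bimodule_simps)
  have qR: "additive_map P R q" if "q \<in> carrier ?D" for q
    using right_hom_additive[OF q_hom[OF that]] by (simp add: additive_map_def)
  have qc: "q x \<in> carrier R" if "q \<in> carrier ?D" "x \<in> carrier P" for q x
    using additive_closed[OF qR] that by blast
  have q_sum: "q (\<Oplus>\<^bsub>P\<^esub>i\<in>I. u i) = (\<Oplus>\<^bsub>R\<^esub>i\<in>I. q (u i))" if "q \<in> carrier ?D" "\<And>i. i \<in> I \<Longrightarrow> u i \<in> carrier P"
    for q I and u :: "'i \<Rightarrow> 'p"
    using additive_finsum[OF P.L.M.abelian_group_axioms P.R.R.abelian_group_axioms qR[OF that(1)], of I u] that(2) .
  \<comment> \<open>evaluating at the dual basis expands every functional\<close>
  have q_expand: "q x = (\<Oplus>\<^bsub>R\<^esub>j\<in>F. q (a j) \<otimes>\<^bsub>R\<^esub> b j x)" if q: "q \<in> carrier ?D" and x: "x \<in> carrier P" for q x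
  proof -
    have "q x = q (\<Oplus>\<^bsub>P\<^esub>j\<in>F. a j \<bullet>\<^bsub>P\<^esub> b j x)" using ab[OF x] by simp
    also have "\<dots> = (\<Oplus>\<^bsub>R\<^esub>j\<in>F. q (a j \<bullet>\<^bsub>P\<^esub> b j x))"
      using q a b x qc by (intro q_sum) (auto intro!: P.R.rsmult_closed)
    also have "\<dots> = (\<Oplus>\<^bsub>R\<^esub>j\<in>F. q (a j) \<otimes>\<^bsub>R\<^esub> b j x)"
      using right_hom_rsmult[OF q_hom[OF q]] a b qc x q by (intro P.R.R.finsum_cong' refl) auto
    finally show ?thesis .
  qed
  have D_sum: "(\<Oplus>\<^bsub>?D\<^esub>i\<in>I. u i) x = (\<Oplus>\<^bsub>R\<^esub>i\<in>I. u i x)"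
    if "\<And>i. i \<in> I \<Longrightarrow> u i \<in> carrier ?D" "x \<in> carrier P" for I and u :: "'i \<Rightarrow> _" and x
  proof -
    have "additive_map ?D R (\<lambda>q. q x)" using that qc by (auto simp: additive_map_def dual_bimodule_simps(3))
    then show ?thesis
      by (rule additive_finsum[OF D.L.M.abelian_group_axioms P.R.R.abelian_group_axioms]) (rule that(1))
  qed
  have pure_expand: "pure q m = (\<Oplus>\<^bsub>T\<^esub>j\<in>F. q (a j) \<odot>\<^bsub>T\<^esub> pure (b j) m)"
    if q: "q \<in> carrier ?D" and m: "m \<in> carrier M" for q m
  proof -
    have sb: "q (a j) \<odot>\<^bsub>?D\<^esub> b j \<in> carrier ?D" if "j \<in> F" for j
      using that q a b qc by (intro D.L.smult_closed) auto
    have "q = (\<Oplus>\<^bsub>?D\<^esub>j\<in>F. q (a j) \<odot>\<^bsub>?D\<^esub> b j)"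
    proof (rule extensionalityI)
      show "q \<in> extensional (carrier P)" using q by (auto simp: dual_bimodule_simps right_hom_def PiE_def)
      have "(\<Oplus>\<^bsub>?D\<^esub>j\<in>F. q (a j) \<odot>\<^bsub>?D\<^esub> b j) \<in> carrier ?D" using sb by (intro D.L.M.finsum_closed) auto
      then show "(\<Oplus>\<^bsub>?D\<^esub>j\<in>F. q (a j) \<odot>\<^bsub>?D\<^esub> b j) \<in> extensional (carrier P)"
        by (auto simp: dual_bimodule_simps right_hom_def PiE_def)
      fix x assume x: "x \<in> carrier P"
      have "(\<Oplus>\<^bsub>?D\<^esub>j\<in>F. q (a j) \<odot>\<^bsub>?D\<^esub> b j) x = (\<Oplus>\<^bsub>R\<^esub>j\<in>F. (q (a j) \<odot>\<^bsub>?D\<^esub> b j) x)"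
        using sb x by (rule D_sum)
      also have "\<dots> = (\<Oplus>\<^bsub>R\<^esub>j\<in>F. q (a j) \<otimes>\<^bsub>R\<^esub> b j x)"
        using x q a b qc by (intro P.R.R.finsum_cong' refl) (auto simp: dual_bimodule_simps(4))
      finally show "q x = (\<Oplus>\<^bsub>?D\<^esub>j\<in>F. q (a j) \<odot>\<^bsub>?D\<^esub> b j) x" using q_expand[OF q x] by simp
    qed
    then have "pure q m = pure (\<Oplus>\<^bsub>?D\<^esub>j\<in>F. q (a j) \<odot>\<^bsub>?D\<^esub> b j) m" by simp
    also have "\<dots> = (\<Oplus>\<^bsub>T\<^esub>j\<in>F. pure (q (a j) \<odot>\<^bsub>?D\<^esub> b j) m)"
    proof (rule additive_finsum[OF D.L.M.abelian_group_axioms T_abelian_group _ sb, where h = "\<lambda>q. pure q m"])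
      show "additive_map ?D T (\<lambda>q. pure q m)" using m pure_closed pure_add_left by (auto simp: additive_map_def)
    qed
    also have "\<dots> = (\<Oplus>\<^bsub>T\<^esub>j\<in>F. q (a j) \<odot>\<^bsub>T\<^esub> pure (b j) m)"
      using q a b qc m pure_closed
      by (intro T.finsum_cong' refl) (auto simp: smult_pure intro!: TM.smult_closed)
    finally show ?thesis .
  qed
  let ?I = "{..<n} \<times> F"
  let ?E = "\<lambda>z. pure (b (snd z)) (e (fst z))"
  \<comment> \<open>coordinates of $q \otimes \sum_i \nu_i e_i$ with respect to the $b_j \otimes e_i$\<close>
  define vec where "vec q \<nu> = (\<lambda>z\<in>?I. q (\<nu> (fst z) \<odot>\<^bsub>P\<^esub> a (snd z)))" for q :: "'p \<Rightarrow> 'r" and \<nu> :: "nat \<Rightarrow> 'l"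
  have E: "?E z \<in> carrier T" if "z \<in> ?I" for z using that b e pure_closed by auto
  have finI: "finite ?I" using F by simp
  have \<nu>a: "\<nu> i \<odot>\<^bsub>P\<^esub> a j \<in> carrier P" if "\<forall>i<n. \<nu> i \<in> carrier L" "i < n" "j \<in> F" for \<nu> i j
    using that a by (intro P.L.smult_closed) auto
  have vecR: "vec q \<nu> z \<in> carrier R" if "q \<in> carrier ?D" "\<forall>i<n. \<nu> i \<in> carrier L" "z \<in> ?I" for q \<nu> z
    using that qc \<nu>a by (auto simp: vec_def)
  have pure_vec: "pure q (\<Oplus>\<^bsub>M\<^esub>i\<in>{..<n}. \<nu> i \<odot>\<^bsub>M\<^esub> e i) = (\<Oplus>\<^bsub>T\<^esub>z\<in>?I. vec q \<nu> z \<odot>\<^bsub>T\<^esub> ?E z)"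
    if q: "q \<in> carrier ?D" and \<nu>: "\<forall>i<n. \<nu> i \<in> carrier L" for q \<nu>
  proof -
    have \<nu>e: "\<nu> i \<odot>\<^bsub>M\<^esub> e i \<in> carrier M" if "i < n" for i using that \<nu> e by (intro M.smult_closed) auto
    have q\<nu>: "q \<bullet>\<^bsub>?D\<^esub> \<nu> i \<in> carrier ?D" if "i < n" for i using that \<nu> q by (intro D.R.rsmult_closed) auto
    have "pure q (\<Oplus>\<^bsub>M\<^esub>i\<in>{..<n}. \<nu> i \<odot>\<^bsub>M\<^esub> e i) = (\<Oplus>\<^bsub>T\<^esub>i\<in>{..<n}. pure q (\<nu> i \<odot>\<^bsub>M\<^esub> e i))"
    proof (rule additive_finsum[OF M.M.abelian_group_axioms T_abelian_group])
      show "additive_map M T (pure q)" using q pure_closed pure_add_right by (auto simp: additive_map_def)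
    qed (use \<nu>e in auto)
    also have "\<dots> = (\<Oplus>\<^bsub>T\<^esub>i\<in>{..<n}. \<Oplus>\<^bsub>T\<^esub>j\<in>F. vec q \<nu> (i, j) \<odot>\<^bsub>T\<^esub> ?E (i, j))"
    proof (intro T.finsum_cong' refl)
      fix i assume i: "i \<in> {..<n}"
      have "pure q (\<nu> i \<odot>\<^bsub>M\<^esub> e i) = pure (q \<bullet>\<^bsub>?D\<^esub> \<nu> i) (e i)"
        using i q \<nu> e by (simp add: pure_balanced)
      also have "\<dots> = (\<Oplus>\<^bsub>T\<^esub>j\<in>F. (q \<bullet>\<^bsub>?D\<^esub> \<nu> i) (a j) \<odot>\<^bsub>T\<^esub> pure (b j) (e i))"
        using i q\<nu> e by (intro pure_expand) auto
      also have "\<dots> = (\<Oplus>\<^bsub>T\<^esub>j\<in>F. vec q \<nu> (i, j) \<odot>\<^bsub>T\<^esub> ?E (i, j))"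
        using i a E vecR[OF q \<nu>]
        by (intro T.finsum_cong' refl) (auto simp: dual_bimodule_simps(5) vec_def intro!: TM.smult_closed)
      finally show "pure q (\<nu> i \<odot>\<^bsub>M\<^esub> e i) = \<dots>" .
    qed (use E vecR[OF q \<nu>] in \<open>auto intro!: T.finsum_closed TM.smult_closed\<close>)
    also have "\<dots> = (\<Oplus>\<^bsub>T\<^esub>z\<in>?I. vec q \<nu> (fst z, snd z) \<odot>\<^bsub>T\<^esub> ?E (fst z, snd z))"
      using F E vecR[OF q \<nu>] by (intro T.finsum_Times[symmetric]) (auto intro!: TM.smult_closed)
    finally show ?thesis by simp
  qed
  have comb_diff: "(\<Oplus>\<^bsub>T\<^esub>z\<in>?I. (s z \<ominus>\<^bsub>R\<^esub> s' z) \<odot>\<^bsub>T\<^esub> ?E z) =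
      (\<Oplus>\<^bsub>T\<^esub>z\<in>?I. s z \<odot>\<^bsub>T\<^esub> ?E z) \<ominus>\<^bsub>T\<^esub> (\<Oplus>\<^bsub>T\<^esub>z\<in>?I. s' z \<odot>\<^bsub>T\<^esub> ?E z)"
    if s: "\<forall>z\<in>?I. s z \<in> carrier R" and s': "\<forall>z\<in>?I. s' z \<in> carrier R" for s s'
  proof -
    have "(\<Oplus>\<^bsub>T\<^esub>z\<in>?I. (s z \<ominus>\<^bsub>R\<^esub> s' z) \<odot>\<^bsub>T\<^esub> ?E z) \<oplus>\<^bsub>T\<^esub> (\<Oplus>\<^bsub>T\<^esub>z\<in>?I. s' z \<odot>\<^bsub>T\<^esub> ?E z) =
        (\<Oplus>\<^bsub>T\<^esub>z\<in>?I. (s z \<ominus>\<^bsub>R\<^esub> s' z) \<odot>\<^bsub>T\<^esub> ?E z \<oplus>\<^bsub>T\<^esub> s' z \<odot>\<^bsub>T\<^esub> ?E z)"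
      using s s' E by (intro T.finsum_addf[symmetric]) (auto intro!: TM.smult_closed)
    also have "\<dots> = (\<Oplus>\<^bsub>T\<^esub>z\<in>?I. s z \<odot>\<^bsub>T\<^esub> ?E z)"
    proof (intro T.finsum_cong' refl)
      fix z assume z: "z \<in> ?I"
      have "(s z \<ominus>\<^bsub>R\<^esub> s' z) \<odot>\<^bsub>T\<^esub> ?E z \<oplus>\<^bsub>T\<^esub> s' z \<odot>\<^bsub>T\<^esub> ?E z = ((s z \<ominus>\<^bsub>R\<^esub> s' z) \<oplus>\<^bsub>R\<^esub> s' z) \<odot>\<^bsub>T\<^esub> ?E z"
        using z s s' E[OF z] by (intro TM.smult_l_distr[symmetric]) auto
      also have "(s z \<ominus>\<^bsub>R\<^esub> s' z) \<oplus>\<^bsub>R\<^esub> s' z = s z"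
        using s[rule_format, OF z] s'[rule_format, OF z] by (simp add: a_minus_def P.R.R.a_assoc P.R.R.l_neg)
      finally show "(s z \<ominus>\<^bsub>R\<^esub> s' z) \<odot>\<^bsub>T\<^esub> ?E z \<oplus>\<^bsub>T\<^esub> s' z \<odot>\<^bsub>T\<^esub> ?E z = s z \<odot>\<^bsub>T\<^esub> ?E z" .
    qed (use s E in \<open>auto intro!: TM.smult_closed\<close>)
    finally have eq: "(\<Oplus>\<^bsub>T\<^esub>z\<in>?I. (s z \<ominus>\<^bsub>R\<^esub> s' z) \<odot>\<^bsub>T\<^esub> ?E z) \<oplus>\<^bsub>T\<^esub> (\<Oplus>\<^bsub>T\<^esub>z\<in>?I. s' z \<odot>\<^bsub>T\<^esub> ?E z) = \<dots>" .
    have cl: "(\<Oplus>\<^bsub>T\<^esub>z\<in>?I. (s z \<ominus>\<^bsub>R\<^esub> s' z) \<odot>\<^bsub>T\<^esub> ?E z) \<in> carrier T"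
      "(\<Oplus>\<^bsub>T\<^esub>z\<in>?I. s z \<odot>\<^bsub>T\<^esub> ?E z) \<in> carrier T" "(\<Oplus>\<^bsub>T\<^esub>z\<in>?I. s' z \<odot>\<^bsub>T\<^esub> ?E z) \<in> carrier T"
      using s s' E by (auto intro!: T.finsum_closed TM.smult_closed)
    show ?thesis
      by (rule T.minus_eq_iff[OF cl(2,3,1), THEN iffD2, OF eq[symmetric], symmetric])
  qed
  have gen: "\<exists>s. (\<forall>z\<in>?I. s z \<in> carrier R) \<and> t = (\<Oplus>\<^bsub>T\<^esub>z\<in>?I. s z \<odot>\<^bsub>T\<^esub> ?E z)" if "t \<in> carrier T" for t
    using that
  proof (induction t rule: T_induct)
    case zero
    have "(\<Oplus>\<^bsub>T\<^esub>z\<in>?I. \<zero>\<^bsub>R\<^esub> \<odot>\<^bsub>T\<^esub> ?E z) = (\<Oplus>\<^bsub>T\<^esub>z\<in>?I. \<zero>\<^bsub>T\<^esub>)"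
      using E by (intro T.finsum_cong' refl) (auto simp: TM.smult_zero_left)
    then show ?case by (intro exI[of _ "\<lambda>_. \<zero>\<^bsub>R\<^esub>"]) simp
  next
    case (diff x y)
    then obtain s s' where s: "\<forall>z\<in>?I. s z \<in> carrier R" "x = (\<Oplus>\<^bsub>T\<^esub>z\<in>?I. s z \<odot>\<^bsub>T\<^esub> ?E z)"
      and s': "\<forall>z\<in>?I. s' z \<in> carrier R" "y = (\<Oplus>\<^bsub>T\<^esub>z\<in>?I. s' z \<odot>\<^bsub>T\<^esub> ?E z)" by blast
    then have "x \<ominus>\<^bsub>T\<^esub> y = (\<Oplus>\<^bsub>T\<^esub>z\<in>?I. (s z \<ominus>\<^bsub>R\<^esub> s' z) \<odot>\<^bsub>T\<^esub> ?E z)"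
      by (simp add: comb_diff)
    then show ?case using s s' by (intro exI[of _ "\<lambda>z. s z \<ominus>\<^bsub>R\<^esub> s' z"]) auto
  next
    case (pure q m)
    then obtain \<nu> where \<nu>: "\<forall>j<n. \<nu> j \<in> carrier L" "m = (\<Oplus>\<^bsub>M\<^esub>j\<in>{..<n}. \<nu> j \<odot>\<^bsub>M\<^esub> e j)" using span by blast
    then show ?case using pure_vec[OF pure(1) \<nu>(1)] vecR[OF pure(1) \<nu>(1)] by (intro exI[of _ "vec q \<nu>"]) auto
  qed
  define unit where "unit i = (\<lambda>i'. if i' = i then \<one>\<^bsub>L\<^esub> else \<zero>\<^bsub>L\<^esub>)" for i :: nat
  have unit: "\<forall>i'<n. unit i i' \<in> carrier L" for i by (simp add: unit_def)
  have unit_sum: "(\<Oplus>\<^bsub>M\<^esub>i'\<in>{..<n}. unit i i' \<odot>\<^bsub>M\<^esub> e i') = e i" if i: "i < n" for i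
  proof -
    have "(\<Oplus>\<^bsub>M\<^esub>i'\<in>{..<n}. unit i i' \<odot>\<^bsub>M\<^esub> e i') = (\<Oplus>\<^bsub>M\<^esub>i'\<in>{..<n}. if i = i' then e i' else \<zero>\<^bsub>M\<^esub>)"
      using e by (intro M.M.finsum_cong' refl) (auto simp: unit_def M.smult_one M.smult_zero_left)
    also have "\<dots> = e i" using i e by (intro M.M.finsum_singleton) auto
    finally show ?thesis .
  qed
  \<comment> \<open>A relation of the first kind expands a generator in the dual basis; one of the second
    kind comes from a relation between the $e_i$ and a functional $b_k$.\<close>
  let ?J = "?I <+> ({..<c} \<times> F)"
  let ?rel = "case_sum (\<lambda>w z. (if z = w then \<one>\<^bsub>R\<^esub> else \<zero>\<^bsub>R\<^esub>) \<ominus>\<^bsub>R\<^esub> vec (b (snd w)) (unit (fst w)) z)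
      (\<lambda>w. vec (b (snd w)) (rel (fst w)))"
  have relL: "\<forall>i<n. rel l i \<in> carrier L" if "l < c" for l using relc that by simp
  have relR: "?rel y z \<in> carrier R" if "y \<in> ?J" "z \<in> ?I" for y z
    using that vecR[OF b unit] vecR[OF b relL] by auto
  have rel0: "(\<Oplus>\<^bsub>T\<^esub>z\<in>?I. ?rel y z \<odot>\<^bsub>T\<^esub> ?E z) = \<zero>\<^bsub>T\<^esub>" if "y \<in> ?J" for y
    using that
  proof (elim PlusE)
    fix w assume w: "w \<in> ?I" and y: "y = Inl w"
    let ?v = "vec (b (snd w)) (unit (fst w))" and ?d = "\<lambda>z. if z = w then \<one>\<^bsub>R\<^esub> else \<zero>\<^bsub>R\<^esub>"
    have v: "\<forall>z\<in>?I. ?v z \<in> carrier R" using w vecR[OF b unit] by auto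
    have "(\<Oplus>\<^bsub>T\<^esub>z\<in>?I. ?d z \<odot>\<^bsub>T\<^esub> ?E z) = (\<Oplus>\<^bsub>T\<^esub>z\<in>?I. if w = z then ?E z else \<zero>\<^bsub>T\<^esub>)"
      using E by (intro T.finsum_cong' refl) (auto simp: TM.smult_one TM.smult_zero_left)
    also have "\<dots> = ?E w" using w finI E by (intro T.finsum_singleton) auto
    also have "\<dots> = pure (b (snd w)) (\<Oplus>\<^bsub>M\<^esub>i'\<in>{..<n}. unit (fst w) i' \<odot>\<^bsub>M\<^esub> e i')"
      using w unit_sum by auto
    also have "\<dots> = (\<Oplus>\<^bsub>T\<^esub>z\<in>?I. ?v z \<odot>\<^bsub>T\<^esub> ?E z)" using w b unit by (intro pure_vec) auto
    finally have eq: "(\<Oplus>\<^bsub>T\<^esub>z\<in>?I. ?d z \<odot>\<^bsub>T\<^esub> ?E z) = (\<Oplus>\<^bsub>T\<^esub>z\<in>?I. ?v z \<odot>\<^bsub>T\<^esub> ?E z)" .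
    have cl: "(\<Oplus>\<^bsub>T\<^esub>z\<in>?I. ?v z \<odot>\<^bsub>T\<^esub> ?E z) \<in> carrier T"
      using v E by (auto intro!: T.finsum_closed TM.smult_closed)
    have "(\<Oplus>\<^bsub>T\<^esub>z\<in>?I. (?d z \<ominus>\<^bsub>R\<^esub> ?v z) \<odot>\<^bsub>T\<^esub> ?E z) =
        (\<Oplus>\<^bsub>T\<^esub>z\<in>?I. ?d z \<odot>\<^bsub>T\<^esub> ?E z) \<ominus>\<^bsub>T\<^esub> (\<Oplus>\<^bsub>T\<^esub>z\<in>?I. ?v z \<odot>\<^bsub>T\<^esub> ?E z)"
      using v by (intro comb_diff) auto
    also have "\<dots> = \<zero>\<^bsub>T\<^esub>" unfolding eq using cl by (simp add: a_minus_def T.r_neg)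
    finally show ?thesis by (simp add: y)
  next
    fix w assume w: "w \<in> {..<c} \<times> F" and y: "y = Inr w"
    have bw: "b (snd w) \<in> carrier ?D" using w b by auto
    have "(\<Oplus>\<^bsub>T\<^esub>z\<in>?I. vec (b (snd w)) (rel (fst w)) z \<odot>\<^bsub>T\<^esub> ?E z) =
        pure (b (snd w)) (\<Oplus>\<^bsub>M\<^esub>i\<in>{..<n}. rel (fst w) i \<odot>\<^bsub>M\<^esub> e i)"
      using w bw relL by (intro pure_vec[symmetric]) auto
    also have "\<dots> = pure (b (snd w)) \<zero>\<^bsub>M\<^esub>" using w rel by (auto simp: relation_def)
    also have "\<dots> = \<zero>\<^bsub>T\<^esub>"
    proof (rule additive_zero[OF M.M.abelian_group_axioms T_abelian_group])
      show "additive_map M T (pure (b (snd w)))" using bw pure_closed pure_add_right by (auto simp: additive_map_def)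
    qed
    finally show ?thesis by (simp add: y)
  qed
  have relgen': "\<exists>\<mu>. (\<forall>y\<in>?J. \<mu> y \<in> carrier R) \<and> (\<forall>z\<in>?I. s z = (\<Oplus>\<^bsub>R\<^esub>y\<in>?J. \<mu> y \<otimes>\<^bsub>R\<^esub> ?rel y z))"
    if s: "\<And>z. z \<in> ?I \<Longrightarrow> s z \<in> carrier R" and s0: "(\<Oplus>\<^bsub>T\<^esub>z\<in>?I. s z \<odot>\<^bsub>T\<^esub> ?E z) = \<zero>\<^bsub>T\<^esub>" for s
  proof -
    let ?F = "direct_sum_power ?I (regular_bimodule R)"
    let ?U = "{x \<in> carrier ?F. \<exists>\<mu>. (\<forall>y\<in>?J. \<mu> y \<in> carrier R) \<and>
      (\<forall>z\<in>?I. x z = (\<Oplus>\<^bsub>R\<^esub>y\<in>?J. \<mu> y \<otimes>\<^bsub>R\<^esub> ?rel y z))}"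
    interpret Fn: abelian_group ?F
      by (rule abelian_group_direct_sum_power[OF abelian_group_regular_bimodule[OF R]])
    have carrF: "carrier ?F = ?I \<rightarrow>\<^sub>E carrier R" using finI by (auto simp: direct_sum_power_def)
    have FR: "x z \<in> carrier R" if "x \<in> carrier ?F" "z \<in> ?I" for x z using that carrF by auto
    have F_add: "(x \<oplus>\<^bsub>?F\<^esub> y) z = x z \<oplus>\<^bsub>R\<^esub> y z" if "z \<in> ?I" for x y z
      using that by (simp add: direct_sum_power_def)
    have F_eqI: "x = y" if "x \<in> carrier ?F" "y \<in> carrier ?F" "\<And>z. z \<in> ?I \<Longrightarrow> x z = y z" for x y
      using that unfolding carrF by (intro PiE_ext[of x ?I "\<lambda>_. carrier R" y]) auto
    have F_eval: "additive_map ?F R (\<lambda>x. x z)" if "z \<in> ?I" for z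
      using that FR F_add by (auto simp: additive_map_def)
    have finJ: "finite ?J" using F by simp
    have \<mu>c: "\<mu> y \<otimes>\<^bsub>R\<^esub> ?rel y z \<in> carrier R" if "\<forall>y\<in>?J. \<mu> y \<in> carrier R" "y \<in> ?J" "z \<in> ?I" for \<mu> y z
      using that(1,2) relR[OF that(2,3)] by (intro P.R.R.m_closed) auto
    have U: "subgroup ?U (add_monoid ?F)"
    proof (rule Fn.add.subgroupI)
      show "?U \<subseteq> carrier ?F" by blast
      have "\<zero>\<^bsub>?F\<^esub> \<in> ?U"
      proof (intro CollectI conjI exI[of _ "\<lambda>_. \<zero>\<^bsub>R\<^esub>"] ballI)
        fix z assume z: "z \<in> ?I"
        have "(\<Oplus>\<^bsub>R\<^esub>y\<in>?J. \<zero>\<^bsub>R\<^esub> \<otimes>\<^bsub>R\<^esub> ?rel y z) = (\<Oplus>\<^bsub>R\<^esub>y\<in>?J. \<zero>\<^bsub>R\<^esub>)"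
          using relR[OF _ z] by (intro P.R.R.finsum_cong' refl) (auto simp del: sum.case)
        then show "\<zero>\<^bsub>?F\<^esub> z = (\<Oplus>\<^bsub>R\<^esub>y\<in>?J. \<zero>\<^bsub>R\<^esub> \<otimes>\<^bsub>R\<^esub> ?rel y z)"
          using z by (simp add: direct_sum_power_def)
      qed auto
      then show "?U \<noteq> {}" by blast
      fix x assume "x \<in> ?U"
      then obtain \<mu> where x: "x \<in> carrier ?F" and \<mu>: "\<forall>y\<in>?J. \<mu> y \<in> carrier R"
        "\<forall>z\<in>?I. x z = (\<Oplus>\<^bsub>R\<^esub>y\<in>?J. \<mu> y \<otimes>\<^bsub>R\<^esub> ?rel y z)" by blast
      show "\<ominus>\<^bsub>?F\<^esub> x \<in> ?U"
      proof (intro CollectI conjI exI[of _ "\<lambda>y. \<ominus>\<^bsub>R\<^esub> \<mu> y"] ballI)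
        fix z assume z: "z \<in> ?I"
        have "(\<ominus>\<^bsub>?F\<^esub> x) z = \<ominus>\<^bsub>R\<^esub> x z"
          using additive_minus[OF Fn.abelian_group_axioms P.R.R.abelian_group_axioms F_eval[OF z] x] .
        also have "\<dots> = (\<Oplus>\<^bsub>R\<^esub>y\<in>?J. \<ominus>\<^bsub>R\<^esub> (\<mu> y \<otimes>\<^bsub>R\<^esub> ?rel y z))"
        proof -
          have "additive_map R R (\<lambda>r. \<ominus>\<^bsub>R\<^esub> r)" by (auto simp: additive_map_def P.R.R.minus_add)
          then show ?thesis
            unfolding \<mu>(2)[rule_format, OF z]
            using \<mu>c[OF \<mu>(1) _ z] by (intro additive_finsum[OF P.R.R.abelian_group_axioms P.R.R.abelian_group_axioms])
        qed
        also have "\<dots> = (\<Oplus>\<^bsub>R\<^esub>y\<in>?J. (\<ominus>\<^bsub>R\<^esub> \<mu> y) \<otimes>\<^bsub>R\<^esub> ?rel y z)"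
          using \<mu>(1) relR[OF _ z] by (intro P.R.R.finsum_cong' refl) (auto simp: P.R.R.l_minus simp del: sum.case)
        finally show "(\<ominus>\<^bsub>?F\<^esub> x) z = (\<Oplus>\<^bsub>R\<^esub>y\<in>?J. (\<ominus>\<^bsub>R\<^esub> \<mu> y) \<otimes>\<^bsub>R\<^esub> ?rel y z)" .
      qed (use x \<mu> in auto)
      fix x' assume "x' \<in> ?U"
      then obtain \<mu>' where x': "x' \<in> carrier ?F" and \<mu>': "\<forall>y\<in>?J. \<mu>' y \<in> carrier R"
        "\<forall>z\<in>?I. x' z = (\<Oplus>\<^bsub>R\<^esub>y\<in>?J. \<mu>' y \<otimes>\<^bsub>R\<^esub> ?rel y z)" by blast
      show "x \<oplus>\<^bsub>?F\<^esub> x' \<in> ?U"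
      proof (intro CollectI conjI exI[of _ "\<lambda>y. \<mu> y \<oplus>\<^bsub>R\<^esub> \<mu>' y"] ballI)
        fix z assume z: "z \<in> ?I"
        have "(x \<oplus>\<^bsub>?F\<^esub> x') z = (\<Oplus>\<^bsub>R\<^esub>y\<in>?J. \<mu> y \<otimes>\<^bsub>R\<^esub> ?rel y z) \<oplus>\<^bsub>R\<^esub> (\<Oplus>\<^bsub>R\<^esub>y\<in>?J. \<mu>' y \<otimes>\<^bsub>R\<^esub> ?rel y z)"
          unfolding F_add[OF z] \<mu>(2)[rule_format, OF z] \<mu>'(2)[rule_format, OF z] ..
        also have "\<dots> = (\<Oplus>\<^bsub>R\<^esub>y\<in>?J. \<mu> y \<otimes>\<^bsub>R\<^esub> ?rel y z \<oplus>\<^bsub>R\<^esub> \<mu>' y \<otimes>\<^bsub>R\<^esub> ?rel y z)"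
          using \<mu>c[OF \<mu>(1) _ z] \<mu>c[OF \<mu>'(1) _ z] by (intro P.R.R.finsum_addf[symmetric] Pi_I)
        also have "\<dots> = (\<Oplus>\<^bsub>R\<^esub>y\<in>?J. (\<mu> y \<oplus>\<^bsub>R\<^esub> \<mu>' y) \<otimes>\<^bsub>R\<^esub> ?rel y z)"
          using \<mu>(1) \<mu>'(1) relR[OF _ z]
          by (intro P.R.R.finsum_cong' refl) (auto simp: P.R.R.l_distr simp del: sum.case)
        finally show "(x \<oplus>\<^bsub>?F\<^esub> x') z = (\<Oplus>\<^bsub>R\<^esub>y\<in>?J. (\<mu> y \<oplus>\<^bsub>R\<^esub> \<mu>' y) \<otimes>\<^bsub>R\<^esub> ?rel y z)" .
      qed (use x x' \<mu> \<mu>' in auto)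
    qed
    \<comment> \<open>The quotient of the free module by the span of the relations, as a group: the universal
      property of the tensor product only asks for an abelian group as target.\<close>
    obtain N :: "(nat \<times> 'p \<Rightarrow> 'r) set ring" and \<kappa> where N: "abelian_group N" and \<kappa>: "additive_map ?F N \<kappa>"
      and \<kappa>0: "\<And>x. x \<in> carrier ?F \<Longrightarrow> \<kappa> x = \<zero>\<^bsub>N\<^esub> \<longleftrightarrow> x \<in> ?U"
      by (rule abelian_group_quotient[OF Fn.abelian_group_axioms U]) (rule that)
    interpret N: abelian_group N by fact
    have vecF: "vec q \<nu> \<in> carrier ?F" if "q \<in> carrier ?D" "\<forall>i<n. \<nu> i \<in> carrier L" for q \<nu>
      unfolding carrF using vecR[OF that] by (auto simp: vec_def)
    have vec_U: "vec q \<nu> \<in> ?U" if q: "q \<in> carrier ?D" and r: "relation L M n e \<nu>" for q \<nu>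
    proof -
      have \<nu>: "\<forall>i<n. \<nu> i \<in> carrier L" using r by (simp add: relation_def)
      obtain \<mu> where \<mu>: "\<forall>l<c. \<mu> l \<in> carrier L"
        "\<forall>i<n. \<nu> i = (\<Oplus>\<^bsub>L\<^esub>l\<in>{..<c}. \<mu> l \<otimes>\<^bsub>L\<^esub> rel l i)" using relgen[OF r] by blast
      let ?m = "case_sum (\<lambda>_ :: nat \<times> 'p. \<zero>\<^bsub>R\<^esub>) (\<lambda>w. q (\<mu> (fst w) \<odot>\<^bsub>P\<^esub> a (snd w)))"
      have q\<mu>: "q (\<mu> l \<odot>\<^bsub>P\<^esub> a k) \<in> carrier R" if "l < c" "k \<in> F" for l k
        using that \<mu>(1) a q by (intro qc P.L.smult_closed) auto
      have "vec q \<nu> z = (\<Oplus>\<^bsub>R\<^esub>y\<in>?J. ?m y \<otimes>\<^bsub>R\<^esub> ?rel y z)" if z: "z \<in> ?I" for z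
      proof -
        obtain i j where ij: "z = (i, j)" "i < n" "j \<in> F" using z by auto
        have ra: "rel l i \<odot>\<^bsub>P\<^esub> a j \<in> carrier P" if "l < c" for l
          using that ij relc a by (intro P.L.smult_closed) auto
        have \<mu>ra: "\<mu> l \<odot>\<^bsub>P\<^esub> (rel l i \<odot>\<^bsub>P\<^esub> a j) \<in> carrier P" if "l < c" for l
          by (rule P.L.smult_closed[OF \<mu>(1)[rule_format, OF that] ra[OF that]])
        have vb: "vec (b k) (rel l) (i, j) \<in> carrier R" if "l < c" "k \<in> F" for l k
          using that ij vecR[OF b relL] by auto
        have "vec q \<nu> z = q ((\<Oplus>\<^bsub>L\<^esub>l\<in>{..<c}. \<mu> l \<otimes>\<^bsub>L\<^esub> rel l i) \<odot>\<^bsub>P\<^esub> a j)"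
          using ij \<mu>(2) by (simp add: vec_def)
        also have "(\<Oplus>\<^bsub>L\<^esub>l\<in>{..<c}. \<mu> l \<otimes>\<^bsub>L\<^esub> rel l i) \<odot>\<^bsub>P\<^esub> a j =
            (\<Oplus>\<^bsub>P\<^esub>l\<in>{..<c}. (\<mu> l \<otimes>\<^bsub>L\<^esub> rel l i) \<odot>\<^bsub>P\<^esub> a j)"
          using ij \<mu>(1) relc a by (intro P.L.smult_finsum_left) auto
        also have "\<dots> = (\<Oplus>\<^bsub>P\<^esub>l\<in>{..<c}. \<mu> l \<odot>\<^bsub>P\<^esub> (rel l i \<odot>\<^bsub>P\<^esub> a j))"
          using ij \<mu>(1) relc a \<mu>ra by (intro P.L.M.finsum_cong' refl) (auto simp: P.L.smult_assoc)
        also have "q \<dots> = (\<Oplus>\<^bsub>R\<^esub>l\<in>{..<c}. q (\<mu> l \<odot>\<^bsub>P\<^esub> (rel l i \<odot>\<^bsub>P\<^esub> a j)))"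
          using q \<mu>ra by (intro q_sum) auto
        also have "\<dots> = (\<Oplus>\<^bsub>R\<^esub>l\<in>{..<c}. \<Oplus>\<^bsub>R\<^esub>k\<in>F. q (\<mu> l \<odot>\<^bsub>P\<^esub> a k) \<otimes>\<^bsub>R\<^esub> vec (b k) (rel l) (i, j))"
        proof (intro P.R.R.finsum_cong' refl)
          fix l assume l: "l \<in> {..<c}"
          have q': "q \<bullet>\<^bsub>?D\<^esub> \<mu> l \<in> carrier ?D" using l q \<mu>(1) by (intro D.R.rsmult_closed) auto
          have "q (\<mu> l \<odot>\<^bsub>P\<^esub> (rel l i \<odot>\<^bsub>P\<^esub> a j)) = (q \<bullet>\<^bsub>?D\<^esub> \<mu> l) (rel l i \<odot>\<^bsub>P\<^esub> a j)"
            using l ra by (simp add: dual_bimodule_simps(5))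
          also have "\<dots> = (\<Oplus>\<^bsub>R\<^esub>k\<in>F. (q \<bullet>\<^bsub>?D\<^esub> \<mu> l) (a k) \<otimes>\<^bsub>R\<^esub> b k (rel l i \<odot>\<^bsub>P\<^esub> a j))"
            using l ra q' by (intro q_expand) auto
          also have "\<dots> = (\<Oplus>\<^bsub>R\<^esub>k\<in>F. q (\<mu> l \<odot>\<^bsub>P\<^esub> a k) \<otimes>\<^bsub>R\<^esub> vec (b k) (rel l) (i, j))"
            using l ij a q\<mu> vb by (intro P.R.R.finsum_cong' refl) (auto simp: dual_bimodule_simps(5) vec_def)
          finally show "q (\<mu> l \<odot>\<^bsub>P\<^esub> (rel l i \<odot>\<^bsub>P\<^esub> a j)) = \<dots>" .
        qed (use q\<mu> vb in \<open>auto intro!: P.R.R.finsum_closed\<close>)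
        also have "\<dots> = (\<Oplus>\<^bsub>R\<^esub>w\<in>{..<c} \<times> F. q (\<mu> (fst w) \<odot>\<^bsub>P\<^esub> a (snd w)) \<otimes>\<^bsub>R\<^esub> vec (b (snd w)) (rel (fst w)) (i, j))"
          using F q\<mu> vb by (intro P.R.R.finsum_Times[symmetric]) auto
        also have "\<dots> = (\<Oplus>\<^bsub>R\<^esub>w\<in>?I. ?m (Inl w) \<otimes>\<^bsub>R\<^esub> ?rel (Inl w) z) \<oplus>\<^bsub>R\<^esub>
            (\<Oplus>\<^bsub>R\<^esub>w\<in>{..<c} \<times> F. ?m (Inr w) \<otimes>\<^bsub>R\<^esub> ?rel (Inr w) z)"
        proof -
          have "(\<Oplus>\<^bsub>R\<^esub>w\<in>?I. ?m (Inl w) \<otimes>\<^bsub>R\<^esub> ?rel (Inl w) z) = (\<Oplus>\<^bsub>R\<^esub>w\<in>?I. \<zero>\<^bsub>R\<^esub>)"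
          proof (intro P.R.R.finsum_cong' refl)
            fix w assume "w \<in> ?I"
            then have "?rel (Inl w) z \<in> carrier R" using relR[OF _ z] by blast
            then show "?m (Inl w) \<otimes>\<^bsub>R\<^esub> ?rel (Inl w) z = \<zero>\<^bsub>R\<^esub>" by simp
          qed auto
          moreover have "(\<Oplus>\<^bsub>R\<^esub>w\<in>{..<c} \<times> F. q (\<mu> (fst w) \<odot>\<^bsub>P\<^esub> a (snd w)) \<otimes>\<^bsub>R\<^esub> vec (b (snd w)) (rel (fst w)) (i, j)) \<in> carrier R"
            using q\<mu> vb by (auto intro!: P.R.R.finsum_closed)
          ultimately show ?thesis using ij by simp
        qed
        also have "\<dots> = (\<Oplus>\<^bsub>R\<^esub>y\<in>?J. ?m y \<otimes>\<^bsub>R\<^esub> ?rel y z)"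
        proof (rule P.R.R.finsum_Plus[symmetric])
          fix w assume "w \<in> ?I"
          then have "?rel (Inl w) z \<in> carrier R" using relR[OF _ z] by blast
          then show "?m (Inl w) \<otimes>\<^bsub>R\<^esub> ?rel (Inl w) z \<in> carrier R" by simp
        next
          fix w assume "w \<in> {..<c} \<times> F"
          then show "?m (Inr w) \<otimes>\<^bsub>R\<^esub> ?rel (Inr w) z \<in> carrier R" using q\<mu> vb ij by auto
        qed (use F in auto)
        finally show ?thesis .
      qed
      moreover have "\<forall>y\<in>?J. ?m y \<in> carrier R" using q\<mu> by auto
      ultimately show ?thesis using vecF[OF q \<nu>] by blast
    qed
    let ?comb = "\<lambda>\<nu>. \<Oplus>\<^bsub>M\<^esub>i\<in>{..<n}. \<nu> i \<odot>\<^bsub>M\<^esub> e i"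
    have \<nu>e: "\<nu> i \<odot>\<^bsub>M\<^esub> e i \<in> carrier M" if "\<forall>i<n. \<nu> i \<in> carrier L" "i < n" for \<nu> i
      using that e by (intro M.smult_closed) auto
    have comb_cl: "?comb \<nu> \<in> carrier M" if "\<forall>i<n. \<nu> i \<in> carrier L" for \<nu>
      using \<nu>e[OF that] by (intro M.M.finsum_closed) auto
    have comb_add: "?comb (\<lambda>i. \<nu> i \<oplus>\<^bsub>L\<^esub> \<nu>' i) = ?comb \<nu> \<oplus>\<^bsub>M\<^esub> ?comb \<nu>'"
      if \<nu>: "\<forall>i<n. \<nu> i \<in> carrier L" and \<nu>': "\<forall>i<n. \<nu>' i \<in> carrier L" for \<nu> \<nu>'
    proof -
      have "?comb (\<lambda>i. \<nu> i \<oplus>\<^bsub>L\<^esub> \<nu>' i) = (\<Oplus>\<^bsub>M\<^esub>i\<in>{..<n}. \<nu> i \<odot>\<^bsub>M\<^esub> e i \<oplus>\<^bsub>M\<^esub> \<nu>' i \<odot>\<^bsub>M\<^esub> e i)"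
        using \<nu> \<nu>' e \<nu>e[OF \<nu>] \<nu>e[OF \<nu>'] by (intro M.M.finsum_cong' refl) (auto simp: M.smult_l_distr)
      also have "\<dots> = ?comb \<nu> \<oplus>\<^bsub>M\<^esub> ?comb \<nu>'"
        using \<nu>e[OF \<nu>] \<nu>e[OF \<nu>'] by (intro M.M.finsum_addf) auto
      finally show ?thesis .
    qed
    have vec_add: "vec q (\<lambda>i. \<nu> i \<oplus>\<^bsub>L\<^esub> \<nu>' i) = vec q \<nu> \<oplus>\<^bsub>?F\<^esub> vec q \<nu>'"
      if q: "q \<in> carrier ?D" and \<nu>: "\<forall>i<n. \<nu> i \<in> carrier L" and \<nu>': "\<forall>i<n. \<nu>' i \<in> carrier L" for q \<nu> \<nu>'
    proof (rule F_eqI)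
      show "vec q (\<lambda>i. \<nu> i \<oplus>\<^bsub>L\<^esub> \<nu>' i) \<in> carrier ?F" using \<nu> \<nu>' by (intro vecF[OF q]) auto
      show "vec q \<nu> \<oplus>\<^bsub>?F\<^esub> vec q \<nu>' \<in> carrier ?F" by (intro Fn.a_closed vecF q \<nu> \<nu>')
      fix z assume z: "z \<in> ?I"
      then show "vec q (\<lambda>i. \<nu> i \<oplus>\<^bsub>L\<^esub> \<nu>' i) z = (vec q \<nu> \<oplus>\<^bsub>?F\<^esub> vec q \<nu>') z"
        using \<nu> \<nu>' a \<nu>a[OF \<nu>] \<nu>a[OF \<nu>'] additive_add[OF qR[OF q]]
        by (auto simp: F_add[OF z] vec_def P.L.smult_l_distr)
    qed
    have \<kappa>_cong: "\<kappa> (vec q \<nu>) = \<kappa> (vec q \<nu>')"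
      if q: "q \<in> carrier ?D" and \<nu>: "\<forall>i<n. \<nu> i \<in> carrier L" and \<nu>': "\<forall>i<n. \<nu>' i \<in> carrier L"
        and eq: "?comb \<nu> = ?comb \<nu>'" for q \<nu> \<nu>'
    proof -
      let ?\<delta> = "\<lambda>i. \<nu> i \<ominus>\<^bsub>L\<^esub> \<nu>' i"
      have \<delta>: "\<forall>i<n. ?\<delta> i \<in> carrier L" using \<nu> \<nu>' by auto
      have sum: "?\<delta> i \<oplus>\<^bsub>L\<^esub> \<nu>' i = \<nu> i" if "i < n" for i
        using that \<nu> \<nu>' by (simp add: a_minus_def P.L.R.a_assoc P.L.R.l_neg)
      have "?comb ?\<delta> \<oplus>\<^bsub>M\<^esub> ?comb \<nu>' = ?comb (\<lambda>i. ?\<delta> i \<oplus>\<^bsub>L\<^esub> \<nu>' i)" using comb_add[OF \<delta> \<nu>'] by simp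
      also have "\<dots> = ?comb \<nu>" using sum \<nu>e[OF \<nu>] by (intro M.M.finsum_cong' refl) auto
      finally have "?comb ?\<delta> \<oplus>\<^bsub>M\<^esub> ?comb \<nu>' = ?comb \<nu>'" using eq by simp
      then have "?comb ?\<delta> = \<zero>\<^bsub>M\<^esub>" using comb_cl[OF \<delta>] comb_cl[OF \<nu>']
        by (metis M.M.add.l_cancel_one M.M.add.m_comm)
      then have "relation L M n e ?\<delta>" using \<delta> by (simp add: relation_def)
      then have "\<kappa> (vec q ?\<delta>) = \<zero>\<^bsub>N\<^esub>" using \<kappa>0[OF vecF[OF q \<delta>]] vec_U[OF q] by simp
      moreover have "vec q \<nu> = vec q (\<lambda>i. ?\<delta> i \<oplus>\<^bsub>L\<^esub> \<nu>' i)" using sum by (auto simp: vec_def)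
      ultimately show ?thesis
        using vec_add[OF q \<delta> \<nu>'] additive_add[OF \<kappa> vecF[OF q \<delta>] vecF[OF q \<nu>']]
          additive_closed[OF \<kappa> vecF[OF q \<nu>']] by simp
    qed
    have "\<forall>m. \<exists>\<nu>. m \<in> carrier M \<longrightarrow> (\<forall>i<n. \<nu> i \<in> carrier L) \<and> m = ?comb \<nu>" using span by blast
    then obtain \<Lambda> where \<Lambda>: "\<And>m. m \<in> carrier M \<Longrightarrow> \<forall>i<n. \<Lambda> m i \<in> carrier L"
      and \<Lambda>m: "\<And>m. m \<in> carrier M \<Longrightarrow> m = ?comb (\<Lambda> m)" by metis
    obtain h where h: "additive_map T N h"
      and h_pure: "\<And>q m. q \<in> carrier ?D \<Longrightarrow> m \<in> carrier M \<Longrightarrow> h (pure q m) = \<kappa> (vec q (\<Lambda> m))"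
    proof (rule universal_property[OF N, of "\<lambda>q m. \<kappa> (vec q (\<Lambda> m))"])
      show "\<kappa> (vec q (\<Lambda> m)) \<in> carrier N" if "q \<in> carrier ?D" "m \<in> carrier M" for q m
        using additive_closed[OF \<kappa> vecF[OF that(1) \<Lambda>[OF that(2)]]] .
      show "\<kappa> (vec (p \<oplus>\<^bsub>?D\<^esub> q) (\<Lambda> m)) = \<kappa> (vec p (\<Lambda> m)) \<oplus>\<^bsub>N\<^esub> \<kappa> (vec q (\<Lambda> m))"
        if "p \<in> carrier ?D" "q \<in> carrier ?D" "m \<in> carrier M" for p q m
      proof -
        have "vec (p \<oplus>\<^bsub>?D\<^esub> q) (\<Lambda> m) = vec p (\<Lambda> m) \<oplus>\<^bsub>?F\<^esub> vec q (\<Lambda> m)"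
        proof (rule F_eqI)
          show "vec (p \<oplus>\<^bsub>?D\<^esub> q) (\<Lambda> m) \<in> carrier ?F" "vec p (\<Lambda> m) \<oplus>\<^bsub>?F\<^esub> vec q (\<Lambda> m) \<in> carrier ?F"
            by (intro Fn.a_closed vecF D.L.M.a_closed that \<Lambda>)+
          show "vec (p \<oplus>\<^bsub>?D\<^esub> q) (\<Lambda> m) z = (vec p (\<Lambda> m) \<oplus>\<^bsub>?F\<^esub> vec q (\<Lambda> m)) z" if z: "z \<in> ?I" for z
            using z \<nu>a[OF \<Lambda>[OF \<open>m \<in> carrier M\<close>]] by (auto simp: F_add[OF z] vec_def dual_bimodule_simps(3))
        qed
        then show ?thesis using additive_add[OF \<kappa> vecF vecF, OF that(1) \<Lambda> that(2) \<Lambda>, OF that(3) that(3)] by simp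
      qed
      show "\<kappa> (vec q (\<Lambda> (m \<oplus>\<^bsub>M\<^esub> m'))) = \<kappa> (vec q (\<Lambda> m)) \<oplus>\<^bsub>N\<^esub> \<kappa> (vec q (\<Lambda> m'))"
        if q: "q \<in> carrier ?D" and m: "m \<in> carrier M" and m': "m' \<in> carrier M" for q m m'
      proof -
        have mm: "m \<oplus>\<^bsub>M\<^esub> m' \<in> carrier M" using m m' by simp
        have "?comb (\<Lambda> (m \<oplus>\<^bsub>M\<^esub> m')) = ?comb (\<lambda>i. \<Lambda> m i \<oplus>\<^bsub>L\<^esub> \<Lambda> m' i)"
          using \<Lambda>m[OF mm] \<Lambda>m[OF m] \<Lambda>m[OF m'] comb_add[OF \<Lambda>[OF m] \<Lambda>[OF m']] by simp
        then have "\<kappa> (vec q (\<Lambda> (m \<oplus>\<^bsub>M\<^esub> m'))) = \<kappa> (vec q (\<lambda>i. \<Lambda> m i \<oplus>\<^bsub>L\<^esub> \<Lambda> m' i))"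
          using \<Lambda>[OF m] \<Lambda>[OF m'] by (intro \<kappa>_cong[OF q \<Lambda>[OF mm]]) auto
        then show ?thesis
          using vec_add[OF q \<Lambda>[OF m] \<Lambda>[OF m']] additive_add[OF \<kappa> vecF[OF q \<Lambda>[OF m]] vecF[OF q \<Lambda>[OF m']]]
          by simp
      qed
      show "\<kappa> (vec (q \<bullet>\<^bsub>?D\<^esub> l) (\<Lambda> m)) = \<kappa> (vec q (\<Lambda> (l \<odot>\<^bsub>M\<^esub> m)))"
        if q: "q \<in> carrier ?D" and l: "l \<in> carrier L" and m: "m \<in> carrier M" for q l m
      proof -
        have lm: "l \<odot>\<^bsub>M\<^esub> m \<in> carrier M" using l m by (rule M.smult_closed)
        have ll: "\<forall>i<n. l \<otimes>\<^bsub>L\<^esub> \<Lambda> m i \<in> carrier L" using l \<Lambda>[OF m] by auto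
        have "?comb (\<lambda>i. l \<otimes>\<^bsub>L\<^esub> \<Lambda> m i) = (\<Oplus>\<^bsub>M\<^esub>i\<in>{..<n}. l \<odot>\<^bsub>M\<^esub> (\<Lambda> m i \<odot>\<^bsub>M\<^esub> e i))"
          using l \<Lambda>[OF m] e \<nu>e[OF \<Lambda>[OF m]]
          by (intro M.M.finsum_cong' refl) (auto simp: M.smult_assoc M.smult_closed)
        also have "\<dots> = l \<odot>\<^bsub>M\<^esub> ?comb (\<Lambda> m)"
          using l \<nu>e[OF \<Lambda>[OF m]] by (intro M.smult_finsum_right[symmetric]) auto
        finally have "?comb (\<lambda>i. l \<otimes>\<^bsub>L\<^esub> \<Lambda> m i) = ?comb (\<Lambda> (l \<odot>\<^bsub>M\<^esub> m))"
          using \<Lambda>m[OF m] \<Lambda>m[OF lm] by simp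
        then have "\<kappa> (vec q (\<lambda>i. l \<otimes>\<^bsub>L\<^esub> \<Lambda> m i)) = \<kappa> (vec q (\<Lambda> (l \<odot>\<^bsub>M\<^esub> m)))"
          by (rule \<kappa>_cong[OF q ll \<Lambda>[OF lm]])
        moreover have "vec (q \<bullet>\<^bsub>?D\<^esub> l) (\<Lambda> m) = vec q (\<lambda>i. l \<otimes>\<^bsub>L\<^esub> \<Lambda> m i)"
          unfolding vec_def using l \<Lambda>[OF m] a \<nu>a[OF \<Lambda>[OF m]]
          by (intro restrict_ext) (auto simp: dual_bimodule_simps(5) P.L.smult_assoc)
        ultimately show ?thesis by simp
      qed
    qed blast
    have h_unit: "h (pure q (e i)) = \<kappa> (vec q (unit i))" if "q \<in> carrier ?D" "i < n" for q i
      unfolding h_pure[OF that(1) e[OF that(2)]]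
      using \<Lambda>m[OF e[OF that(2)]] unit_sum[OF that(2)]
      by (intro \<kappa>_cong[OF that(1) \<Lambda>[OF e[OF that(2)]] unit]) simp
    have sb: "s z \<odot>\<^bsub>?D\<^esub> b (snd z) \<in> carrier ?D" if "z \<in> ?I" for z
      using that s[OF that] b by (intro D.L.smult_closed) auto
    let ?w = "\<lambda>z. vec (s z \<odot>\<^bsub>?D\<^esub> b (snd z)) (unit (fst z))"
    let ?x = "\<Oplus>\<^bsub>?F\<^esub>z\<in>?I. ?w z"
    have w: "?w z \<in> carrier ?F" if "z \<in> ?I" for z using vecF[OF sb[OF that] unit] .
    have x: "?x \<in> carrier ?F" using w by (intro Fn.finsum_closed) auto
    have wz: "?w z z' = s z \<otimes>\<^bsub>R\<^esub> vec (b (snd z)) (unit (fst z)) z'" if "z \<in> ?I" "z' \<in> ?I" for z z'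
      using that \<nu>a[OF unit] by (auto simp: vec_def dual_bimodule_simps(4))
    have "\<kappa> ?x = (\<Oplus>\<^bsub>N\<^esub>z\<in>?I. \<kappa> (?w z))"
      by (rule additive_finsum[OF Fn.abelian_group_axioms N \<kappa> w])
    also have "\<dots> = (\<Oplus>\<^bsub>N\<^esub>z\<in>?I. h (s z \<odot>\<^bsub>T\<^esub> ?E z))"
    proof (intro N.finsum_cong' refl)
      fix z assume z: "z \<in> ?I"
      have "s z \<odot>\<^bsub>T\<^esub> ?E z = pure (s z \<odot>\<^bsub>?D\<^esub> b (snd z)) (e (fst z))"
        using z s[OF z] b e by (intro smult_pure) auto
      then show "\<kappa> (?w z) = h (s z \<odot>\<^bsub>T\<^esub> ?E z)" using h_unit[OF sb[OF z]] z by auto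
    qed (use additive_closed[OF h TM.smult_closed[OF s E]] in auto)
    also have "\<dots> = h (\<Oplus>\<^bsub>T\<^esub>z\<in>?I. s z \<odot>\<^bsub>T\<^esub> ?E z)"
      by (rule additive_finsum[OF T_abelian_group N h TM.smult_closed[OF s E], symmetric])
    also have "\<dots> = \<zero>\<^bsub>N\<^esub>" unfolding s0 by (rule additive_zero[OF T_abelian_group N h])
    finally have xU: "?x \<in> ?U" using \<kappa>0[OF x] by simp
    let ?s = "\<lambda>z\<in>?I. s z"
    \<comment> \<open>\<open>?x\<close> sums the coordinates of the terms of the combination \<open>s\<close>; it differs from \<open>s\<close> by
      the combination \<open>?y\<close> of relations of the first kind.\<close>
    let ?y = "\<lambda>z'\<in>?I. \<Oplus>\<^bsub>R\<^esub>z\<in>?I. s z \<otimes>\<^bsub>R\<^esub> ?rel (Inl z) z'"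
    have rl: "?rel (Inl z) z' \<in> carrier R" if "z \<in> ?I" "z' \<in> ?I" for z z'
      using relR[OF InlI[OF that(1)] that(2)] .
    have y: "?y \<in> carrier ?F" unfolding carrF using s rl by (auto intro!: P.R.R.finsum_closed P.R.R.m_closed)
    have "?y \<in> ?U"
    proof (intro CollectI conjI y exI[of _ "case_sum s (\<lambda>_ :: nat \<times> 'p. \<zero>\<^bsub>R\<^esub>)"] ballI)
      fix z' assume z': "z' \<in> ?I"
      let ?t = "\<lambda>y. case_sum s (\<lambda>_ :: nat \<times> 'p. \<zero>\<^bsub>R\<^esub>) y \<otimes>\<^bsub>R\<^esub> ?rel y z'"
      have l: "?t (Inl z) \<in> carrier R" if "z \<in> ?I" for z using s[OF that] rl[OF that z'] by simp
      have r: "?t (Inr z) = \<zero>\<^bsub>R\<^esub>" if "z \<in> {..<c} \<times> F" for z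
        using relR[OF InrI[OF that] z'] by simp
      have "(\<Oplus>\<^bsub>R\<^esub>y\<in>?J. ?t y) = (\<Oplus>\<^bsub>R\<^esub>z\<in>?I. ?t (Inl z)) \<oplus>\<^bsub>R\<^esub> (\<Oplus>\<^bsub>R\<^esub>z\<in>{..<c} \<times> F. ?t (Inr z))"
      proof (rule P.R.R.finsum_Plus)
        show "?t (Inr z) \<in> carrier R" if "z \<in> {..<c} \<times> F" for z unfolding r[OF that] by simp
      qed (use F l in auto)
      also have "(\<Oplus>\<^bsub>R\<^esub>z\<in>{..<c} \<times> F. ?t (Inr z)) = (\<Oplus>\<^bsub>R\<^esub>z\<in>{..<c} \<times> F. \<zero>\<^bsub>R\<^esub>)"
        by (rule P.R.R.finsum_cong'[OF refl _ r]) auto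
      also have "(\<Oplus>\<^bsub>R\<^esub>z\<in>?I. ?t (Inl z)) \<oplus>\<^bsub>R\<^esub> (\<Oplus>\<^bsub>R\<^esub>z\<in>{..<c} \<times> F. \<zero>\<^bsub>R\<^esub>) = (\<Oplus>\<^bsub>R\<^esub>z\<in>?I. ?t (Inl z))"
        using P.R.R.finsum_closed[of ?t "Inl ` ?I"] l P.R.R.finsum_closed[of "\<lambda>z. ?t (Inl z)" ?I] by (simp add: Pi_def del: sum.case)
      finally show "?y z' = (\<Oplus>\<^bsub>R\<^esub>y\<in>?J. ?t y)" using z' by simp
    qed (use s in auto)
    moreover have "?s = ?x \<oplus>\<^bsub>?F\<^esub> ?y"
    proof (rule F_eqI)
      show "?s \<in> carrier ?F" unfolding carrF using s by auto
      show "?x \<oplus>\<^bsub>?F\<^esub> ?y \<in> carrier ?F" using x y by (rule Fn.a_closed)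
      fix z' assume z': "z' \<in> ?I"
      have vz: "vec (b (snd z)) (unit (fst z)) z' \<in> carrier R" if "z \<in> ?I" for z
        using that vecR[OF b unit z'] by auto
      have "(?x \<oplus>\<^bsub>?F\<^esub> ?y) z' = ?x z' \<oplus>\<^bsub>R\<^esub> ?y z'" by (rule F_add[OF z'])
      also have "?x z' = (\<Oplus>\<^bsub>R\<^esub>z\<in>?I. ?w z z')"
        by (rule additive_finsum[OF Fn.abelian_group_axioms P.R.R.abelian_group_axioms F_eval[OF z'] w])
      also have "\<dots> \<oplus>\<^bsub>R\<^esub> ?y z' = (\<Oplus>\<^bsub>R\<^esub>z\<in>?I. ?w z z' \<oplus>\<^bsub>R\<^esub> s z \<otimes>\<^bsub>R\<^esub> ?rel (Inl z) z')"
        unfolding restrict_apply'[OF z'] using FR[OF w z'] s rl[OF _ z']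
        by (intro P.R.R.finsum_addf[symmetric] Pi_I P.R.R.m_closed)
      also have "\<dots> = (\<Oplus>\<^bsub>R\<^esub>z\<in>?I. if z' = z then s z else \<zero>\<^bsub>R\<^esub>)"
      proof (intro P.R.R.finsum_cong' refl)
        fix z assume z: "z \<in> ?I"
        let ?v = "vec (b (snd z)) (unit (fst z)) z'" and ?d = "if z' = z then \<one>\<^bsub>R\<^esub> else \<zero>\<^bsub>R\<^esub>"
        have "?w z z' \<oplus>\<^bsub>R\<^esub> s z \<otimes>\<^bsub>R\<^esub> ?rel (Inl z) z' = s z \<otimes>\<^bsub>R\<^esub> (?v \<oplus>\<^bsub>R\<^esub> (?d \<ominus>\<^bsub>R\<^esub> ?v))"
          using wz[OF z z'] s[OF z] vz[OF z] by (simp add: P.R.R.r_distr)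
        also have "?v \<oplus>\<^bsub>R\<^esub> (?d \<ominus>\<^bsub>R\<^esub> ?v) = ?d" using vz[OF z]
          by (simp add: a_minus_def P.R.R.a_lcomm P.R.R.r_neg)
        finally show "?w z z' \<oplus>\<^bsub>R\<^esub> s z \<otimes>\<^bsub>R\<^esub> ?rel (Inl z) z' = (if z' = z then s z else \<zero>\<^bsub>R\<^esub>)"
          using s[OF z] by simp
      qed (use s in auto)
      also have "\<dots> = s z'" using z' finI s by (intro P.R.R.finsum_singleton) auto
      finally have "(?x \<oplus>\<^bsub>?F\<^esub> ?y) z' = s z'" .
      then show "?s z' = (?x \<oplus>\<^bsub>?F\<^esub> ?y) z'" by (simp only: restrict_apply'[OF z'])
    qed
    ultimately have "?s \<in> ?U" using subgroup.m_closed[OF U xU] by simp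
    then obtain \<mu> where \<mu>: "\<forall>y\<in>?J. \<mu> y \<in> carrier R" "\<forall>z\<in>?I. ?s z = (\<Oplus>\<^bsub>R\<^esub>y\<in>?J. \<mu> y \<otimes>\<^bsub>R\<^esub> ?rel y z)" by blast
    have "\<forall>z\<in>?I. s z = (\<Oplus>\<^bsub>R\<^esub>y\<in>?J. \<mu> y \<otimes>\<^bsub>R\<^esub> ?rel y z)"
    proof
      fix z assume z: "z \<in> ?I"
      show "s z = (\<Oplus>\<^bsub>R\<^esub>y\<in>?J. \<mu> y \<otimes>\<^bsub>R\<^esub> ?rel y z)"
        using \<mu>(2)[rule_format, OF z] unfolding restrict_apply'[OF z] .
    qed
    with \<mu>(1) show ?thesis by blast
  qed
  show ?thesis
  proof (rule finitely_presented_of_indexed[OF R T_left_module, where e = ?E and rel = ?rel])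
    show "finite ?I" "?I \<noteq> {}" using F cn by auto
    show "finite ?J" "?J \<noteq> {}" using F cn by auto
  qed (fact E gen relR rel0 relgen')+
qed

section \<open>Comparison of two progenerators\<close>

text \<open>
A bimodule map \<open>u\<close> acts on functionals by composition, and this action is compatible with the tensor
relations.
\<close>

lemma left_hom_pullback:
  assumes P: "bimodule L R P" and Q: "bimodule L R Q" and M: "left_module L M"
    and u: "additive_map Q P u" and uL: "\<And>l x. l \<in> carrier L \<Longrightarrow> x \<in> carrier Q \<Longrightarrow> u (l \<odot>\<^bsub>Q\<^esub> x) = l \<odot>\<^bsub>P\<^esub> u x"
    and uR: "\<And>x r. x \<in> carrier Q \<Longrightarrow> r \<in> carrier R \<Longrightarrow> u (x \<bullet>\<^bsub>Q\<^esub> r) = u x \<bullet>\<^bsub>P\<^esub> r"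
  shows "\<exists>f \<in> left_hom R (tensor_product L (dual_bimodule R P) M) (tensor_product L (dual_bimodule R Q) M).
    \<forall>q\<in>carrier (dual_bimodule R P). \<forall>m\<in>carrier M.
      (\<lambda>x\<in>carrier Q. q (u x)) \<in> carrier (dual_bimodule R Q) \<and>
      f (tensor.pure L (dual_bimodule R P) M q m) =
        tensor.pure L (dual_bimodule R Q) M (\<lambda>x\<in>carrier Q. q (u x)) m"
proof -
  let ?DP = "dual_bimodule R P" and ?DQ = "dual_bimodule R Q"
  interpret P: bimodule L R P by fact
  interpret Q: bimodule L R Q by fact
  interpret M: left_module L M by fact
  interpret DP: bimodule R L ?DP by (rule bimodule_dual_bimodule[OF P])
  interpret DQ: bimodule R L ?DQ by (rule bimodule_dual_bimodule[OF Q])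
  interpret TP: tensor R L ?DP M by unfold_locales
  interpret TQ: tensor R L ?DQ M by unfold_locales
  interpret TPM: left_module R TP.T by (rule TP.T_left_module)
  interpret TQM: left_module R TQ.T by (rule TQ.T_left_module)
  let ?u = "\<lambda>q. \<lambda>x\<in>carrier Q. q (u x)"
  have uc: "u x \<in> carrier P" if "x \<in> carrier Q" for x using additive_closed[OF u that] .
  have qc: "q p \<in> carrier R" if "q \<in> carrier ?DP" "p \<in> carrier P" for q p
    using that by (auto simp: dual_bimodule_simps right_hom_regular_iff)
  have pull: "?u q \<in> carrier ?DQ" if "q \<in> carrier ?DP" for q
    using that uc uR additive_add[OF u] Q.R.rsmult_closed
    by (auto simp: dual_bimodule_simps right_hom_regular_iff)
  have pull_add: "?u (p \<oplus>\<^bsub>?DP\<^esub> q) = ?u p \<oplus>\<^bsub>?DQ\<^esub> ?u q" for p q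
    using uc by (auto simp: dual_bimodule_simps(3))
  have pull_rsm: "?u (q \<bullet>\<^bsub>?DP\<^esub> l) = ?u q \<bullet>\<^bsub>?DQ\<^esub> l" if "l \<in> carrier L" for q l
    using uc uL[OF that] Q.L.smult_closed[OF that] by (auto simp: dual_bimodule_simps(5))
  have pull_sm: "?u (r \<odot>\<^bsub>?DP\<^esub> q) = r \<odot>\<^bsub>?DQ\<^esub> ?u q" for r q
    using uc by (auto simp: dual_bimodule_simps(4))
  obtain h where h: "additive_map TP.T TQ.T h"
    and h_pure: "\<And>q m. q \<in> carrier ?DP \<Longrightarrow> m \<in> carrier M \<Longrightarrow> h (TP.pure q m) = TQ.pure (?u q) m"
  proof (rule TP.universal_property[OF TQ.T_abelian_group, of "\<lambda>q m. TQ.pure (?u q) m"])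
    show "TQ.pure (?u q) m \<in> carrier TQ.T" if "q \<in> carrier ?DP" "m \<in> carrier M" for q m
      using pull[OF that(1)] that(2) by (rule TQ.pure_closed)
    show "TQ.pure (?u (p \<oplus>\<^bsub>?DP\<^esub> q)) m = TQ.pure (?u p) m \<oplus>\<^bsub>TQ.T\<^esub> TQ.pure (?u q) m"
      if "p \<in> carrier ?DP" "q \<in> carrier ?DP" "m \<in> carrier M" for p q m
      unfolding pull_add using pull[OF that(1)] pull[OF that(2)] that(3) by (rule TQ.pure_add_left)
    show "TQ.pure (?u q) (m \<oplus>\<^bsub>M\<^esub> m') = TQ.pure (?u q) m \<oplus>\<^bsub>TQ.T\<^esub> TQ.pure (?u q) m'"
      if "q \<in> carrier ?DP" "m \<in> carrier M" "m' \<in> carrier M" for q m m'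
      using pull[OF that(1)] that(2,3) by (rule TQ.pure_add_right)
    show "TQ.pure (?u (q \<bullet>\<^bsub>?DP\<^esub> l)) m = TQ.pure (?u q) (l \<odot>\<^bsub>M\<^esub> m)"
      if "q \<in> carrier ?DP" "l \<in> carrier L" "m \<in> carrier M" for q l m
      unfolding pull_rsm[OF that(2)] using pull[OF that(1)] that(2,3) by (rule TQ.pure_balanced)
  qed blast
  let ?f = "\<lambda>t\<in>carrier TP.T. h t"
  have "h (r \<odot>\<^bsub>TP.T\<^esub> t) = r \<odot>\<^bsub>TQ.T\<^esub> h t" if r: "r \<in> carrier R" and t: "t \<in> carrier TP.T" for r t
  proof (rule TP.additive_eqI[OF TQ.T_abelian_group _ _ _ t])
    show "additive_map TP.T TQ.T (\<lambda>t. h (r \<odot>\<^bsub>TP.T\<^esub> t))" "additive_map TP.T TQ.T (\<lambda>t. r \<odot>\<^bsub>TQ.T\<^esub> h t)"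
      using additive_closed[OF h] additive_add[OF h] additive_closed[OF TP.additive_smult[OF r]]
        additive_add[OF TP.additive_smult[OF r]] additive_closed[OF TQ.additive_smult[OF r]]
        additive_add[OF TQ.additive_smult[OF r]]
      by (simp_all add: additive_map_def)
    fix q m assume q: "q \<in> carrier ?DP" and m: "m \<in> carrier M"
    show "h (r \<odot>\<^bsub>TP.T\<^esub> TP.pure q m) = r \<odot>\<^bsub>TQ.T\<^esub> h (TP.pure q m)"
      unfolding TP.smult_pure[OF r q m] h_pure[OF q m] h_pure[OF DP.L.smult_closed[OF r q] m] pull_sm
      by (rule TQ.smult_pure[OF r pull[OF q] m, symmetric])
  qed
  then have "?f \<in> left_hom R TP.T TQ.T"
    using additive_closed[OF h] additive_add[OF h] additive_closed[OF TP.additive_smult]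
    by (auto simp: left_hom_def)
  moreover have "?f (TP.pure q m) = TQ.pure (?u q) m" if "q \<in> carrier ?DP" "m \<in> carrier M" for q m
    using h_pure[OF that] TP.pure_closed[OF that] by simp
  ultimately show ?thesis using pull by (intro bexI[of _ ?f]) simp_all
qed

text \<open>
The pairing \<open>br\<close> with values in \<open>L\<close> belongs to the Morita context of \<open>P\<close>; the other pairing is the
evaluation of functionals.
\<close>

lemma progenerator_bracket:
  assumes prog: "progenerator L R P"
  obtains br where "\<And>x y. x \<in> carrier P \<Longrightarrow> y \<in> right_hom R P (regular_bimodule R) \<Longrightarrow> br x y \<in> carrier L"
    "\<And>x y p. x \<in> carrier P \<Longrightarrow> y \<in> right_hom R P (regular_bimodule R) \<Longrightarrow> p \<in> carrier P \<Longrightarrow>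
      br x y \<odot>\<^bsub>P\<^esub> p = x \<bullet>\<^bsub>P\<^esub> y p"
proof -
  interpret P: bimodule L R P using prog by (simp add: progenerator_def)
  have "\<exists>l. l \<in> carrier L \<and> (\<forall>p\<in>carrier P. l \<odot>\<^bsub>P\<^esub> p = x \<bullet>\<^bsub>P\<^esub> y p)"
    if x: "x \<in> carrier P" and y: "y \<in> right_hom R P (regular_bimodule R)" for x y
  proof -
    have yc: "y p \<in> carrier R" if "p \<in> carrier P" for p using y that by (auto simp: right_hom_regular_iff)
    have "(\<lambda>p\<in>carrier P. x \<bullet>\<^bsub>P\<^esub> y p) \<in> right_hom R P P"
      using x y yc P.R.rsmult_closed
      by (auto simp: right_hom_def P.R.rsmult_r_distr P.R.rsmult_assoc)
    then obtain l where l: "l \<in> carrier L"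
      "\<And>p. p \<in> carrier P \<Longrightarrow> l \<odot>\<^bsub>P\<^esub> p = (\<lambda>p\<in>carrier P. x \<bullet>\<^bsub>P\<^esub> y p) p"
      using progenerator_endomorphism[OF prog] by blast
    then show ?thesis by (intro exI[of _ l]) simp
  qed
  then have "\<forall>x y. \<exists>l. x \<in> carrier P \<and> y \<in> right_hom R P (regular_bimodule R) \<longrightarrow>
      l \<in> carrier L \<and> (\<forall>p\<in>carrier P. l \<odot>\<^bsub>P\<^esub> p = x \<bullet>\<^bsub>P\<^esub> y p)" by blast
  then obtain br where "\<And>x y. x \<in> carrier P \<and> y \<in> right_hom R P (regular_bimodule R) \<longrightarrow>
      br x y \<in> carrier L \<and> (\<forall>p\<in>carrier P. br x y \<odot>\<^bsub>P\<^esub> p = x \<bullet>\<^bsub>P\<^esub> y p)" by metis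
  then show thesis using that[of br] by blast
qed

text \<open>
Additivity and linearity over \<open>L\<close> hold because \<open>L\<close> acts faithfully on \<open>Q\<close>. Right linearity is then
left linearity for central scalars, because both bimodules are balanced.
\<close>

lemma bracket_map:
  assumes P: "bimodule L (ring_centre L) P" and bP: "centre_balanced L P"
    and Q: "progenerator L (ring_centre L) Q" and bQ: "centre_balanced L Q"
    and y: "y \<in> right_hom (ring_centre L) Q (regular_bimodule (ring_centre L))" and a: "a \<in> carrier P"
    and br: "\<And>x. x \<in> carrier Q \<Longrightarrow> br x \<in> carrier L"
      "\<And>x p. x \<in> carrier Q \<Longrightarrow> p \<in> carrier Q \<Longrightarrow> br x \<odot>\<^bsub>Q\<^esub> p = x \<bullet>\<^bsub>Q\<^esub> y p"
  shows "additive_map Q P (\<lambda>x. br x \<odot>\<^bsub>P\<^esub> a)"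
    and "\<And>l x. l \<in> carrier L \<Longrightarrow> x \<in> carrier Q \<Longrightarrow> br (l \<odot>\<^bsub>Q\<^esub> x) \<odot>\<^bsub>P\<^esub> a = l \<odot>\<^bsub>P\<^esub> (br x \<odot>\<^bsub>P\<^esub> a)"
    and "\<And>x r. x \<in> carrier Q \<Longrightarrow> r \<in> carrier (ring_centre L) \<Longrightarrow> br (x \<bullet>\<^bsub>Q\<^esub> r) \<odot>\<^bsub>P\<^esub> a = (br x \<odot>\<^bsub>P\<^esub> a) \<bullet>\<^bsub>P\<^esub> r"
proof -
  let ?R = "ring_centre L"
  interpret P: bimodule L ?R P by fact
  interpret Q: bimodule L ?R Q using Q by (simp add: progenerator_def)
  have RL: "r \<in> carrier L" if "r \<in> carrier ?R" for r using that by (simp add: ring_centre_def)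
  have yc: "y p \<in> carrier ?R" if "p \<in> carrier Q" for p using y that by (auto simp: right_hom_regular_iff)
  have br_add: "br (x \<oplus>\<^bsub>Q\<^esub> x') = br x \<oplus>\<^bsub>L\<^esub> br x'" if "x \<in> carrier Q" "x' \<in> carrier Q" for x x'
    using that br yc by (intro progenerator_faithful[OF Q]) (auto simp: Q.L.smult_l_distr Q.R.rsmult_l_distr)
  have br_sm: "br (l \<odot>\<^bsub>Q\<^esub> x) = l \<otimes>\<^bsub>L\<^esub> br x" if "l \<in> carrier L" "x \<in> carrier Q" for l x
    using that br yc Q.L.smult_closed
    by (intro progenerator_faithful[OF Q]) (auto simp: Q.L.smult_assoc Q.smult_rsmult)
  show "additive_map Q P (\<lambda>x. br x \<odot>\<^bsub>P\<^esub> a)"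
    using br a P.L.smult_closed by (auto simp: additive_map_def br_add P.L.smult_l_distr)
  show lin: "br (l \<odot>\<^bsub>Q\<^esub> x) \<odot>\<^bsub>P\<^esub> a = l \<odot>\<^bsub>P\<^esub> (br x \<odot>\<^bsub>P\<^esub> a)" if "l \<in> carrier L" "x \<in> carrier Q" for l x
    using that br a by (simp add: br_sm P.L.smult_assoc)
  show "br (x \<bullet>\<^bsub>Q\<^esub> r) \<odot>\<^bsub>P\<^esub> a = (br x \<odot>\<^bsub>P\<^esub> a) \<bullet>\<^bsub>P\<^esub> r" if x: "x \<in> carrier Q" and r: "r \<in> carrier ?R" for x r
  proof -
    have "x \<bullet>\<^bsub>Q\<^esub> r = r \<odot>\<^bsub>Q\<^esub> x" using bQ x r by (simp add: centre_balanced_def)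
    moreover have "br x \<odot>\<^bsub>P\<^esub> a \<in> carrier P" using br x a P.L.smult_closed by simp
    then have "r \<odot>\<^bsub>P\<^esub> (br x \<odot>\<^bsub>P\<^esub> a) = (br x \<odot>\<^bsub>P\<^esub> a) \<bullet>\<^bsub>P\<^esub> r" using bP r by (simp add: centre_balanced_def)
    ultimately show ?thesis using lin[OF RL[OF r] x] by simp
  qed
qed

text \<open>
The maps $u_{jk}$, $v_{jk}$ and the central elements $z_{jk}$, for \<open>s\<close> ranging over the pairs
$(j,k)$. They exhibit \<open>P\<close> and \<open>Q\<close> as isomorphic bimodules wherever $z_s$ is invertible.
\<close>

lemma balanced_progenerators_local_maps:
  fixes P :: "('a, 'p, 'a, 'y) bimodule_scheme" and Q :: "('a, 'q, 'a, 'z) bimodule_scheme"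
  assumes P: "progenerator L (ring_centre L) P" and bP: "centre_balanced L P"
    and Q: "progenerator L (ring_centre L) Q" and bQ: "centre_balanced L Q"
  obtains S :: "('p \<times> nat) set" and u v z where "finite S"
    "\<And>s. s \<in> S \<Longrightarrow> additive_map Q P (u s)"
    "\<And>s l x. s \<in> S \<Longrightarrow> l \<in> carrier L \<Longrightarrow> x \<in> carrier Q \<Longrightarrow> u s (l \<odot>\<^bsub>Q\<^esub> x) = l \<odot>\<^bsub>P\<^esub> u s x"
    "\<And>s x r. s \<in> S \<Longrightarrow> x \<in> carrier Q \<Longrightarrow> r \<in> carrier (ring_centre L) \<Longrightarrow> u s (x \<bullet>\<^bsub>Q\<^esub> r) = u s x \<bullet>\<^bsub>P\<^esub> r"
    "\<And>s. s \<in> S \<Longrightarrow> additive_map P Q (v s)"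
    "\<And>s l x. s \<in> S \<Longrightarrow> l \<in> carrier L \<Longrightarrow> x \<in> carrier P \<Longrightarrow> v s (l \<odot>\<^bsub>P\<^esub> x) = l \<odot>\<^bsub>Q\<^esub> v s x"
    "\<And>s x r. s \<in> S \<Longrightarrow> x \<in> carrier P \<Longrightarrow> r \<in> carrier (ring_centre L) \<Longrightarrow> v s (x \<bullet>\<^bsub>P\<^esub> r) = v s x \<bullet>\<^bsub>Q\<^esub> r"
    "\<And>s. s \<in> S \<Longrightarrow> z s \<in> carrier (ring_centre L)"
    "\<And>s x. s \<in> S \<Longrightarrow> x \<in> carrier Q \<Longrightarrow> v s (u s x) = x \<bullet>\<^bsub>Q\<^esub> z s"
    "(\<Oplus>\<^bsub>ring_centre L\<^esub>s\<in>S. z s) = \<one>\<^bsub>ring_centre L\<^esub>"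
proof -
  let ?R = "ring_centre L"
  have bimP: "bimodule L ?R P" and bimQ: "bimodule L ?R Q" using P Q by (auto simp: progenerator_def)
  have progP: "right_progenerator ?R P" and progQ: "right_progenerator ?R Q"
    using P Q by (auto simp: progenerator_def)
  interpret P: bimodule L ?R P by fact
  interpret Q: bimodule L ?R Q by fact
  interpret R: cring ?R by (rule cring_ring_centre[OF P.L.R.ring_axioms])
  have RL: "r \<in> carrier L" if "r \<in> carrier ?R" for r using that by (simp add: ring_centre_def)
  obtain F :: "'p set" and a b where F: "finite F" and a: "\<And>j. j \<in> F \<Longrightarrow> a j \<in> carrier P"
    and b: "\<And>j. j \<in> F \<Longrightarrow> b j \<in> right_hom ?R P (regular_bimodule ?R)"
    and ab: "\<And>p. p \<in> carrier P \<Longrightarrow> p = (\<Oplus>\<^bsub>P\<^esub>j\<in>F. a j \<bullet>\<^bsub>P\<^esub> b j p)"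
    by (rule right_progenerator_dual_basis[OF progP]) (rule that)
  obtain n :: nat and x y where x: "\<And>k. k < n \<Longrightarrow> x k \<in> carrier Q"
    and y: "\<And>k. k < n \<Longrightarrow> y k \<in> right_hom ?R Q (regular_bimodule ?R)"
    and xy: "(\<Oplus>\<^bsub>?R\<^esub>k\<in>{..<n}. y k (x k)) = \<one>\<^bsub>?R\<^esub>"
    by (rule right_progenerator_trace[OF progQ]) (rule that)
  obtain bp where bp: "\<And>p q. p \<in> carrier P \<Longrightarrow> q \<in> right_hom ?R P (regular_bimodule ?R) \<Longrightarrow> bp p q \<in> carrier L"
    "\<And>p q p'. p \<in> carrier P \<Longrightarrow> q \<in> right_hom ?R P (regular_bimodule ?R) \<Longrightarrow> p' \<in> carrier P \<Longrightarrow>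
      bp p q \<odot>\<^bsub>P\<^esub> p' = p \<bullet>\<^bsub>P\<^esub> q p'"
    by (rule progenerator_bracket[OF P]) (rule that)
  obtain bq where bq: "\<And>p q. p \<in> carrier Q \<Longrightarrow> q \<in> right_hom ?R Q (regular_bimodule ?R) \<Longrightarrow> bq p q \<in> carrier L"
    "\<And>p q p'. p \<in> carrier Q \<Longrightarrow> q \<in> right_hom ?R Q (regular_bimodule ?R) \<Longrightarrow> p' \<in> carrier Q \<Longrightarrow>
      bq p q \<odot>\<^bsub>Q\<^esub> p' = p \<bullet>\<^bsub>Q\<^esub> q p'"
    by (rule progenerator_bracket[OF Q]) (rule that)
  \<comment> \<open>The composite $v_s u_s$ is $x \mapsto [x,y_k] [a_j,b_j] x_k$, because $v_s$ is linear over \<open>L\<close>.\<close>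
  define S where "S = F \<times> {..<n}"
  define u where "u s p = bq p (y (snd s)) \<odot>\<^bsub>P\<^esub> a (fst s)" for s and p :: 'q
  define v where "v s p = bp p (b (fst s)) \<odot>\<^bsub>Q\<^esub> x (snd s)" for s and p :: 'p
  have s: "a (fst s) \<in> carrier P" "b (fst s) \<in> right_hom ?R P (regular_bimodule ?R)"
    "x (snd s) \<in> carrier Q" "y (snd s) \<in> right_hom ?R Q (regular_bimodule ?R)" if "s \<in> S" for s
    using that a b x y by (auto simp: S_def)
  have u1: "additive_map Q P (u s)"
    and u2: "\<And>l x. l \<in> carrier L \<Longrightarrow> x \<in> carrier Q \<Longrightarrow> u s (l \<odot>\<^bsub>Q\<^esub> x) = l \<odot>\<^bsub>P\<^esub> u s x"
    and u3: "\<And>x r. x \<in> carrier Q \<Longrightarrow> r \<in> carrier ?R \<Longrightarrow> u s (x \<bullet>\<^bsub>Q\<^esub> r) = u s x \<bullet>\<^bsub>P\<^esub> r" if "s \<in> S" for s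
    using bracket_map[OF bimP bP Q bQ s(4)[OF that] s(1)[OF that], of "\<lambda>p. bq p (y (snd s))"] bq s(4)[OF that]
    unfolding u_def by blast+
  have v1: "additive_map P Q (v s)"
    and v2: "\<And>l x. l \<in> carrier L \<Longrightarrow> x \<in> carrier P \<Longrightarrow> v s (l \<odot>\<^bsub>P\<^esub> x) = l \<odot>\<^bsub>Q\<^esub> v s x"
    and v3: "\<And>x r. x \<in> carrier P \<Longrightarrow> r \<in> carrier ?R \<Longrightarrow> v s (x \<bullet>\<^bsub>P\<^esub> r) = v s x \<bullet>\<^bsub>Q\<^esub> r" if "s \<in> S" for s
    using bracket_map[OF bimQ bQ P bP s(2)[OF that] s(3)[OF that], of "\<lambda>p. bp p (b (fst s))"] bp s(2)[OF that]
    unfolding v_def by blast+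
  have uc: "u s p \<in> carrier P" if "s \<in> S" "p \<in> carrier Q" for s p using additive_closed[OF u1] that by blast
  have vc: "v s p \<in> carrier Q" if "s \<in> S" "p \<in> carrier P" for s p using additive_closed[OF v1] that by blast
  have vu: "\<exists>l. l \<in> carrier ?R \<and> (\<forall>p\<in>carrier Q. l \<odot>\<^bsub>Q\<^esub> p = v s (u s p))" if sS: "s \<in> S" for s
  proof -
    have "(\<lambda>p\<in>carrier Q. v s (u s p)) \<in> right_hom ?R Q Q"
      using uc[OF sS] vc[OF sS] u3[OF sS] v3[OF sS] additive_add[OF u1[OF sS]] additive_add[OF v1[OF sS]]
        Q.R.rsmult_closed by (auto simp: right_hom_def)
    then obtain l where l: "l \<in> carrier L" "\<And>p. p \<in> carrier Q \<Longrightarrow> l \<odot>\<^bsub>Q\<^esub> p = (\<lambda>p\<in>carrier Q. v s (u s p)) p"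
      using progenerator_endomorphism[OF Q] by blast
    have lp: "l \<odot>\<^bsub>Q\<^esub> p = v s (u s p)" if "p \<in> carrier Q" for p using l(2)[OF that] that by simp
    have "l \<otimes>\<^bsub>L\<^esub> l' = l' \<otimes>\<^bsub>L\<^esub> l" if l': "l' \<in> carrier L" for l'
    proof (rule progenerator_faithful[OF Q])
      fix p assume p: "p \<in> carrier Q"
      have "(l \<otimes>\<^bsub>L\<^esub> l') \<odot>\<^bsub>Q\<^esub> p = v s (u s (l' \<odot>\<^bsub>Q\<^esub> p))"
        using l(1) l' p lp[OF Q.L.smult_closed[OF l' p]] by (simp add: Q.L.smult_assoc)
      also have "\<dots> = l' \<odot>\<^bsub>Q\<^esub> v s (u s p)" using u2[OF sS l' p] v2[OF sS l' uc[OF sS p]] by simp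
      also have "\<dots> = (l' \<otimes>\<^bsub>L\<^esub> l) \<odot>\<^bsub>Q\<^esub> p" using l(1) l' p lp[OF p] by (simp add: Q.L.smult_assoc)
      finally show "(l \<otimes>\<^bsub>L\<^esub> l') \<odot>\<^bsub>Q\<^esub> p = (l' \<otimes>\<^bsub>L\<^esub> l) \<odot>\<^bsub>Q\<^esub> p" .
    qed (use l(1) l' in auto)
    then show ?thesis using l(1) lp by (auto simp: ring_centre_def)
  qed
  then have "\<forall>s. \<exists>l. s \<in> S \<longrightarrow> l \<in> carrier ?R \<and> (\<forall>p\<in>carrier Q. l \<odot>\<^bsub>Q\<^esub> p = v s (u s p))" by blast
  then obtain z where "\<And>s. s \<in> S \<longrightarrow> z s \<in> carrier ?R \<and> (\<forall>p\<in>carrier Q. z s \<odot>\<^bsub>Q\<^esub> p = v s (u s p))" by metis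
  then have z: "\<And>s. s \<in> S \<Longrightarrow> z s \<in> carrier ?R"
    and zs: "\<And>s p. s \<in> S \<Longrightarrow> p \<in> carrier Q \<Longrightarrow> z s \<odot>\<^bsub>Q\<^esub> p = v s (u s p)" by auto
  have zr: "v s (u s p) = p \<bullet>\<^bsub>Q\<^esub> z s" if "s \<in> S" "p \<in> carrier Q" for s p
    using zs[OF that] z[OF that(1)] that(2) bQ by (simp add: centre_balanced_def)
  have one: "(\<Oplus>\<^bsub>L\<^esub>j\<in>F. bp (a j) (b j)) = \<one>\<^bsub>L\<^esub>"
  proof (rule progenerator_faithful[OF P])
    fix p assume p: "p \<in> carrier P"
    have "(\<Oplus>\<^bsub>L\<^esub>j\<in>F. bp (a j) (b j)) \<odot>\<^bsub>P\<^esub> p = (\<Oplus>\<^bsub>P\<^esub>j\<in>F. bp (a j) (b j) \<odot>\<^bsub>P\<^esub> p)"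
      using p bp a b by (intro P.L.smult_finsum_left) auto
    also have "\<dots> = (\<Oplus>\<^bsub>P\<^esub>j\<in>F. a j \<bullet>\<^bsub>P\<^esub> b j p)"
      using p bp a b P.L.smult_closed[OF bp(1)]
      by (intro P.L.M.finsum_cong' refl) (auto intro!: P.R.rsmult_closed simp: right_hom_regular_iff)
    also have "\<dots> = \<one>\<^bsub>L\<^esub> \<odot>\<^bsub>P\<^esub> p" using ab[OF p] p by (simp add: P.L.smult_one)
    finally show "(\<Oplus>\<^bsub>L\<^esub>j\<in>F. bp (a j) (b j)) \<odot>\<^bsub>P\<^esub> p = \<one>\<^bsub>L\<^esub> \<odot>\<^bsub>P\<^esub> p" .
  qed (use bp a b in \<open>auto intro!: P.L.R.finsum_closed\<close>)
  have incl: "additive_map ?R L (\<lambda>r. r)" by (auto simp: additive_map_def ring_centre_def)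
  have sumL: "(\<Oplus>\<^bsub>?R\<^esub>s\<in>S. z s) = (\<Oplus>\<^bsub>L\<^esub>s\<in>S. z s)"
    by (rule additive_finsum[OF P.R.R.abelian_group_axioms P.L.R.abelian_group_axioms incl]) (rule z)
  have "(\<Oplus>\<^bsub>L\<^esub>s\<in>S. z s) = \<one>\<^bsub>L\<^esub>"
  proof (rule progenerator_faithful[OF Q])
    fix p assume p: "p \<in> carrier Q"
    have yx: "y k (x k) \<in> carrier ?R" if "k < n" for k
      using additive_closed[OF right_hom_additive[OF y[OF that]] x[OF that]] by simp
    have bqp: "bq p (y k) \<in> carrier L" if "k < n" for k using bq(1)[OF p y[OF that]] .
    have bab: "bp (a j) (b j) \<in> carrier L" if "j \<in> F" for j using bp(1)[OF a b] that by blast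
    have t: "bq p (y k) \<odot>\<^bsub>Q\<^esub> (bp (a j) (b j) \<odot>\<^bsub>Q\<^esub> x k) \<in> carrier Q" if "j \<in> F" "k < n" for j k
      using that bqp bab x by (intro Q.L.smult_closed) auto
    have vu': "v (j, k) (u (j, k) p) = bq p (y k) \<odot>\<^bsub>Q\<^esub> (bp (a j) (b j) \<odot>\<^bsub>Q\<^esub> x k)" if "j \<in> F" "k < n" for j k
    proof -
      have jk: "(j, k) \<in> S" using that by (simp add: S_def)
      have "v (j, k) (u (j, k) p) = v (j, k) (bq p (y k) \<odot>\<^bsub>P\<^esub> a j)" by (simp add: u_def)
      also have "\<dots> = bq p (y k) \<odot>\<^bsub>Q\<^esub> v (j, k) (a j)" using v2[OF jk bqp[OF that(2)] a[OF that(1)]] .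
      finally show ?thesis by (simp add: v_def)
    qed
    have "(\<Oplus>\<^bsub>L\<^esub>s\<in>S. z s) \<odot>\<^bsub>Q\<^esub> p = (\<Oplus>\<^bsub>Q\<^esub>s\<in>S. z s \<odot>\<^bsub>Q\<^esub> p)"
      using p z RL by (intro Q.L.smult_finsum_left) auto
    also have "\<dots> = (\<Oplus>\<^bsub>Q\<^esub>s\<in>F \<times> {..<n}. bq p (y (snd s)) \<odot>\<^bsub>Q\<^esub> (bp (a (fst s)) (b (fst s)) \<odot>\<^bsub>Q\<^esub> x (snd s)))"
      using p zs vu' t by (intro Q.L.M.finsum_cong') (auto simp: S_def)
    also have "\<dots> = (\<Oplus>\<^bsub>Q\<^esub>j\<in>F. \<Oplus>\<^bsub>Q\<^esub>k\<in>{..<n}. bq p (y k) \<odot>\<^bsub>Q\<^esub> (bp (a j) (b j) \<odot>\<^bsub>Q\<^esub> x k))"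
      using F t by (intro Q.L.M.finsum_Times) auto
    also have "\<dots> = (\<Oplus>\<^bsub>Q\<^esub>k\<in>{..<n}. \<Oplus>\<^bsub>Q\<^esub>j\<in>F. bq p (y k) \<odot>\<^bsub>Q\<^esub> (bp (a j) (b j) \<odot>\<^bsub>Q\<^esub> x k))"
      using F t by (intro Q.L.M.finsum_swap) auto
    also have "\<dots> = (\<Oplus>\<^bsub>Q\<^esub>k\<in>{..<n}. p \<bullet>\<^bsub>Q\<^esub> y k (x k))"
    proof (intro Q.L.M.finsum_cong' refl)
      fix k assume k: "k \<in> {..<n}"
      have bx: "bp (a j) (b j) \<odot>\<^bsub>Q\<^esub> x k \<in> carrier Q" if "j \<in> F" for j
        using that k bab x by (intro Q.L.smult_closed) auto
      have "(\<Oplus>\<^bsub>Q\<^esub>j\<in>F. bq p (y k) \<odot>\<^bsub>Q\<^esub> (bp (a j) (b j) \<odot>\<^bsub>Q\<^esub> x k)) =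
          bq p (y k) \<odot>\<^bsub>Q\<^esub> (\<Oplus>\<^bsub>Q\<^esub>j\<in>F. bp (a j) (b j) \<odot>\<^bsub>Q\<^esub> x k)"
        using k bqp bx by (intro Q.L.smult_finsum_right[symmetric]) auto
      also have "(\<Oplus>\<^bsub>Q\<^esub>j\<in>F. bp (a j) (b j) \<odot>\<^bsub>Q\<^esub> x k) = (\<Oplus>\<^bsub>L\<^esub>j\<in>F. bp (a j) (b j)) \<odot>\<^bsub>Q\<^esub> x k"
        using k x bab by (intro Q.L.smult_finsum_left[symmetric]) auto
      also have "\<dots> = x k" using k x by (simp add: one Q.L.smult_one)
      also have "bq p (y k) \<odot>\<^bsub>Q\<^esub> x k = p \<bullet>\<^bsub>Q\<^esub> y k (x k)" using k bq(2)[OF p y x] by simp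
      finally show "(\<Oplus>\<^bsub>Q\<^esub>j\<in>F. bq p (y k) \<odot>\<^bsub>Q\<^esub> (bp (a j) (b j) \<odot>\<^bsub>Q\<^esub> x k)) = p \<bullet>\<^bsub>Q\<^esub> y k (x k)" .
    qed (use p yx in \<open>auto intro!: Q.R.rsmult_closed\<close>)
    also have "\<dots> = p \<bullet>\<^bsub>Q\<^esub> (\<Oplus>\<^bsub>?R\<^esub>k\<in>{..<n}. y k (x k))"
      using p yx by (intro Q.R.rsmult_finsum_right[symmetric]) auto
    also have "\<dots> = \<one>\<^bsub>L\<^esub> \<odot>\<^bsub>Q\<^esub> p" unfolding xy using p by (simp add: Q.R.rsmult_one Q.L.smult_one)
    finally show "(\<Oplus>\<^bsub>L\<^esub>s\<in>S. z s) \<odot>\<^bsub>Q\<^esub> p = \<one>\<^bsub>L\<^esub> \<odot>\<^bsub>Q\<^esub> p" .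
  qed (use z RL in \<open>auto intro!: P.L.R.finsum_closed\<close>)
  then have sum1: "(\<Oplus>\<^bsub>?R\<^esub>s\<in>S. z s) = \<one>\<^bsub>?R\<^esub>" unfolding sumL by (simp add: ring_centre_def)
  have finS: "finite S" using F by (simp add: S_def)
  show thesis by (rule that[of S u v z]) (fact finS u1 u2 u3 v1 v2 v3 z zr sum1)+
qed

lemma fitting_invariant_subset:
  fixes P :: "('a, 'p, 'a, 'y) bimodule_scheme" and Q :: "('a, 'q, 'a, 'z) bimodule_scheme"
  assumes L: "ring L" and M: "left_module L M" and fp: "finitely_presented L M"
    and P: "progenerator L (ring_centre L) P" and bP: "centre_balanced L P"
    and Q: "progenerator L (ring_centre L) Q" and bQ: "centre_balanced L Q"
  shows "fitting_invariant L P M \<subseteq> fitting_invariant L Q M"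
proof -
  let ?R = "ring_centre L"
  let ?DP = "dual_bimodule ?R P" and ?DQ = "dual_bimodule ?R Q"
  have bimP: "bimodule L ?R P" and bimQ: "bimodule L ?R Q" using P Q by (auto simp: progenerator_def)
  interpret R: cring ?R by (rule cring_ring_centre[OF L])
  interpret P: bimodule L ?R P by fact
  interpret Q: bimodule L ?R Q by fact
  interpret M: left_module L M by fact
  interpret DP: bimodule ?R L ?DP by (rule bimodule_dual_bimodule[OF bimP])
  interpret DQ: bimodule ?R L ?DQ by (rule bimodule_dual_bimodule[OF bimQ])
  interpret TP: tensor ?R L ?DP M by unfold_locales
  interpret TQ: tensor ?R L ?DQ M by unfold_locales
  have fpP: "finitely_presented ?R TP.T" and fpQ: "finitely_presented ?R TQ.T"
    using finitely_presented_dual_tensor[OF bimP _ M fp] finitely_presented_dual_tensor[OF bimQ _ M fp] P Q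
    by (auto simp: progenerator_def)
  obtain b e where e: "spans ?R TP.T b e"
    using fpP presents_of_finite_presentation[OF R.ring_axioms TP.T_left_module]
    unfolding finitely_presented_def presents_def by blast
  obtain b' e' where e': "spans ?R TQ.T b' e'"
    using fpQ presents_of_finite_presentation[OF R.ring_axioms TQ.T_left_module]
    unfolding finitely_presented_def presents_def by blast
  obtain S :: "('p \<times> nat) set" and u v z where S: "finite S"
    and u1: "\<And>s. s \<in> S \<Longrightarrow> additive_map Q P (u s)"
    and u2: "\<And>s l x. s \<in> S \<Longrightarrow> l \<in> carrier L \<Longrightarrow> x \<in> carrier Q \<Longrightarrow> u s (l \<odot>\<^bsub>Q\<^esub> x) = l \<odot>\<^bsub>P\<^esub> u s x"
    and u3: "\<And>s x r. s \<in> S \<Longrightarrow> x \<in> carrier Q \<Longrightarrow> r \<in> carrier ?R \<Longrightarrow> u s (x \<bullet>\<^bsub>Q\<^esub> r) = u s x \<bullet>\<^bsub>P\<^esub> r"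
    and v1: "\<And>s. s \<in> S \<Longrightarrow> additive_map P Q (v s)"
    and v2: "\<And>s l x. s \<in> S \<Longrightarrow> l \<in> carrier L \<Longrightarrow> x \<in> carrier P \<Longrightarrow> v s (l \<odot>\<^bsub>P\<^esub> x) = l \<odot>\<^bsub>Q\<^esub> v s x"
    and v3: "\<And>s x r. s \<in> S \<Longrightarrow> x \<in> carrier P \<Longrightarrow> r \<in> carrier ?R \<Longrightarrow> v s (x \<bullet>\<^bsub>P\<^esub> r) = v s x \<bullet>\<^bsub>Q\<^esub> r"
    and z: "\<And>s. s \<in> S \<Longrightarrow> z s \<in> carrier ?R"
    and vu: "\<And>s x. s \<in> S \<Longrightarrow> x \<in> carrier Q \<Longrightarrow> v s (u s x) = x \<bullet>\<^bsub>Q\<^esub> z s"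
    and sum1: "(\<Oplus>\<^bsub>?R\<^esub>s\<in>S. z s) = \<one>\<^bsub>?R\<^esub>"
    by (rule balanced_progenerators_local_maps[OF P bP Q bQ]) (rule that)
  have "\<forall>s\<in>S. \<exists>f\<in>left_hom ?R TP.T TQ.T. \<forall>q\<in>carrier ?DP. \<forall>m\<in>carrier M.
      (\<lambda>x\<in>carrier Q. q (u s x)) \<in> carrier ?DQ \<and> f (TP.pure q m) = TQ.pure (\<lambda>x\<in>carrier Q. q (u s x)) m"
    by (rule ballI, rule left_hom_pullback[OF bimP bimQ M u1 u2 u3])
  from bchoice[OF this[unfolded Bex_def]] obtain f where f_all: "\<forall>s\<in>S. f s \<in> left_hom ?R TP.T TQ.T \<and>
      (\<forall>q\<in>carrier ?DP. \<forall>m\<in>carrier M. (\<lambda>x\<in>carrier Q. q (u s x)) \<in> carrier ?DQ \<and>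
        f s (TP.pure q m) = TQ.pure (\<lambda>x\<in>carrier Q. q (u s x)) m)" by (rule exE)
  have f: "f s \<in> left_hom ?R TP.T TQ.T" if "s \<in> S" for s using f_all that by simp
  have "\<forall>s\<in>S. \<exists>g\<in>left_hom ?R TQ.T TP.T. \<forall>q\<in>carrier ?DQ. \<forall>m\<in>carrier M.
      (\<lambda>x\<in>carrier P. q (v s x)) \<in> carrier ?DP \<and> g (TQ.pure q m) = TP.pure (\<lambda>x\<in>carrier P. q (v s x)) m"
    by (rule ballI, rule left_hom_pullback[OF bimQ bimP M v1 v2 v3])
  from bchoice[OF this[unfolded Bex_def]] obtain g where g_all: "\<forall>s\<in>S. g s \<in> left_hom ?R TQ.T TP.T \<and>
      (\<forall>q\<in>carrier ?DQ. \<forall>m\<in>carrier M. (\<lambda>x\<in>carrier P. q (v s x)) \<in> carrier ?DP \<and>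
        g s (TQ.pure q m) = TP.pure (\<lambda>x\<in>carrier P. q (v s x)) m)" by (rule exE)
  have g: "g s \<in> left_hom ?R TQ.T TP.T" if "s \<in> S" for s using g_all that by simp
  have fg: "f s (g s t) = z s \<odot>\<^bsub>TQ.T\<^esub> t" if s: "s \<in> S" and t: "t \<in> carrier TQ.T" for s t
  proof (rule TQ.additive_eqI[OF TQ.T_abelian_group _ TQ.additive_smult[OF z[OF s]] _ t])
    note F = left_hom_additive[OF f[OF s]] and G = left_hom_additive[OF g[OF s]]
    show "additive_map TQ.T TQ.T (\<lambda>t. f s (g s t))"
      using additive_closed[OF F] additive_closed[OF G] additive_add[OF F] additive_add[OF G]
      by (simp add: additive_map_def)
    fix q m assume q: "q \<in> carrier ?DQ" and m: "m \<in> carrier M"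
    have q': "q (x \<bullet>\<^bsub>Q\<^esub> r) = q x \<otimes>\<^bsub>?R\<^esub> r" "q x \<in> carrier ?R" if "x \<in> carrier Q" "r \<in> carrier ?R" for x r
      using q that by (auto simp: dual_bimodule_simps right_hom_regular_iff)
    have "(\<lambda>x\<in>carrier Q. (\<lambda>p\<in>carrier P. q (v s p)) (u s x)) = z s \<odot>\<^bsub>?DQ\<^esub> q"
      unfolding dual_bimodule_simps(4)
    proof (rule restrict_ext)
      fix x assume x: "x \<in> carrier Q"
      have "(\<lambda>p\<in>carrier P. q (v s p)) (u s x) = q (v s (u s x))"
        using additive_closed[OF u1[OF s] x] by simp
      also have "\<dots> = q x \<otimes>\<^bsub>?R\<^esub> z s" using vu[OF s x] q'(1)[OF x z[OF s]] by simp
      also have "\<dots> = z s \<otimes>\<^bsub>?R\<^esub> q x" using q'(2)[OF x z[OF s]] z[OF s] by (rule R.m_comm)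
      finally show "(\<lambda>p\<in>carrier P. q (v s p)) (u s x) = z s \<otimes>\<^bsub>?R\<^esub> q x" .
    qed
    then show "f s (g s (TQ.pure q m)) = z s \<odot>\<^bsub>TQ.T\<^esub> TQ.pure q m"
      using f_all s g_all q m TQ.smult_pure[OF z[OF s] q m] by simp
  qed
  have "family_fitting ?R TP.T b e \<subseteq> family_fitting ?R TQ.T b' e'"
    by (rule R.family_fitting_subset_of_local_maps[OF TP.T_left_module TQ.T_left_module e e' S f g z sum1 fg])
  then show ?thesis
    unfolding fitting_invariant_def dual_tensor_def
      R.fitting_ideal_eq_family_fitting[OF TP.T_left_module fpP e]
      R.fitting_ideal_eq_family_fitting[OF TQ.T_left_module fpQ e'] .
qed

theorem propositionA7:
  fixes \<Lambda> :: "('a, 'x) ring_scheme"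
    and M :: "('a, 'm) module"
  assumes "ring \<Lambda>"
    and "morita_equivalent \<Lambda> (ring_centre \<Lambda>)"
    and "left_module \<Lambda> M"
    and "finitely_presented \<Lambda> M"
  shows "(\<forall>P :: ('a, 'p, 'a) bimodule. progenerator \<Lambda> (ring_centre \<Lambda>) P \<longrightarrow>
            finitely_presented (ring_centre \<Lambda>) (dual_tensor \<Lambda> P M)) \<and>
         (\<forall>(P :: ('a, 'p, 'a) bimodule) (Q :: ('a, 'q, 'a) bimodule).
            progenerator \<Lambda> (ring_centre \<Lambda>) P \<and> centre_balanced \<Lambda> P \<and>
            progenerator \<Lambda> (ring_centre \<Lambda>) Q \<and> centre_balanced \<Lambda> Q \<longrightarrow>
            fitting_invariant \<Lambda> P M = fitting_invariant \<Lambda> Q M)"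
proof (intro conjI allI impI)
  fix P :: "('a, 'p, 'a) bimodule" assume "progenerator \<Lambda> (ring_centre \<Lambda>) P"
  then show "finitely_presented (ring_centre \<Lambda>) (dual_tensor \<Lambda> P M)"
    unfolding dual_tensor_def using assms(3,4)
    by (intro finitely_presented_dual_tensor) (auto simp: progenerator_def)
next
  fix P :: "('a, 'p, 'a) bimodule" and Q :: "('a, 'q, 'a) bimodule"
  assume *: "progenerator \<Lambda> (ring_centre \<Lambda>) P \<and> centre_balanced \<Lambda> P \<and>
    progenerator \<Lambda> (ring_centre \<Lambda>) Q \<and> centre_balanced \<Lambda> Q"
  show "fitting_invariant \<Lambda> P M = fitting_invariant \<Lambda> Q M"
  proof
    show "fitting_invariant \<Lambda> P M \<subseteq> fitting_invariant \<Lambda> Q M"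
      using * by (intro fitting_invariant_subset[OF assms(1,3,4)]) auto
    show "fitting_invariant \<Lambda> Q M \<subseteq> fitting_invariant \<Lambda> P M"
      using * by (intro fitting_invariant_subset[OF assms(1,3,4)]) auto
  qed
qed

end
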